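(* (Uniform approximation of expected empirical gradient by population gradient.) Let $\varepsilon_1 = \frac{1}{2\sqrt{\|\Sigma\|_{\mathrm{op}}}}\left(\frac{1}{16} - \sqrt{\sigma_1(M\Sigma^{1/2})}\right)$. There exists a constant $C$ depending on $M$ and $\Sigma$ such that any $\theta$ which is $\varepsilon_1$-close (in the $P$-norm) to $\mathcal{S}$ satisfies $$\|\mathbb{E}[\nabla\hat Q(\theta)] - \nabla Q(\theta)\|_F^2 \le C n^{-2}\log^6 n$$ for sufficiently large $n$.
   Context: Covariates $x_i\in\mathbb{R}^d$ i.i.d. $\mathcal{N}(0,\Sigma)$, $y_i = Mx_i+z_i$ with $z_i$ i.i.d. $\mathcal{N}(0,\Omega)$; $\theta=(A,B)$, $A\in\mathbb{R}^{p\times d}$, $B\in\mathbb{R}^{d\times d}$. Assumptions: $\Sigma$ full rank, $p\ge d$, $M\Sigma^{1/2}$ full column rank, $\|M\Sigma^{1/2}\|_{\mathrm{op}}<1/16$. Empirical loss $\hat L(\theta)=\frac{1}{2n}\sum_i\left\|A\frac{\sum_j\exp(x_i^{\top}Bx_j)x_j}{\sum_j\exp(x_i^{\top}Bx_j)}-y_i\right\|_2^2$; population loss $L(\theta)=\frac12\mathbb{E}\left\|A\frac{\mathbb{E}_{x_2}[\exp(x_1^{\top}Bx_2)x_2]}{\mathbb{E}_{x_2}[\exp(x_1^{\top}Bx_2)]}-(Mx_1+z_1)\right\|_2^2$. $R(\theta)=\frac18\|\Sigma^{1/2}(A^{\top}A-B^{\top}\Sigma B)\Sigma^{1/2}\|_F^2$,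 $Q=L+R$; $\hat\Sigma=\frac1n\sum_ix_ix_i^{\top}$, $\hat R$ is $R$ with $\Sigma$ replaced by $\hat\Sigma$, $\hat Q=\hat L+\hat R$; the expectation is over the $n$ samples at fixed $\theta$. With $U\Gamma V^{\top}$ an SVD of $M\Sigma^{1/2}$ ($U^{\top}U=V^{\top}V=I_d$, $\Gamma$ diagonal positive definite), $\mathcal{S}=\{(U\Gamma^{1/2}J^{\top}\Sigma^{-1/2};\ \Sigma^{-1/2}V\Gamma^{1/2}J^{\top}\Sigma^{-1/2}) : J\in\mathbb{O}_d\}$. $P=\mathrm{diag}(I_p,\Sigma)$ and $\|\theta\|_P=\sqrt{\mathrm{Tr}(\theta^{\top}P\theta)}$. *)

theory Defs
  imports "HOL-Analysis.Analysis" "HOL-Probability.Probability"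
begin

definition psd_mat :: "real^'n^'n \<Rightarrow> bool" where
  "psd_mat S \<longleftrightarrow> transpose S = S \<and> (\<forall>x. 0 \<le> x \<bullet> (S *v x))"

definition msqrt :: "real^'n^'n \<Rightarrow> real^'n^'n" where
  "msqrt S = (THE R. psd_mat R \<and> R ** R = S)"

definition diag_mat :: "real^'n^'n \<Rightarrow> bool" where
  "diag_mat G \<longleftrightarrow> (\<forall>i j. i \<noteq> j \<longrightarrow> G $ i $ j = 0)"

definition diag_sqrt :: "real^'n^'n \<Rightarrow> real^'n^'n" where
  "diag_sqrt G = (\<chi> i j. if i = j then sqrt (G $ i $ i) else 0)"

definition outer :: "real^'n \<Rightarrow> real^'n^'n" where
  "outer x = (\<chi> a b. x $ a * x $ b)"

definition opnorm :: "real^'n^'m \<Rightarrow> real" where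
  "opnorm A = onorm (\<lambda>x. A *v x)"

definition std_gauss :: "(real^'n) measure" where
  "std_gauss = density lborel (\<lambda>x. ennreal (\<Prod>i\<in>UNIV. std_normal_density (x $ i)))"

definition gauss :: "real^'n^'n \<Rightarrow> (real^'n) measure" where
  "gauss S = distr std_gauss borel (\<lambda>g. msqrt S *v g)"

definition sample_dist :: "real^'d^'p \<Rightarrow> real^'d^'d \<Rightarrow> real^'p^'p \<Rightarrow> ((real^'d) \<times> (real^'p)) measure" where
  "sample_dist M \<Sigma> \<Omega> = distr (gauss \<Sigma> \<Otimes>\<^sub>M gauss \<Omega>) borel (\<lambda>(x, z). (x, M *v x + z))"

type_synonym ('d, 'p) param = "(real^'d^'p) \<times> (real^'d^'d)"

definition emp_attn :: "real^'d^'d \<Rightarrow> (nat \<Rightarrow> real^'d) \<Rightarrow> nat \<Rightarrow> nat \<Rightarrow> real^'d" where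
  "emp_attn B xs n i =
     (1 / (\<Sum>j<n. exp (xs i \<bullet> (B *v xs j)))) *\<^sub>R (\<Sum>j<n. exp (xs i \<bullet> (B *v xs j)) *\<^sub>R xs j)"

definition emp_loss :: "nat \<Rightarrow> (nat \<Rightarrow> (real^'d) \<times> (real^'p)) \<Rightarrow> ('d, 'p) param \<Rightarrow> real" where
  "emp_loss n s \<theta> = (1 / (2 * real n)) *
     (\<Sum>i<n. (norm (fst \<theta> *v emp_attn (snd \<theta>) (\<lambda>j. fst (s j)) n i - snd (s i)))\<^sup>2)"

definition pop_attn :: "real^'d^'d \<Rightarrow> real^'d^'d \<Rightarrow> real^'d \<Rightarrow> real^'d" where
  "pop_attn \<Sigma> B x1 =
     (1 / (\<integral>x2. exp (x1 \<bullet> (B *v x2)) \<partial>gauss \<Sigma>)) *\<^sub>R (\<integral>x2. exp (x1 \<bullet> (B *v x2)) *\<^sub>R x2 \<partial>gauss \<Sigma>)"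

definition pop_loss :: "real^'d^'p \<Rightarrow> real^'d^'d \<Rightarrow> real^'p^'p \<Rightarrow> ('d, 'p) param \<Rightarrow> real" where
  "pop_loss M \<Sigma> \<Omega> \<theta> = 1 / 2 *
     (\<integral>xz. (norm (fst \<theta> *v pop_attn \<Sigma> (snd \<theta>) (fst xz) - (M *v fst xz + snd xz)))\<^sup>2
        \<partial>(gauss \<Sigma> \<Otimes>\<^sub>M gauss \<Omega>))"

text \<open>\<open>R(\<theta>) = 1/8 \<parallel>\<Sigma>^(1/2) (A^T A - B^T \<Sigma> B) \<Sigma>^(1/2)\<parallel>_F^2\<close>; the norm on \<open>real^'d^'d\<close> is the Frobenius norm.\<close>
definition reg :: "real^'d^'d \<Rightarrow> ('d, 'p::finite) param \<Rightarrow> real" where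
  "reg \<Sigma> \<theta> = 1 / 8 * (norm (msqrt \<Sigma> ** (transpose (fst \<theta>) ** fst \<theta>
        - transpose (snd \<theta>) ** \<Sigma> ** snd \<theta>) ** msqrt \<Sigma>))\<^sup>2"

definition emp_cov :: "nat \<Rightarrow> (nat \<Rightarrow> (real^'d) \<times> (real^'p)) \<Rightarrow> real^'d^'d" where
  "emp_cov n s = (1 / real n) *\<^sub>R (\<Sum>i<n. outer (fst (s i)))"

definition Qhat :: "nat \<Rightarrow> (nat \<Rightarrow> (real^'d) \<times> (real^'p)) \<Rightarrow> ('d, 'p) param \<Rightarrow> real" where
  "Qhat n s \<theta> = emp_loss n s \<theta> + reg (emp_cov n s) \<theta>"

definition Qpop :: "real^'d^'p \<Rightarrow> real^'d^'d \<Rightarrow> real^'p^'p \<Rightarrow> ('d, 'p) param \<Rightarrow> real" where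
  "Qpop M \<Sigma> \<Omega> \<theta> = pop_loss M \<Sigma> \<Omega> \<theta> + reg \<Sigma> \<theta>"

text \<open>Gradient w.r.t. the Frobenius inner product on \<open>\<theta> = (A,B)\<close>.\<close>
definition grad :: "('a::real_inner \<Rightarrow> real) \<Rightarrow> 'a \<Rightarrow> 'a" where
  "grad f x = (THE D. GDERIV f x :> D)"

definition exp_grad_Qhat :: "real^'d^'p \<Rightarrow> real^'d^'d \<Rightarrow> real^'p^'p \<Rightarrow> nat \<Rightarrow> ('d, 'p) param \<Rightarrow> ('d, 'p) param" where
  "exp_grad_Qhat M \<Sigma> \<Omega> n \<theta> =
     (\<integral>s. grad (Qhat n s) \<theta> \<partial>(PiM {..<n} (\<lambda>_. sample_dist M \<Sigma> \<Omega>)))"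

text \<open>\<open>\<parallel>\<theta>\<parallel>_P = sqrt (Tr(\<theta>^T P \<theta>))\<close> with \<open>P = diag(I_p, \<Sigma>)\<close>, i.e. \<open>Tr(A^T A + B^T \<Sigma> B)\<close>.\<close>
definition Pnorm :: "real^'d^'d \<Rightarrow> ('d, 'p::finite) param \<Rightarrow> real" where
  "Pnorm \<Sigma> \<theta> = sqrt (trace (transpose (fst \<theta>) ** fst \<theta> + transpose (snd \<theta>) ** \<Sigma> ** snd \<theta>))"

definition S_set :: "real^'d^'d \<Rightarrow> real^'d^'p \<Rightarrow> real^'d^'d \<Rightarrow> real^'d^'d \<Rightarrow> ('d, 'p) param set" where
  "S_set \<Sigma> U G V = {(U ** diag_sqrt G ** transpose J ** matrix_inv (msqrt \<Sigma>),
      matrix_inv (msqrt \<Sigma>) ** V ** diag_sqrt G ** transpose J ** matrix_inv (msqrt \<Sigma>)) | J.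
      orthogonal_matrix J}"

end

theory Submission
  imports Defs
begin

text \<open>
  In a fixed direction, the derivative of the empirical objective is an average over queries \<open>s\<^sub>i\<close> of
  \<open>\<Sum>\<^sub>j\<^sub>k\<^sub>l w\<^sub>i\<^sub>j w\<^sub>i\<^sub>k w\<^sub>i\<^sub>l H(s\<^sub>i, s\<^sub>j, s\<^sub>k, s\<^sub>l) / W\<^sub>i\<^sup>3\<close> with \<open>W\<^sub>i = \<Sum>\<^sub>t w\<^sub>i\<^sub>t\<close>: for the loss the weights are
  \<open>w\<^sub>i\<^sub>j = exp(x\<^sub>i\<^sup>T B x\<^sub>j)\<close>, for the regularizer they are constant. The population derivative is the same
  expression with the sample replaced by independent draws.

  No concentration inequality is needed. After centering \<open>H\<close>, a term with four distinct indices
  would have mean zero if \<open>W\<^sub>i\<close> were replaced by the sum \<open>W'\<close> of the weights of the other indices,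
  and that replacement costs \<open>3 (W\<^sub>i - W') / W'\<^sup>4\<close>, that is \<open>O(n\<^sup>-\<^sup>4)\<close> in mean for each of \<open>n\<^sup>3\<close> terms.
  The \<open>O(n\<^sup>2)\<close> remaining terms are \<open>O(n\<^sup>-\<^sup>3)\<close> each. Hence the bias is \<open>K/n\<close>.
  All moments are finite because near the solution set \<open>\<parallel>\<Sigma>\<^sup>1\<^sup>/\<^sup>2 B \<Sigma>\<^sup>1\<^sup>/\<^sup>2\<parallel> \<le> 1/16\<close>, so that the weights and their
  inverses are dominated by products of Gaussian exponential moments. The population loss itself is
  polynomial in \<open>\<theta>\<close>, because tilting a Gaussian by \<open>exp(x\<^sup>T B \<cdot>)\<close> only shifts its mean to \<open>\<Sigma> B\<^sup>T x\<close>.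
  Since \<open>K\<close> may depend on \<open>\<Omega>\<close> and so may the threshold on \<open>n\<close>, the constant \<open>C = 1\<close> is obtained by
  absorbing \<open>K\<close> into the logarithm.
\<close>

section \<open>Positive semidefinite square roots\<close>

lemma inner_matrix_transpose:
  fixes S :: "real^'n^'m"
  shows "x \<bullet> (S *v y) = (transpose S *v x) \<bullet> y"
  by (simp only: dot_lmul_matrix[symmetric] transpose_matrix_vector)

lemma inner_symmetric_matrix:
  fixes S :: "real^'n^'n"
  assumes "transpose S = S"
  shows "x \<bullet> (S *v y) = (S *v x) \<bullet> y"
  using inner_matrix_transpose[of x S y] assms by simp

text \<open>The maximiser of the quadratic form on the unit sphere of an invariant subspace is an eigenvector.\<close>
lemma symmetric_eigenvector_in_subspace:
  fixes S :: "real^'n^'n"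
  assumes sym: "transpose S = S" and W: "subspace W" "W \<noteq> {0}"
    and inv: "\<And>x. x \<in> W \<Longrightarrow> S *v x \<in> W"
  obtains v \<nu> where "v \<in> W" "norm v = 1" "S *v v = \<nu> *\<^sub>R v"
proof -
  let ?K = "W \<inter> sphere 0 1"
  have "compact ?K" using closed_subspace[OF W(1)] by (intro closed_Int_compact) auto
  moreover have "?K \<noteq> {}"
  proof -
    obtain w where w: "w \<in> W" "w \<noteq> 0" using W subspace_0[OF W(1)] by auto
    then have "(1 / norm w) *\<^sub>R w \<in> ?K" using W(1) by (simp add: subspace_scale)
    then show ?thesis by blast
  qed
  moreover have "continuous_on ?K (\<lambda>x. x \<bullet> (S *v x))"
    by (intro continuous_intros linear_continuous_on matrix_vector_mul_bounded_linear)
  ultimately obtain v where v: "v \<in> ?K" and max: "\<And>x. x \<in> ?K \<Longrightarrow> x \<bullet> (S *v x) \<le> v \<bullet> (S *v v)"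
    using continuous_attains_sup[of ?K "\<lambda>x. x \<bullet> (S *v x)"] by blast
  define \<nu> where "\<nu> = v \<bullet> (S *v v)"
  have vW: "v \<in> W" and v1: "norm v = 1" using v by auto
  have le: "x \<bullet> (S *v x) \<le> \<nu> * (x \<bullet> x)" if "x \<in> W" for x
  proof (cases "x = 0")
    case False
    have "(1 / norm x) *\<^sub>R x \<in> ?K" using that False W(1) by (simp add: subspace_scale)
    from max[OF this] have "(1 / norm x)\<^sup>2 * (x \<bullet> (S *v x)) \<le> \<nu>"
      by (simp add: \<nu>_def matrix_vector_mult_scaleR power2_eq_square)
    then have "(norm x)\<^sup>2 * ((1 / norm x)\<^sup>2 * (x \<bullet> (S *v x))) \<le> (norm x)\<^sup>2 * \<nu>"
      by (rule mult_left_mono) simp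
    then show ?thesis using False by (simp add: power_divide power2_norm_eq_inner mult.commute)
  qed simp
  define w where "w = S *v v - \<nu> *\<^sub>R v"
  have wW: "w \<in> W" unfolding w_def using inv vW W(1) by (simp add: subspace_diff subspace_scale)
  define c where "c = w \<bullet> (S *v w) - \<nu> * (w \<bullet> w)"
  have quad: "2 * t * (w \<bullet> w) + t\<^sup>2 * c \<le> 0" for t
  proof -
    have "v + t *\<^sub>R w \<in> W" using vW wW W(1) by (simp add: subspace_add subspace_scale)
    from le[OF this]
    have "(v + t *\<^sub>R w) \<bullet> (S *v (v + t *\<^sub>R w)) - \<nu> * ((v + t *\<^sub>R w) \<bullet> (v + t *\<^sub>R w)) \<le> 0" by simp
    also have "(v + t *\<^sub>R w) \<bullet> (S *v (v + t *\<^sub>R w)) - \<nu> * ((v + t *\<^sub>R w) \<bullet> (v + t *\<^sub>R w))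
        = (\<nu> - \<nu> * (v \<bullet> v)) + 2 * t * (w \<bullet> (S *v v) - \<nu> * (w \<bullet> v)) + t\<^sup>2 * c"
    proof -
      have vb: "v \<bullet> (S *v w) = w \<bullet> (S *v v)"
        by (simp only: inner_symmetric_matrix[OF sym, of v w] inner_commute[of w])
      have "S *v (v + t *\<^sub>R w) = S *v v + t *\<^sub>R (S *v w)"
        by (simp add: matrix_vector_right_distrib matrix_vector_mult_scaleR)
      then have "(v + t *\<^sub>R w) \<bullet> (S *v (v + t *\<^sub>R w)) = \<nu> + 2 * t * (w \<bullet> (S *v v)) + t\<^sup>2 * (w \<bullet> (S *v w))"
        by (simp add: inner_add_left inner_add_right vb \<nu>_def[symmetric] power2_eq_square distrib_left)
      moreover have "(v + t *\<^sub>R w) \<bullet> (v + t *\<^sub>R w) = v \<bullet> v + 2 * t * (w \<bullet> v) + t\<^sup>2 * (w \<bullet> w)"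
        by (simp add: inner_add_left inner_add_right inner_commute[of v w] power2_eq_square distrib_left)
      ultimately show ?thesis unfolding c_def by (simp add: algebra_simps)
    qed
    also have "w \<bullet> (S *v v) - \<nu> * (w \<bullet> v) = w \<bullet> w"
      unfolding w_def by (simp add: inner_diff_left inner_diff_right algebra_simps)
    also have "v \<bullet> v = 1" using v1 by (simp add: power2_norm_eq_inner[symmetric])
    finally show ?thesis by simp
  qed
  have "w \<bullet> w = 0"
  proof (rule ccontr)
    assume "w \<bullet> w \<noteq> 0"
    then have p: "0 < w \<bullet> w" by simp
    define t where "t = (w \<bullet> w) / (\<bar>c\<bar> + 1)"
    have t: "0 < t" unfolding t_def using p by (intro divide_pos_pos) auto
    have "t * \<bar>c\<bar> < w \<bullet> w" using p unfolding t_def by (simp add: field_simps)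
    moreover have "- (t * \<bar>c\<bar>) \<le> t * c" using t mult_left_mono[of "- \<bar>c\<bar>" c t] by simp
    ultimately have "0 < 2 * (w \<bullet> w) + t * c" using p by linarith
    then have "0 < t * (2 * (w \<bullet> w) + t * c)" using t by simp
    then show False using quad[of t] by (simp add: algebra_simps power2_eq_square)
  qed
  then have "S *v v = \<nu> *\<^sub>R v" by (simp add: w_def)
  then show ?thesis using that vW v1 by blast
qed

lemma symmetric_matrix_eigenbasis:
  fixes S :: "real^'n^'n"
  assumes sym: "transpose S = S"
  obtains E \<nu> where "finite E" "\<And>x. (\<Sum>v\<in>E. (v \<bullet> x) *\<^sub>R v) = x"
    "\<And>v. v \<in> E \<Longrightarrow> S *v v = \<nu> v *\<^sub>R v" "\<And>v. v \<in> E \<Longrightarrow> norm v = 1"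
    "pairwise orthogonal E"
proof -
  have "\<exists>E. finite E \<and> card E = k \<and> pairwise orthogonal E \<and> (\<forall>v\<in>E. norm v = 1 \<and> (\<exists>\<nu>. S *v v = \<nu> *\<^sub>R v))"
    if "k \<le> CARD('n)" for k using that
  proof (induction k)
    case 0
    show ?case by (rule exI[of _ "{}"]) simp
  next
    case (Suc k)
    then obtain E where E: "finite E" "card E = k" "pairwise orthogonal E"
      "\<And>v. v \<in> E \<Longrightarrow> norm v = 1" "\<And>v. v \<in> E \<Longrightarrow> \<exists>\<nu>. S *v v = \<nu> *\<^sub>R v" by auto
    define W where "W = {x. \<forall>v\<in>E. orthogonal v x}"
    have sW: "subspace W" unfolding W_def subspace_def by (auto simp: orthogonal_def inner_add_right)
    have "W \<noteq> {0}"
    proof -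
      have "dim E \<le> k" using E dim_le_card'[OF E(1)] by simp
      then have "dim (span E) < DIM(real^'n)" using Suc.prems by simp
      then obtain x where "x \<noteq> 0" "\<And>y. y \<in> span E \<Longrightarrow> orthogonal x y"
        using orthogonal_to_subspace_exists[of E] by (auto simp: dim_span)
      then have "x \<in> W" by (auto simp: W_def orthogonal_commute span_base)
      then show ?thesis using \<open>x \<noteq> 0\<close> by auto
    qed
    moreover have "S *v x \<in> W" if "x \<in> W" for x
    proof -
      have "v \<bullet> (S *v x) = 0" if v: "v \<in> E" for v
      proof -
        obtain \<nu> where "S *v v = \<nu> *\<^sub>R v" using E(5)[OF v] by auto
        then show ?thesis using \<open>x \<in> W\<close> v by (simp add: inner_symmetric_matrix[OF sym] W_def orthogonal_def)
      qed
      then show ?thesis by (simp add: W_def orthogonal_def)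
    qed
    ultimately obtain v \<mu> where v: "v \<in> W" "norm v = 1" "S *v v = \<mu> *\<^sub>R v"
      using symmetric_eigenvector_in_subspace[OF sym sW] by metis
    have "v \<notin> E" using v by (auto simp: W_def orthogonal_def power2_norm_eq_inner[symmetric])
    moreover have "pairwise orthogonal (insert v E)"
      using E(3) v(1) by (auto simp: pairwise_insert W_def orthogonal_commute)
    ultimately have "finite (insert v E) \<and> card (insert v E) = Suc k \<and> pairwise orthogonal (insert v E)
      \<and> (\<forall>u\<in>insert v E. norm u = 1 \<and> (\<exists>\<nu>. S *v u = \<nu> *\<^sub>R u))"
      using E v by auto
    then show ?case by blast
  qed
  from this[OF order_refl] obtain E where E: "finite E" "card E = CARD('n)" "pairwise orthogonal E"
    "\<And>v. v \<in> E \<Longrightarrow> norm v = 1" "\<And>v. v \<in> E \<Longrightarrow> \<exists>\<nu>. S *v v = \<nu> *\<^sub>R v" by auto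
  have "0 \<notin> E" using E(4) by force
  then have "independent E" using E(3) pairwise_orthogonal_independent by blast
  then have sp: "span E = UNIV" using E(2) card_eq_dim[of E UNIV] by (simp add: top.extremum_uniqueI E(1))
  have ex: "(\<Sum>v\<in>E. (v \<bullet> x) *\<^sub>R v) = x" for x
    using orthonormal_basis_expand[OF E(3) E(4), of x] sp E(1) by (simp add: inner_commute)
  obtain \<nu> where "\<And>v. v \<in> E \<Longrightarrow> S *v v = \<nu> v *\<^sub>R v" using E(5) by metis
  then show ?thesis using that E ex by blast
qed

lemma psd_sqrt_exists:
  fixes S :: "real^'n^'n"
  assumes "psd_mat S"
  shows "\<exists>R. psd_mat R \<and> R ** R = S"
proof -
  have sym: "transpose S = S" and pos: "\<And>x. 0 \<le> x \<bullet> (S *v x)" using assms by (auto simp: psd_mat_def)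
  obtain E \<nu> where E: "finite E" "\<And>x. (\<Sum>v\<in>E. (v \<bullet> x) *\<^sub>R v) = x"
    "\<And>v. v \<in> E \<Longrightarrow> S *v v = \<nu> v *\<^sub>R v" "\<And>v. v \<in> E \<Longrightarrow> norm v = 1" "pairwise orthogonal E"
    by (rule symmetric_matrix_eigenbasis[OF sym], rule that)
  have \<nu>: "0 \<le> \<nu> v" if "v \<in> E" for v
    using pos[of v] E(3,4)[OF that] by (simp add: power2_norm_eq_inner[symmetric])
  define f where "f = (\<lambda>x. \<Sum>v\<in>E. (sqrt (\<nu> v) * (v \<bullet> x)) *\<^sub>R v)"
  define R where "R = matrix f"
  have lin: "linear f" unfolding f_def
    by (rule linearI) (simp_all add: inner_add_right algebra_simps sum.distrib scaleR_sum_right)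
  have Rx: "R *v x = f x" for x unfolding R_def using lin by (simp add: matrix_works)
  have fv: "f v = sqrt (\<nu> v) *\<^sub>R v" if "v \<in> E" for v
  proof -
    have "(\<Sum>u\<in>E. (sqrt (\<nu> u) * (u \<bullet> v)) *\<^sub>R u) = (\<Sum>u\<in>E. if u = v then sqrt (\<nu> v) *\<^sub>R v else 0)"
    proof (rule sum.cong[OF refl])
      fix u assume u: "u \<in> E"
      show "(sqrt (\<nu> u) * (u \<bullet> v)) *\<^sub>R u = (if u = v then sqrt (\<nu> v) *\<^sub>R v else 0)"
        using E(5) E(4)[OF that] u that by (auto simp: pairwise_def orthogonal_def power2_norm_eq_inner[symmetric])
    qed
    then show ?thesis using that E(1) by (simp add: f_def)
  qed
  have fi: "y \<bullet> f x = (\<Sum>v\<in>E. sqrt (\<nu> v) * (v \<bullet> x) * (v \<bullet> y))" for x y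
    by (simp add: f_def inner_sum_right inner_commute)
  have "transpose R = R"
  proof -
    have "x \<bullet> (transpose R *v y) = x \<bullet> (R *v y)" for x y
    proof -
      have "x \<bullet> (transpose R *v y) = y \<bullet> (R *v x)"
        by (simp only: inner_matrix_transpose[of y R x] inner_commute[of x])
      then show ?thesis by (simp add: Rx fi mult_ac)
    qed
    then have "transpose R *v y = R *v y" for y by (intro vector_eq_ldot[THEN iffD1]) simp
    then show ?thesis by (simp add: matrix_eq)
  qed
  moreover have "0 \<le> x \<bullet> (R *v x)" for x
    unfolding Rx fi by (intro sum_nonneg) (simp add: \<nu> mult.assoc)
  moreover have "R ** R = S"
  proof -
    have "(R ** R) *v x = S *v x" for x
    proof -
      have "(R ** R) *v x = f (f x)" by (simp add: matrix_vector_mul_assoc[symmetric] Rx)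
      also have "f x = (\<Sum>v\<in>E. (sqrt (\<nu> v) * (v \<bullet> x)) *\<^sub>R v)" by (simp add: f_def)
      also have "f \<dots> = (\<Sum>v\<in>E. (sqrt (\<nu> v) * (v \<bullet> x)) *\<^sub>R f v)"
        by (simp add: linear_sum[OF lin] linear_scale[OF lin])
      also have "\<dots> = (\<Sum>v\<in>E. (v \<bullet> x) *\<^sub>R (S *v v))"
        using \<nu> by (intro sum.cong refl) (simp add: fv E(3) power2_eq_square[symmetric] mult_ac)
      also have "\<dots> = S *v (\<Sum>v\<in>E. (v \<bullet> x) *\<^sub>R v)"
        by (simp add: linear_sum linear_scale matrix_vector_mult_scaleR)
      finally show ?thesis by (simp only: E(2))
    qed
    then show ?thesis by (simp add: matrix_eq)
  qed
  ultimately show ?thesis by (auto simp: psd_mat_def)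
qed

lemma psd_kernel:
  fixes R :: "real^'n^'n"
  assumes R: "psd_mat R" and 0: "v \<bullet> (R *v v) = 0"
  shows "R *v v = 0"
proof -
  obtain Q where Q: "psd_mat Q" "Q ** Q = R" using psd_sqrt_exists[OF R] by auto
  have "(Q *v v) \<bullet> (Q *v v) = v \<bullet> (R *v v)"
    using Q by (simp add: inner_symmetric_matrix[symmetric] psd_mat_def matrix_vector_mul_assoc)
  then have "Q *v v = 0" using 0 by simp
  then show ?thesis using Q(2) by (metis matrix_vector_mul_assoc matrix_vector_mult_0_right)
qed

lemma psd_sqrt_unique:
  fixes R T :: "real^'n^'n"
  assumes R: "psd_mat R" and T: "psd_mat T" and eq: "R ** R = T ** T"
  shows "R = T"
proof -
  define D where "D = R - T"
  have sR: "transpose R = R" and sT: "transpose T = T" using R T by (auto simp: psd_mat_def)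
  have sD: "transpose D = D" unfolding D_def using sR sT by (simp add: transpose_def vec_eq_iff)
  obtain E \<nu> where E: "finite E" "\<And>x. (\<Sum>v\<in>E. (v \<bullet> x) *\<^sub>R v) = x"
    "\<And>v. v \<in> E \<Longrightarrow> D *v v = \<nu> v *\<^sub>R v" "\<And>v. v \<in> E \<Longrightarrow> norm v = 1" "pairwise orthogonal E"
    by (rule symmetric_matrix_eigenbasis[OF sD], rule that)
  have "D *v v = 0" if v: "v \<in> E" for v
  proof (cases "\<nu> v = 0")
    case False
    let ?r = "R *v v" and ?t = "T *v v"
    have d: "?r - ?t = \<nu> v *\<^sub>R v" using E(3)[OF v] by (simp add: D_def matrix_vector_mult_diff_rdistrib)
    have "?r \<bullet> ?r = ?t \<bullet> ?t"
      using eq by (simp add: inner_symmetric_matrix[OF sR, symmetric] inner_symmetric_matrix[OF sT, symmetric] matrix_vector_mul_assoc)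
    then have "(?r - ?t) \<bullet> (?r + ?t) = 0" by (simp add: inner_diff_left inner_add_right inner_commute[of ?t ?r])
    then have "v \<bullet> (?r + ?t) = 0" unfolding d using False by simp
    then have "v \<bullet> ?r + v \<bullet> ?t = 0" by (simp add: inner_add_right)
    moreover have "0 \<le> v \<bullet> ?r" "0 \<le> v \<bullet> ?t" using R T by (auto simp: psd_mat_def)
    ultimately have "?r = 0" "?t = 0" using psd_kernel R T by (metis add_nonneg_eq_0_iff)+
    then show ?thesis by (simp add: D_def matrix_vector_mult_diff_rdistrib)
  qed (use E(3)[OF v] in simp)
  then have "D *v x = 0" for x
    by (subst E(2)[of x, symmetric]) (simp add: linear_sum linear_scale matrix_vector_mult_scaleR)
  then have "D = 0" by (simp add: matrix_eq)
  then show ?thesis by (simp add: D_def)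
qed

lemma msqrt_psd:
  assumes "psd_mat S"
  shows "psd_mat (msqrt S)" "msqrt S ** msqrt S = S"
proof -
  have "\<exists>!R. psd_mat R \<and> R ** R = S"
    using psd_sqrt_exists[OF assms] by (intro ex_ex1I) (auto intro: psd_sqrt_unique)
  from theI'[OF this] show "psd_mat (msqrt S)" "msqrt S ** msqrt S = S"
    unfolding msqrt_def by auto
qed

section \<open>Gaussian integrals\<close>

lemma borel_measurable_matrix_vector_mult [measurable]:
  fixes A :: "real^'n^'m"
  assumes [measurable]: "f \<in> borel_measurable M"
  shows "(\<lambda>x. A *v f x) \<in> borel_measurable M"
  by (rule measurable_compose[OF assms])
    (intro borel_measurable_continuous_onI linear_continuous_on matrix_vector_mul_bounded_linear)

lemma prod_Basis_vec:
  fixes f :: "real^'n \<Rightarrow> 'b::comm_monoid_mult"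
  shows "(\<Prod>b\<in>Basis. f b) = (\<Prod>i\<in>UNIV. f (axis i 1))"
proof -
  have B: "(Basis :: (real^'n) set) = range (\<lambda>i. axis i 1)" by (auto simp: Basis_vec_def)
  have "inj (\<lambda>i::'n. axis i (1::real))" by (auto simp: inj_on_def axis_eq_axis)
  then show ?thesis unfolding B by (simp add: prod.reindex)
qed

lemma nn_integral_std_gauss_prod:
  fixes f :: "'n::finite \<Rightarrow> real \<Rightarrow> real"
  assumes [measurable]: "\<And>i. f i \<in> borel_measurable borel" and nn: "\<And>i t. 0 \<le> f i t"
  shows "(\<integral>\<^sup>+g. ennreal (\<Prod>i\<in>UNIV. f i (g $ i)) \<partial>std_gauss)
    = (\<Prod>i\<in>UNIV. \<integral>\<^sup>+t. ennreal (std_normal_density t * f i t) \<partial>lborel)"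
proof -
  have "(\<integral>\<^sup>+g. ennreal (\<Prod>i\<in>UNIV. f i (g $ i)) \<partial>(std_gauss :: (real^'n) measure))
      = (\<integral>\<^sup>+g. (\<Prod>i\<in>UNIV. ennreal (std_normal_density (g $ i) * f i (g $ i))) \<partial>lborel)"
    unfolding std_gauss_def
    by (subst nn_integral_density)
      (auto simp: ennreal_mult[symmetric] prod_nonneg nn prod.distrib[symmetric] prod_ennreal intro!: nn_integral_cong)
  also have "\<dots> = (\<integral>\<^sup>+(g::real^'n). (\<Prod>b\<in>(Basis :: (real^'n) set). ennreal (std_normal_density (g \<bullet> b) * f (SOME i. b = axis i 1) (g \<bullet> b))) \<partial>lborel)"
    unfolding prod_Basis_vec by (simp add: inner_axis axis_eq_axis)
  also have "\<dots> = (\<Prod>b\<in>(Basis :: (real^'n) set). \<integral>\<^sup>+t. ennreal (std_normal_density t * f (SOME i. b = axis i 1) t) \<partial>lborel)"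
    by (rule nn_integral_lborel_prod) auto
  also have "\<dots> = (\<Prod>i\<in>UNIV. \<integral>\<^sup>+t. ennreal (std_normal_density t * f i t) \<partial>lborel)"
    unfolding prod_Basis_vec by (simp add: axis_eq_axis)
  finally show ?thesis .
qed

lemma space_std_gauss [simp]: "space std_gauss = UNIV"
  and sets_std_gauss [simp, measurable_cong]: "sets std_gauss = sets borel"
  by (simp_all add: std_gauss_def)

lemma prob_space_std_gauss: "prob_space (std_gauss :: (real^'n) measure)"
proof
  have "emeasure (std_gauss :: (real^'n) measure) (space std_gauss) = (\<integral>\<^sup>+g. ennreal (\<Prod>i\<in>(UNIV::'n set). 1) \<partial>(std_gauss :: (real^'n) measure))"
    by simp
  also have "\<dots> = (\<Prod>i\<in>(UNIV::'n set). \<integral>\<^sup>+t. ennreal (std_normal_density t * 1) \<partial>lborel)"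
    by (rule nn_integral_std_gauss_prod) auto
  also have "(\<integral>\<^sup>+t. ennreal (std_normal_density t * 1) \<partial>lborel) = 1"
    by (simp add: nn_integral_eq_integral)
  finally show "emeasure (std_gauss :: (real^'n) measure) (space std_gauss) = 1" by simp
qed

lemma std_gauss_exp_sq_integrable:
  assumes c: "c < 1 / 2"
  shows "integrable (std_gauss :: (real^'n) measure) (\<lambda>g. exp (c * (norm g)\<^sup>2))"
proof -
  define \<sigma> where "\<sigma> = 1 / sqrt (1 - 2 * c)"
  have \<sigma>: "0 < \<sigma>" using c by (simp add: \<sigma>_def)
  have \<sigma>2: "\<sigma>\<^sup>2 = 1 / (1 - 2 * c)" using c by (simp add: \<sigma>_def power_divide)
  have "std_normal_density t * exp (c * t\<^sup>2) = \<sigma> * normal_density 0 \<sigma> t" for t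
  proof -
    have "- t\<^sup>2 / 2 + c * t\<^sup>2 = - t\<^sup>2 / (2 * \<sigma>\<^sup>2)" unfolding \<sigma>2 using c by (simp add: field_simps)
    then show ?thesis using \<sigma>
      by (simp add: normal_density_def exp_add[symmetric] real_sqrt_mult mult.assoc)
  qed
  then have one: "(\<integral>\<^sup>+t. ennreal (std_normal_density t * exp (c * t\<^sup>2)) \<partial>lborel) = ennreal \<sigma>"
    using \<sigma> by (simp add: nn_integral_eq_integral)
  have exp_prod: "exp (c * (norm g)\<^sup>2) = (\<Prod>i\<in>UNIV. exp (c * (g $ i)\<^sup>2))" for g :: "real^'n"
    by (simp add: norm_vec_def L2_set_def sum_nonneg exp_sum[symmetric] sum_distrib_left)
  have "(\<integral>\<^sup>+g. ennreal (exp (c * (norm g)\<^sup>2)) \<partial>(std_gauss :: (real^'n) measure)) = (\<Prod>i\<in>(UNIV :: 'n set). ennreal \<sigma>)"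
    unfolding exp_prod by (subst nn_integral_std_gauss_prod) (auto simp: one)
  also have "\<dots> < \<infinity>" using \<sigma> by (simp add: ennreal_power)
  finally show ?thesis by (intro integrableI_nonneg) auto
qed

lemma std_gauss_integrable_bound:
  fixes f :: "real^'n \<Rightarrow> 'b::{banach, second_countable_topology}"
  assumes [measurable]: "f \<in> borel_measurable borel" and c: "c < 1 / 2"
    and f: "\<And>g. norm (f g) \<le> C * exp (c * (norm g)\<^sup>2)"
  shows "integrable std_gauss f"
proof (rule Bochner_Integration.integrable_bound)
  show "integrable std_gauss (\<lambda>g. C * exp (c * (norm g)\<^sup>2))"
    by (intro integrable_mult_right std_gauss_exp_sq_integrable c)
  show "AE g in std_gauss. norm (f g) \<le> norm (C * exp (c * (norm g)\<^sup>2))"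
    using f by (intro AE_I2) (auto intro: order_trans[OF _ abs_ge_self])
qed simp

lemma integral_lborel_prod:
  fixes h :: "'a::euclidean_space \<Rightarrow> real \<Rightarrow> real"
  assumes h: "\<And>b. b \<in> Basis \<Longrightarrow> integrable lborel (h b)"
  shows "(\<integral>x. (\<Prod>b\<in>Basis. h b (x \<bullet> b)) \<partial>lborel) = (\<Prod>b\<in>Basis. \<integral>t. h b t \<partial>lborel)"
proof -
  interpret product_sigma_finite "\<lambda>_ :: 'a. lborel :: real measure" ..
  have [measurable]: "b \<in> Basis \<Longrightarrow> h b \<in> borel_measurable borel" for b using h[of b] by simp
  have "(\<integral>x. (\<Prod>b\<in>Basis. h b (x \<bullet> b)) \<partial>lborel)
      = (\<integral>f. (\<Prod>b\<in>Basis. h b ((\<Sum>b\<in>Basis. f b *\<^sub>R b) \<bullet> b)) \<partial>(\<Pi>\<^sub>M b\<in>Basis. lborel))"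
    by (subst lborel_eq) (simp add: integral_distr)
  also have "\<dots> = (\<integral>f. (\<Prod>b\<in>Basis. h b (f b)) \<partial>(\<Pi>\<^sub>M b\<in>(Basis::'a set). lborel))"
    by (intro Bochner_Integration.integral_cong refl prod.cong) simp
  also have "\<dots> = (\<Prod>b\<in>Basis. \<integral>t. h b t \<partial>lborel)"
    by (rule product_integral_prod) (auto intro: h)
  finally show ?thesis .
qed

lemma integral_std_gauss_prod:
  fixes f :: "'n::finite \<Rightarrow> real \<Rightarrow> real"
  assumes f: "\<And>i. integrable lborel (\<lambda>t. std_normal_density t * f i t)"
    and [measurable]: "\<And>i. f i \<in> borel_measurable borel"
  shows "(\<integral>g. (\<Prod>i\<in>UNIV. f i (g $ i)) \<partial>std_gauss) = (\<Prod>i\<in>UNIV. \<integral>t. std_normal_density t * f i t \<partial>lborel)"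
proof -
  have "(\<integral>g. (\<Prod>i\<in>UNIV. f i (g $ i)) \<partial>(std_gauss :: (real^'n) measure))
      = (\<integral>(g::real^'n). (\<Prod>b\<in>(Basis :: (real^'n) set). std_normal_density (g \<bullet> b) * f (SOME i. b = axis i 1) (g \<bullet> b)) \<partial>lborel)"
    unfolding std_gauss_def prod_Basis_vec
    by (subst integral_density) (auto simp: prod_nonneg prod.distrib inner_axis axis_eq_axis)
  also have "\<dots> = (\<Prod>b\<in>(Basis :: (real^'n) set). \<integral>t. std_normal_density t * f (SOME i. b = axis i 1) t \<partial>lborel)"
    by (rule integral_lborel_prod) (rule f)
  also have "\<dots> = (\<Prod>i\<in>UNIV. \<integral>t. std_normal_density t * f i t \<partial>lborel)"
    unfolding prod_Basis_vec by (simp add: axis_eq_axis)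
  finally show ?thesis .
qed

lemma std_gauss_coordinate_moments:
  "(\<integral>g. g $ i \<partial>(std_gauss :: (real^'n) measure)) = 0"
  "(\<integral>g. g $ i * g $ j \<partial>(std_gauss :: (real^'n) measure)) = (if i = j then 1 else 0)"
proof -
  have m0: "integrable lborel std_normal_density" "integral\<^sup>L lborel std_normal_density = 1" by simp_all
  have m1: "integrable lborel (\<lambda>t. std_normal_density t * t)" "(\<integral>t. std_normal_density t * t \<partial>lborel) = 0"
    using integrable_std_normal_moment[of 1] integral_std_normal_moment_odd[of 0] by simp_all
  have m2: "integrable lborel (\<lambda>t. std_normal_density t * (t * t))" "(\<integral>t. std_normal_density t * (t * t) \<partial>lborel) = 1"
    using integrable_std_normal_moment[of 2] integral_std_normal_moment_even[of 1]
    by (simp_all add: power2_eq_square)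
  have e1: "g $ i = (\<Prod>k\<in>UNIV. if k = i then g $ k else 1)" for g :: "real^'n" and i by simp
  have "(\<integral>g. (\<Prod>k\<in>UNIV. (\<lambda>t. if k = i then t else 1) (g $ k)) \<partial>(std_gauss :: (real^'n) measure))
      = (\<Prod>k\<in>(UNIV::'n set). \<integral>t. std_normal_density t * (if k = i then t else 1) \<partial>lborel)"
  proof (rule integral_std_gauss_prod)
    show "integrable lborel (\<lambda>t. std_normal_density t * (if k = i then t else 1))" for k :: 'n
      by (cases "k = i") (simp_all add: m0 m1)
  qed auto
  also have "\<dots> = 0" by (rule prod_zero[OF _ bexI[of _ i]]) (auto simp: m1)
  finally show "(\<integral>g. g $ i \<partial>(std_gauss :: (real^'n) measure)) = 0" by simp
  let ?f = "\<lambda>k t::real. (if k = i then t else 1) * (if k = j then t else 1)"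
  have i: "integrable lborel (\<lambda>t. std_normal_density t * ?f k t)" for k
    by (cases "k = i"; cases "k = j") (simp_all add: m0 m1 m2)
  have "(\<integral>g. g $ i * g $ j \<partial>(std_gauss :: (real^'n) measure)) = (\<integral>g. (\<Prod>k\<in>UNIV. ?f k (g $ k)) \<partial>(std_gauss :: (real^'n) measure))"
    by (simp add: prod.distrib)
  also have "\<dots> = (\<Prod>k\<in>(UNIV::'n set). \<integral>t. std_normal_density t * ?f k t \<partial>lborel)"
    by (rule integral_std_gauss_prod[OF i]) auto
  also have "\<dots> = (if i = j then 1 else 0)"
  proof (cases "i = j")
    case True
    have "(\<integral>t. std_normal_density t * ?f k t \<partial>lborel) = 1" for k
      using True by (cases "k = i") (simp_all add: m0 m2)
    then show ?thesis using True by simp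
  next
    case False
    have "(\<integral>t. std_normal_density t * ?f i t \<partial>lborel) = 0" using False by (simp add: m1)
    then have "(\<Prod>k\<in>(UNIV::'n set). \<integral>t. std_normal_density t * ?f k t \<partial>lborel) = 0"
      by (intro prod_zero[OF _ bexI[of _ i]]) auto
    then show ?thesis using False by simp
  qed
  finally show "(\<integral>g. g $ i * g $ j \<partial>(std_gauss :: (real^'n) measure)) = (if i = j then 1 else 0)" .
qed

lemma std_gauss_tilt:
  fixes f :: "real^'n \<Rightarrow> real"
  assumes [measurable]: "f \<in> borel_measurable borel"
  shows "(\<integral>g. exp (u \<bullet> g) * f g \<partial>std_gauss) = exp ((norm u)\<^sup>2 / 2) * (\<integral>g. f (g + u) \<partial>std_gauss)"
proof -
  define \<rho> where "\<rho> = (\<lambda>g :: real^'n. \<Prod>i\<in>UNIV. std_normal_density (g $ i))"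
  define \<kappa> where "\<kappa> = (\<Prod>i\<in>(UNIV::'n set). 1 / sqrt (2 * pi))"
  have \<rho>: "\<rho> g = \<kappa> * exp (- (norm g)\<^sup>2 / 2)" for g
  proof -
    have "exp (- (norm g)\<^sup>2 / 2) = (\<Prod>i\<in>UNIV. exp (- (g $ i)\<^sup>2 / 2))"
      by (simp add: norm_vec_def L2_set_def sum_nonneg exp_sum[symmetric] sum_divide_distrib sum_negf)
    then show ?thesis by (simp add: \<rho>_def \<kappa>_def std_normal_density_def prod.distrib prod_dividef power_divide)
  qed
  have [measurable]: "\<rho> \<in> borel_measurable borel" unfolding \<rho>_def by measurable
  have \<rho>0: "0 \<le> \<rho> g" for g by (simp add: \<rho>_def prod_nonneg)
  have dens: "integral\<^sup>L std_gauss h = (\<integral>g. \<rho> g * h g \<partial>lborel)"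
    if [measurable]: "h \<in> borel_measurable borel" for h :: "real^'n \<Rightarrow> real"
    unfolding std_gauss_def \<rho>_def[symmetric, THEN fun_cong] using \<rho>0
    by (subst integral_density) auto
  have "(\<integral>g. exp (u \<bullet> g) * f g \<partial>std_gauss) = (\<integral>g. \<rho> g * (exp (u \<bullet> g) * f g) \<partial>lborel)"
    by (rule dens) measurable
  also have "\<dots> = (\<integral>g. \<rho> (u + g) * (exp (u \<bullet> (u + g)) * f (u + g)) \<partial>lborel)"
    by (subst lborel_distr_plus[of u, symmetric]) (simp add: integral_distr)
  also have "\<dots> = (\<integral>g. exp ((norm u)\<^sup>2 / 2) * (\<rho> g * f (g + u)) \<partial>lborel)"
  proof (intro Bochner_Integration.integral_cong refl)
    fix g
    have "- (norm (u + g))\<^sup>2 / 2 + u \<bullet> (u + g) = (norm u)\<^sup>2 / 2 + - (norm g)\<^sup>2 / 2"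
      by (simp add: power2_norm_eq_inner inner_add_left inner_add_right inner_commute field_simps)
    then have "exp (- (norm (u + g))\<^sup>2 / 2) * exp (u \<bullet> (u + g)) = exp ((norm u)\<^sup>2 / 2) * exp (- (norm g)\<^sup>2 / 2)"
      by (simp only: exp_add[symmetric])
    then show "\<rho> (u + g) * (exp (u \<bullet> (u + g)) * f (u + g)) = exp ((norm u)\<^sup>2 / 2) * (\<rho> g * f (g + u))"
      unfolding \<rho> by (simp add: add.commute)
  qed
  also have "\<dots> = exp ((norm u)\<^sup>2 / 2) * (\<integral>g. f (g + u) \<partial>std_gauss)"
    by (subst dens) auto
  finally show ?thesis .
qed

lemma std_gauss_linear_moments:
  fixes p q :: "real^'n"
  shows "integrable std_gauss (\<lambda>g. \<alpha> + p \<bullet> g)" "(\<integral>g. \<alpha> + p \<bullet> g \<partial>std_gauss) = \<alpha>"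
    and "integrable std_gauss (\<lambda>g. (\<alpha> + p \<bullet> g) * (\<beta> + q \<bullet> g))"
    "(\<integral>g. (\<alpha> + p \<bullet> g) * (\<beta> + q \<bullet> g) \<partial>std_gauss) = \<alpha> * \<beta> + p \<bullet> q"
proof -
  interpret prob_space "std_gauss :: (real^'n) measure" by (rule prob_space_std_gauss)
  have [simp]: "prob UNIV = 1" using prob_space by simp
  have le: "1 + t \<le> 4 * exp (1 / 4 * t)" if "0 \<le> t" for t :: real
    using exp_ge_add_one_self[of "1 / 4 * t"] that by (simp add: algebra_simps del: exp_ge_add_one_self)
  have b: "\<bar>g $ k\<bar> \<le> norm g" for g :: "real^'n" and k by (rule component_le_norm_cart)
  have i1: "integrable std_gauss (\<lambda>g :: real^'n. g $ i)" for i
  proof (rule std_gauss_integrable_bound[where c = "1/4" and C = 4])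
    fix g :: "real^'n"
    have "2 * norm g \<le> 1 + (norm g)\<^sup>2" using sum_squares_bound[of 1 "norm g"] by simp
    then have "norm g \<le> 1 + (norm g)\<^sup>2" using norm_ge_zero[of g] by linarith
    then show "norm (g $ i) \<le> 4 * exp (1 / 4 * (norm g)\<^sup>2)"
      using le[of "(norm g)\<^sup>2"] b[of g i] by simp
  qed auto
  have i2: "integrable std_gauss (\<lambda>g :: real^'n. g $ i * g $ j)" for i j
  proof (rule std_gauss_integrable_bound[where c = "1/4" and C = 4])
    fix g :: "real^'n"
    have "norm (g $ i * g $ j) \<le> norm g * norm g" unfolding norm_mult using b by (intro mult_mono) auto
    then show "norm (g $ i * g $ j) \<le> 4 * exp (1 / 4 * (norm g)\<^sup>2)" using le[of "(norm g)\<^sup>2"] by (simp add: power2_eq_square)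
  qed auto
  have ip: "integrable std_gauss (\<lambda>g. p \<bullet> g)" "(\<integral>g. p \<bullet> g \<partial>std_gauss) = 0" for p :: "real^'n"
    unfolding inner_vec_def by (simp_all add: i1 Bochner_Integration.integral_sum std_gauss_coordinate_moments)
  show 1: "integrable std_gauss (\<lambda>g. \<alpha> + p \<bullet> g)" "(\<integral>g. \<alpha> + p \<bullet> g \<partial>std_gauss) = \<alpha>"
    using ip[of p] by (simp_all add: prob_space)
  have eq: "(p \<bullet> g) * (q \<bullet> g) = (\<Sum>i\<in>UNIV. \<Sum>j\<in>UNIV. p $ i * q $ j * (g $ i * g $ j))" for g
    by (simp add: inner_vec_def sum_product mult_ac)
  have iq: "integrable std_gauss (\<lambda>g. (p \<bullet> g) * (q \<bullet> g))"
    unfolding eq by (intro Bochner_Integration.integrable_sum integrable_mult_right i2)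
  have "(\<integral>g. (p \<bullet> g) * (q \<bullet> g) \<partial>std_gauss) = (\<Sum>i\<in>UNIV. \<Sum>j\<in>UNIV. p $ i * q $ j * (if i = j then 1 else 0))"
    unfolding eq by (simp add: Bochner_Integration.integral_sum i2 std_gauss_coordinate_moments)
  also have "\<dots> = p \<bullet> q" by (simp add: inner_vec_def if_distrib[of "\<lambda>x. _ * x"] cong: if_cong)
  finally have q: "(\<integral>g. (p \<bullet> g) * (q \<bullet> g) \<partial>std_gauss) = p \<bullet> q" .
  have ex: "(\<alpha> + p \<bullet> g) * (\<beta> + q \<bullet> g) = \<alpha> * (\<beta> + q \<bullet> g) + (\<beta> * (p \<bullet> g) + (p \<bullet> g) * (q \<bullet> g))" for g
    by (simp add: algebra_simps)
  have j: "integrable std_gauss (\<lambda>g. \<alpha> * (\<beta> + q \<bullet> g))" "integrable std_gauss (\<lambda>g. \<beta> * (p \<bullet> g))"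
    using ip[of q] ip[of p] by auto
  show "integrable std_gauss (\<lambda>g. (\<alpha> + p \<bullet> g) * (\<beta> + q \<bullet> g))"
    unfolding ex by (intro Bochner_Integration.integrable_add j iq)
  show "(\<integral>g. (\<alpha> + p \<bullet> g) * (\<beta> + q \<bullet> g) \<partial>std_gauss) = \<alpha> * \<beta> + p \<bullet> q"
    unfolding ex using j iq q ip[of q] ip[of p] by (simp add: prob_space)
qed

lemma std_gauss_frobenius:
  fixes X Y :: "real^'n^'m"
  shows "integrable std_gauss (\<lambda>g. (X *v g) \<bullet> (Y *v g))" "(\<integral>g. (X *v g) \<bullet> (Y *v g) \<partial>std_gauss) = X \<bullet> Y"
proof -
  have eq: "(X *v g) \<bullet> (Y *v g) = (\<Sum>i\<in>UNIV. (0 + X $ i \<bullet> g) * (0 + Y $ i \<bullet> g))" for g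
    by (simp add: inner_vec_def[of "X *v g"] matrix_vector_mul_component)
  show "integrable std_gauss (\<lambda>g. (X *v g) \<bullet> (Y *v g))"
    unfolding eq by (intro Bochner_Integration.integrable_sum std_gauss_linear_moments)
  show "(\<integral>g. (X *v g) \<bullet> (Y *v g) \<partial>std_gauss) = X \<bullet> Y"
    unfolding eq Bochner_Integration.integral_sum[OF std_gauss_linear_moments(3)] std_gauss_linear_moments(4)
    by (simp add: inner_vec_def[of X])
qed

lemma space_gauss [simp]: "space (gauss S) = UNIV"
  and sets_gauss [simp, measurable_cong]: "sets (gauss S) = sets borel"
  by (simp_all add: gauss_def)

lemma prob_space_gauss: "prob_space (gauss S)"
  unfolding gauss_def by (intro prob_space.prob_space_distr prob_space_std_gauss) measurable

lemma integral_gauss: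
  fixes f :: "real^'n \<Rightarrow> 'b::{banach, second_countable_topology}"
  assumes "f \<in> borel_measurable borel"
  shows "(\<integral>x. f x \<partial>gauss S) = (\<integral>g. f (msqrt S *v g) \<partial>std_gauss)"
  unfolding gauss_def using assms by (intro integral_distr) measurable

lemma pair_gauss_eq:
  "gauss S \<Otimes>\<^sub>M gauss T = distr (std_gauss \<Otimes>\<^sub>M std_gauss) (borel \<Otimes>\<^sub>M borel) (\<lambda>(g, u). (msqrt S *v g, msqrt T *v u))"
  unfolding gauss_def
  by (intro pair_measure_distr prob_space_imp_sigma_finite prob_space_gauss[unfolded gauss_def]) measurable

lemma sample_dist_eq:
  "sample_dist M S T = distr (std_gauss \<Otimes>\<^sub>M std_gauss) borel
     (\<lambda>(g, u). (msqrt S *v g, M *v (msqrt S *v g) + msqrt T *v u))"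
proof -
  have "sample_dist M S T = distr (distr (std_gauss \<Otimes>\<^sub>M std_gauss) (borel \<Otimes>\<^sub>M borel)
      (\<lambda>(g, u). (msqrt S *v g, msqrt T *v u))) (borel \<Otimes>\<^sub>M borel) (\<lambda>(x, z). (x, M *v x + z))"
    unfolding sample_dist_def pair_gauss_eq borel_prod ..
  also have "\<dots> = distr (std_gauss \<Otimes>\<^sub>M std_gauss) (borel \<Otimes>\<^sub>M borel)
     (\<lambda>(g, u). (msqrt S *v g, M *v (msqrt S *v g) + msqrt T *v u))"
    by (subst distr_distr) (measurable, auto simp: comp_def split_beta' intro!: distr_cong)
  finally show ?thesis by (simp add: borel_prod)
qed

lemma space_sample_dist [simp]: "space (sample_dist M S T) = UNIV"
  and sets_sample_dist [simp, measurable_cong]: "sets (sample_dist M S T) = sets borel"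
  by (simp_all add: sample_dist_def)

lemma measurable_sample_map [measurable]:
  "(\<lambda>(g, u). (msqrt S *v g, M *v (msqrt S *v g) + msqrt T *v u)) \<in> borel_measurable (std_gauss \<Otimes>\<^sub>M std_gauss)"
  unfolding split_beta' by (intro borel_measurable_Pair) measurable

lemma prob_space_pair_std_gauss: "prob_space (std_gauss \<Otimes>\<^sub>M std_gauss :: ((real^'n) \<times> (real^'m)) measure)"
proof -
  interpret A: prob_space "std_gauss :: (real^'n) measure" by (rule prob_space_std_gauss)
  interpret B: prob_space "std_gauss :: (real^'m) measure" by (rule prob_space_std_gauss)
  interpret pair_prob_space "std_gauss :: (real^'n) measure" "std_gauss :: (real^'m) measure" ..
  show ?thesis by (rule prob_space_axioms)
qed

lemma prob_space_sample_dist: "prob_space (sample_dist M S T)"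
  unfolding sample_dist_eq
  by (intro prob_space.prob_space_distr prob_space_pair_std_gauss) measurable

lemma integrable_pair_std_gauss_bound:
  fixes f :: "(real^'n) \<times> (real^'m) \<Rightarrow> real"
  assumes [measurable]: "f \<in> borel_measurable (std_gauss \<Otimes>\<^sub>M std_gauss)" and c: "c < 1 / 2"
    and f: "\<And>g u. \<bar>f (g, u)\<bar> \<le> C * exp (c * ((norm g)\<^sup>2 + (norm u)\<^sup>2))"
  shows "integrable (std_gauss \<Otimes>\<^sub>M std_gauss) f"
proof (rule Bochner_Integration.integrable_bound)
  interpret A: prob_space "std_gauss :: (real^'n) measure" by (rule prob_space_std_gauss)
  interpret B: prob_space "std_gauss :: (real^'m) measure" by (rule prob_space_std_gauss)
  interpret pair_prob_space "std_gauss :: (real^'n) measure" "std_gauss :: (real^'m) measure" ..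
  have "integrable (std_gauss \<Otimes>\<^sub>M std_gauss) (\<lambda>z :: (real^'n) \<times> (real^'m). exp (c * (norm (fst z))\<^sup>2) * exp (c * (norm (snd z))\<^sup>2))"
  proof (rule Fubini_integrable)
    show "integrable std_gauss (\<lambda>g :: real^'n. (\<integral>u. norm (exp (c * (norm (fst (g, u :: real^'m)))\<^sup>2) * exp (c * (norm (snd (g, u)))\<^sup>2)) \<partial>std_gauss))"
      by (simp add: std_gauss_exp_sq_integrable[OF c])
    show "AE g in (std_gauss :: (real^'n) measure). integrable std_gauss (\<lambda>u :: real^'m. exp (c * (norm (fst (g, u)))\<^sup>2) * exp (c * (norm (snd (g, u)))\<^sup>2))"
      using std_gauss_exp_sq_integrable[OF c] by simp
  qed measurable
  then show "integrable (std_gauss \<Otimes>\<^sub>M std_gauss) (\<lambda>z :: (real^'n) \<times> (real^'m). C * (exp (c * (norm (fst z))\<^sup>2) * exp (c * (norm (snd z))\<^sup>2)))"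
    by (rule integrable_mult_right)
  show "AE z in std_gauss \<Otimes>\<^sub>M std_gauss. norm (f z) \<le> norm (C * (exp (c * (norm (fst z))\<^sup>2) * exp (c * (norm (snd z))\<^sup>2)))"
  proof (intro AE_I2)
    fix z :: "(real^'n) \<times> (real^'m)"
    show "norm (f z) \<le> norm (C * (exp (c * (norm (fst z))\<^sup>2) * exp (c * (norm (snd z))\<^sup>2)))"
      using f[of "fst z" "snd z"] by (auto simp: exp_add distrib_left intro: order_trans[OF _ abs_ge_self])
  qed
qed fact

lemma integral_sample_dist:
  fixes f :: "(real^'d) \<times> (real^'p) \<Rightarrow> real"
  assumes [measurable]: "f \<in> borel_measurable borel"
  shows "(\<integral>s. f s \<partial>sample_dist M S T) = (\<integral>(g, u). f (msqrt S *v g, M *v (msqrt S *v g) + msqrt T *v u) \<partial>(std_gauss \<Otimes>\<^sub>M std_gauss))"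
    and "integrable (sample_dist M S T) f \<longleftrightarrow>
      integrable (std_gauss \<Otimes>\<^sub>M std_gauss) (\<lambda>(g, u). f (msqrt S *v g, M *v (msqrt S *v g) + msqrt T *v u))"
  unfolding sample_dist_eq by (simp_all add: integral_distr integrable_distr_eq split_beta')

lemma distr_fst_sample_dist: "distr (sample_dist M S T) borel fst = gauss S"
proof -
  interpret G: prob_space "gauss T" by (rule prob_space_gauss)
  have "distr (sample_dist M S T) borel fst = distr (gauss S \<Otimes>\<^sub>M gauss T) borel (fst \<circ> (\<lambda>(x, z). (x, M *v x + z)))"
    unfolding sample_dist_def by (intro distr_distr) (auto simp: borel_prod[symmetric])
  also have "\<dots> = distr (gauss S \<Otimes>\<^sub>M gauss T) (gauss S) fst"
    by (intro distr_cong) auto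
  also have "\<dots> = gauss S" by (rule G.distr_pair_fst)
  finally show ?thesis .
qed

lemma integral_sample_dist_fst:
  fixes f :: "(real^'d) \<Rightarrow> real" and M :: "real^'d^'p"
  assumes [measurable]: "f \<in> borel_measurable borel"
  shows "(\<integral>s. f (fst s) \<partial>sample_dist M S T) = (\<integral>g. f (msqrt S *v g) \<partial>std_gauss)"
proof -
  have "(\<integral>s. f (fst s) \<partial>sample_dist M S T) = (\<integral>x. f x \<partial>distr (sample_dist M S T) borel fst)"
  proof (rule integral_distr[symmetric])
    have "(fst :: (real^'d) \<times> (real^'p) \<Rightarrow> _) \<in> borel \<rightarrow>\<^sub>M borel" by (simp add: borel_prod[symmetric])
    then show "fst \<in> sample_dist M S T \<rightarrow>\<^sub>M borel" by measurable
  qed fact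
  then show ?thesis by (simp add: distr_fst_sample_dist integral_gauss)
qed

section \<open>Derivatives of the empirical objective\<close>

lemma linear_eq_inner_sum_Basis:
  fixes l :: "'a::euclidean_space \<Rightarrow> real"
  assumes l: "linear l"
  shows "l x = x \<bullet> (\<Sum>b\<in>Basis. l b *\<^sub>R b)"
proof -
  have "l x = l (\<Sum>b\<in>Basis. (x \<bullet> b) *\<^sub>R b)" unfolding euclidean_representation ..
  also have "\<dots> = (\<Sum>b\<in>Basis. (x \<bullet> b) *\<^sub>R l b)" unfolding linear_sum[OF l] linear_scale[OF l] ..
  also have "\<dots> = x \<bullet> (\<Sum>b\<in>Basis. l b *\<^sub>R b)"
    unfolding inner_sum_right inner_scaleR_right real_scaleR_def by (intro sum.cong refl mult.commute)
  finally show ?thesis .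
qed

lemma grad_eq_sum_Basis:
  fixes f :: "'a::euclidean_space \<Rightarrow> real"
  assumes f: "(f has_derivative f') (at x)"
  shows "grad f x = (\<Sum>b\<in>Basis. f' b *\<^sub>R b)"
  unfolding grad_def
proof (rule the_equality)
  have eq: "f' = (\<lambda>h. h \<bullet> (\<Sum>b\<in>Basis. f' b *\<^sub>R b))"
    using linear_eq_inner_sum_Basis[OF has_derivative_linear[OF f]] by (rule ext)
  show "GDERIV f x :> (\<Sum>b\<in>Basis. f' b *\<^sub>R b)" unfolding gderiv_def eq[symmetric] by (rule f)
  fix D assume "GDERIV f x :> D"
  then have "(\<lambda>h. h \<bullet> D) = f'" using f unfolding gderiv_def by (rule has_derivative_unique)
  then have "(\<lambda>h. h \<bullet> D) = (\<lambda>h. h \<bullet> (\<Sum>b\<in>Basis. f' b *\<^sub>R b))" using eq by (rule trans)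
  then show "D = (\<Sum>b\<in>Basis. f' b *\<^sub>R b)" by (simp only: fun_eq_iff vector_eq_ldot)
qed

lemma bounded_bilinear_matrix_mult:
  "bounded_bilinear ((**) :: real^'n^'m \<Rightarrow> real^'k^'n \<Rightarrow> real^'k^'m)"
proof -
  have "bilinear ((**) :: real^'n^'m \<Rightarrow> real^'k^'n \<Rightarrow> real^'k^'m)"
    unfolding bilinear_def
    by (auto intro!: linearI simp: vec_eq_iff matrix_matrix_mult_def sum_distrib_left algebra_simps sum.distrib)
  then show ?thesis by (simp add: bilinear_conv_bounded_bilinear)
qed

lemma bounded_bilinear_matrix_vector_mult:
  "bounded_bilinear ((*v) :: real^'n^'m \<Rightarrow> real^'n \<Rightarrow> real^'m)"
proof -
  have "bilinear ((*v) :: real^'n^'m \<Rightarrow> real^'n \<Rightarrow> real^'m)"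
    unfolding bilinear_def
    by (auto intro!: linearI simp: matrix_vector_mult_add_rdistrib matrix_vector_right_distrib
        scaleR_matrix_vector_assoc matrix_vector_mult_scaleR)
  then show ?thesis by (simp add: bilinear_conv_bounded_bilinear)
qed

lemma bounded_linear_transpose: "bounded_linear (transpose :: real^'n^'m \<Rightarrow> real^'m^'n)"
  unfolding linear_conv_bounded_linear[symmetric]
  by (rule linearI) (simp_all add: transpose_def vec_eq_iff)

lemma inner_matrix_mult_right:
  fixes X :: "real^'n^'m" and L :: "real^'k^'m" and R :: "real^'n^'k"
  shows "X \<bullet> (L ** R) = (X ** transpose R) \<bullet> L"
proof -
  have "X \<bullet> (L ** R) = (\<Sum>i\<in>UNIV. \<Sum>j\<in>UNIV. \<Sum>k\<in>UNIV. X$i$j * (L$i$k * R$k$j))"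
    by (simp add: inner_vec_def matrix_matrix_mult_def sum_distrib_left)
  also have "\<dots> = (\<Sum>i\<in>UNIV. \<Sum>k\<in>UNIV. \<Sum>j\<in>UNIV. X$i$j * (L$i$k * R$k$j))"
    by (intro sum.cong refl sum.swap)
  also have "\<dots> = (X ** transpose R) \<bullet> L"
    by (simp add: inner_vec_def matrix_matrix_mult_def transpose_def sum_distrib_right sum_distrib_left mult_ac)
  finally show ?thesis .
qed

lemma inner_matrix_mult_left:
  fixes X :: "real^'n^'m" and L :: "real^'k^'m" and R :: "real^'n^'k"
  shows "X \<bullet> (L ** R) = (transpose L ** X) \<bullet> R"
proof -
  have "X \<bullet> (L ** R) = (\<Sum>i\<in>UNIV. \<Sum>j\<in>UNIV. \<Sum>k\<in>UNIV. X$i$j * (L$i$k * R$k$j))"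
    by (simp add: inner_vec_def matrix_matrix_mult_def sum_distrib_left)
  also have "\<dots> = (\<Sum>i\<in>UNIV. \<Sum>k\<in>UNIV. \<Sum>j\<in>UNIV. X$i$j * (L$i$k * R$k$j))"
    by (intro sum.cong refl sum.swap)
  also have "\<dots> = (\<Sum>k\<in>UNIV. \<Sum>i\<in>UNIV. \<Sum>j\<in>UNIV. X$i$j * (L$i$k * R$k$j))"
    by (rule sum.swap)
  also have "\<dots> = (\<Sum>k\<in>UNIV. \<Sum>j\<in>UNIV. \<Sum>i\<in>UNIV. X$i$j * (L$i$k * R$k$j))"
    by (intro sum.cong refl sum.swap)
  also have "\<dots> = (transpose L ** X) \<bullet> R"
    by (simp add: inner_vec_def matrix_matrix_mult_def transpose_def sum_distrib_right sum_distrib_left mult_ac)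
  finally show ?thesis .
qed

lemma inner_outer: "outer x \<bullet> L = x \<bullet> (L *v x)"
  by (simp add: outer_def inner_vec_def matrix_vector_mult_def sum_distrib_left mult_ac)

lemma outer_mult_vec: "outer x *v y = (x \<bullet> y) *\<^sub>R x"
  by (simp add: outer_def matrix_vector_mult_def vec_eq_iff inner_vec_def sum_distrib_left mult_ac)

text \<open>The derivative of the regularizer in direction \<open>\<delta>\<close>, with its four occurrences of the covariance separated.\<close>
definition reg_form :: "('d, 'p::finite) param \<Rightarrow> ('d, 'p) param \<Rightarrow> real^'d^'d \<Rightarrow> real^'d^'d \<Rightarrow> real^'d^'d \<Rightarrow> real^'d^'d \<Rightarrow> real" where
  "reg_form \<theta> \<delta> S1 S2 S3 S4 = 1 / 4 *
     ((S1 ** (transpose (fst \<theta>) ** fst \<theta> - transpose (snd \<theta>) ** S3 ** snd \<theta>) ** S2) \<bullet>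
      (transpose (fst \<delta>) ** fst \<theta> + transpose (fst \<theta>) ** fst \<delta>
       - (transpose (snd \<delta>) ** S4 ** snd \<theta> + transpose (snd \<theta>) ** S4 ** snd \<delta>)))"

lemma reg_has_derivative:
  assumes S: "psd_mat S"
  shows "(reg S has_derivative (\<lambda>\<delta>. reg_form \<theta> \<delta> S S S S)) (at \<theta>)"
proof -
  define R where "R = msqrt S"
  have RR: "R ** R = S" and tR: "transpose R = R" using msqrt_psd[OF S] by (auto simp: R_def psd_mat_def)
  define D where "D = (\<lambda>\<theta> :: ('a, 'b) param. transpose (fst \<theta>) ** fst \<theta> - transpose (snd \<theta>) ** S ** snd \<theta>)"
  define D' where "D' = (\<lambda>\<delta> :: ('a, 'b) param. transpose (fst \<theta>) ** fst \<delta> + transpose (fst \<delta>) ** fst \<theta>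
      - (transpose (snd \<theta>) ** S ** snd \<delta> + (transpose (snd \<theta>) ** 0 + transpose (snd \<delta>) ** S) ** snd \<theta>))"
  note fst' = bounded_linear_imp_has_derivative[OF bounded_linear_fst]
  note snd' = bounded_linear_imp_has_derivative[OF bounded_linear_snd]
  note tfst = bounded_linear.has_derivative[OF bounded_linear_transpose fst']
  note tsnd = bounded_linear.has_derivative[OF bounded_linear_transpose snd']
  have dD: "(D has_derivative D') (at \<theta>)"
    unfolding D_def D'_def
    by (intro has_derivative_diff bounded_bilinear.FDERIV[OF bounded_bilinear_matrix_mult] tfst fst' tsnd snd' has_derivative_const)
  define X where "X = (\<lambda>\<theta>. R ** D \<theta> ** R)"
  have dX: "(X has_derivative (\<lambda>\<delta>. R ** D' \<delta> ** R)) (at \<theta>)"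
    unfolding X_def
    by (intro bounded_linear.has_derivative[OF bounded_bilinear.bounded_linear_left[OF bounded_bilinear_matrix_mult]]
        bounded_linear.has_derivative[OF bounded_bilinear.bounded_linear_right[OF bounded_bilinear_matrix_mult]] dD)
  have "((\<lambda>\<theta>. 1 / 8 * (X \<theta> \<bullet> X \<theta>)) has_derivative (\<lambda>\<delta>. 1 / 8 * (X \<theta> \<bullet> (R ** D' \<delta> ** R) + (R ** D' \<delta> ** R) \<bullet> X \<theta>))) (at \<theta>)"
    by (intro has_derivative_mult_right has_derivative_inner dX)
  moreover have "(\<lambda>\<theta>. 1 / 8 * (X \<theta> \<bullet> X \<theta>)) = reg S"
    by (rule ext) (simp add: reg_def X_def D_def R_def power2_norm_eq_inner)
  moreover have "1 / 8 * (X \<theta> \<bullet> (R ** D' \<delta> ** R) + (R ** D' \<delta> ** R) \<bullet> X \<theta>) = reg_form \<theta> \<delta> S S S S" for \<delta>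
  proof -
    have "X \<theta> \<bullet> (R ** D' \<delta> ** R) = (R ** (R ** D \<theta> ** R ** R)) \<bullet> D' \<delta>"
      unfolding X_def inner_matrix_mult_right[of _ "R ** D' \<delta>"] inner_matrix_mult_left[of _ R] tR ..
    also have "R ** (R ** D \<theta> ** R ** R) = S ** D \<theta> ** S"
      unfolding RR[symmetric] by (simp only: matrix_mul_assoc)
    finally have "X \<theta> \<bullet> (R ** D' \<delta> ** R) = (S ** D \<theta> ** S) \<bullet> D' \<delta>" .
    moreover have D': "D' \<delta> = transpose (fst \<delta>) ** fst \<theta> + transpose (fst \<theta>) ** fst \<delta>
       - (transpose (snd \<delta>) ** S ** snd \<theta> + transpose (snd \<theta>) ** S ** snd \<delta>)"
      unfolding D'_def by (simp add: algebra_simps bounded_bilinear.zero_right[OF bounded_bilinear_matrix_mult])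
    moreover have "reg_form \<theta> \<delta> S S S S = 1 / 4 * ((S ** D \<theta> ** S) \<bullet> D' \<delta>)"
      unfolding reg_form_def D_def D' ..
    ultimately show ?thesis
      unfolding inner_commute[of "R ** D' \<delta> ** R"] by (simp only:) simp
  qed
  ultimately show ?thesis by simp
qed

definition affine_form :: "('a::real_inner \<Rightarrow> real) \<Rightarrow> bool" where
  "affine_form f \<longleftrightarrow> (\<exists>c L. f = (\<lambda>X. c + X \<bullet> L))"

lemma linear_imp_affine_form:
  fixes l :: "'a::euclidean_space \<Rightarrow> real"
  assumes l: "linear l"
  shows "affine_form (\<lambda>X. c + l X)"
  unfolding affine_form_def by (intro exI[of _ c] exI[of _ "\<Sum>b\<in>Basis. l b *\<^sub>R b"] ext)
    (rule arg_cong[OF linear_eq_inner_sum_Basis[OF l]])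

lemma reg_form_affine:
  "affine_form (\<lambda>S. reg_form \<theta> \<delta> S S2 S3 S4)"
  "affine_form (\<lambda>S. reg_form \<theta> \<delta> S1 S S3 S4)"
  "affine_form (\<lambda>S. reg_form \<theta> \<delta> S1 S2 S S4)"
  "affine_form (\<lambda>S. reg_form \<theta> \<delta> S1 S2 S3 S)"
proof -
  note mm = bounded_bilinear_matrix_mult
  note lin = bounded_bilinear.add_left[OF mm] bounded_bilinear.add_right[OF mm]
    bounded_bilinear.scaleR_left[OF mm] bounded_bilinear.scaleR_right[OF mm]
  let ?D = "\<lambda>S3. transpose (fst \<theta>) ** fst \<theta> - transpose (snd \<theta>) ** S3 ** snd \<theta>"
  let ?E = "transpose (fst \<delta>) ** fst \<theta> + transpose (fst \<theta>) ** fst \<delta>"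
  let ?F = "\<lambda>S4. transpose (snd \<delta>) ** S4 ** snd \<theta> + transpose (snd \<theta>) ** S4 ** snd \<delta>"
  note ilin = inner_add_left inner_add_right inner_scaleR_left inner_scaleR_right scaleR_add_right[symmetric]
  have "affine_form (\<lambda>S. 0 + 1 / 4 * ((S ** ?D S3 ** S2) \<bullet> (?E - ?F S4)))"
    by (rule linear_imp_affine_form, rule linearI; unfold lin ilin) (simp_all only: distrib_left real_scaleR_def mult.left_commute)
  then show "affine_form (\<lambda>S. reg_form \<theta> \<delta> S S2 S3 S4)" unfolding reg_form_def add_0 .
  have "affine_form (\<lambda>S. 0 + 1 / 4 * ((S1 ** ?D S3 ** S) \<bullet> (?E - ?F S4)))"
    by (rule linear_imp_affine_form, rule linearI; unfold lin ilin) (simp_all only: distrib_left real_scaleR_def mult.left_commute)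
  then show "affine_form (\<lambda>S. reg_form \<theta> \<delta> S1 S S3 S4)" unfolding reg_form_def add_0 .
  let ?G = "1 / 4 * ((S1 ** (transpose (fst \<theta>) ** fst \<theta>) ** S2) \<bullet> (?E - ?F S4))"
  let ?l = "\<lambda>S. 1 / 4 * ((S1 ** (transpose (snd \<theta>) ** S ** snd \<theta>) ** S2) \<bullet> (?F S4 - ?E))"
  have "affine_form (\<lambda>S. ?G + ?l S)"
    by (rule linear_imp_affine_form, rule linearI; unfold lin ilin) (simp_all only: distrib_left real_scaleR_def mult.left_commute)
  moreover have "reg_form \<theta> \<delta> S1 S2 S S4 = ?G + ?l S" for S
    unfolding reg_form_def bounded_bilinear.diff_left[OF mm] bounded_bilinear.diff_right[OF mm] inner_diff_left
      inner_diff_right[of _ "?F S4" ?E] inner_diff_right[of _ ?E "?F S4"]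
    by (simp only: right_diff_distrib)
  ultimately show "affine_form (\<lambda>S. reg_form \<theta> \<delta> S1 S2 S S4)" by (simp only:)
  let ?G = "1 / 4 * ((S1 ** ?D S3 ** S2) \<bullet> ?E)"
  let ?l = "\<lambda>S. - (1 / 4) * ((S1 ** ?D S3 ** S2) \<bullet> ?F S)"
  have "affine_form (\<lambda>S. ?G + ?l S)"
    by (rule linear_imp_affine_form, rule linearI; unfold lin ilin) (simp_all only: distrib_left real_scaleR_def mult.left_commute)
  moreover have "reg_form \<theta> \<delta> S1 S2 S3 S = ?G + ?l S" for S
    unfolding reg_form_def inner_diff_right[of _ ?E] by (simp only: right_diff_distrib)
  ultimately show "affine_form (\<lambda>S. reg_form \<theta> \<delta> S1 S2 S3 S)" by (simp only:)
qed

lemma affine_form_average: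
  assumes f: "affine_form f" and n: "0 < n"
  shows "f ((1 / real n) *\<^sub>R (\<Sum>i<n. X i)) = (1 / real n) * (\<Sum>i<n. f (X i))"
proof -
  obtain c L where f: "f = (\<lambda>X. c + X \<bullet> L)" using f by (auto simp: affine_form_def)
  show ?thesis unfolding f using n by (simp add: inner_sum_left sum.distrib distrib_left)
qed

lemma affine_form_gauss:
  fixes f :: "real^'d^'d \<Rightarrow> real"
  assumes f: "affine_form f" and S: "psd_mat S"
  shows "(\<integral>g. f (outer (msqrt S *v g)) \<partial>std_gauss) = f S"
proof -
  interpret prob_space "std_gauss :: (real^'d) measure" by (rule prob_space_std_gauss)
  obtain c L where f: "f = (\<lambda>X. c + X \<bullet> L)" using f by (auto simp: affine_form_def)
  define R where "R = msqrt S"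
  have RR: "R ** R = S" and tR: "transpose R = R" using msqrt_psd[OF S] by (auto simp: R_def psd_mat_def)
  have p1: "prob UNIV = 1" using prob_space by simp
  have eq: "f (outer (R *v g)) = c + (R *v g) \<bullet> ((L ** R) *v g)" for g
    unfolding f inner_outer by (simp add: matrix_vector_mul_assoc)
  have "(\<integral>g. f (outer (msqrt S *v g)) \<partial>std_gauss) = c + R \<bullet> (L ** R)"
    unfolding R_def[symmetric] eq using std_gauss_frobenius[of R "L ** R"] by (simp add: p1)
  also have "R \<bullet> (L ** R) = S \<bullet> L" unfolding inner_matrix_mult_right tR RR ..
  finally show "(\<integral>g. f (outer (msqrt S *v g)) \<partial>std_gauss) = f S" unfolding f .
qed

text \<open>The directional derivative of the loss as a function of a query \<open>(x, y)\<close> and three keys.\<close>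
definition loss_form :: "('d, 'p::finite) param \<Rightarrow> ('d, 'p) param \<Rightarrow> (real^'d) \<times> (real^'p) \<Rightarrow> real^'d \<Rightarrow> real^'d \<Rightarrow> real^'d \<Rightarrow> real" where
  "loss_form \<theta> \<delta> s a b c = (fst \<theta> *v a - snd s) \<bullet> (fst \<delta> *v b)
     + ((fst \<theta> *v a - snd s) \<bullet> (fst \<theta> *v b)) * (fst s \<bullet> (snd \<delta> *v (b - c)))"

lemma emp_attn_has_derivative:
  fixes xs :: "nat \<Rightarrow> real^'d" and \<theta> :: "('d, 'p::finite) param" and i :: nat
  assumes n: "0 < n"
  defines "e \<equiv> \<lambda>j. exp (xs i \<bullet> (snd \<theta> *v xs j))"
  defines "p \<equiv> \<lambda>j. e j / (\<Sum>t<n. e t)"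
  shows "emp_attn (snd \<theta>) xs n i = (\<Sum>j<n. p j *\<^sub>R xs j)"
    and "((\<lambda>\<theta> :: ('d, 'p) param. emp_attn (snd \<theta>) xs n i) has_derivative
      (\<lambda>\<delta>. \<Sum>k<n. \<Sum>l<n. (p k * p l * (xs i \<bullet> (snd \<delta> *v (xs k - xs l)))) *\<^sub>R xs k)) (at \<theta>)"
proof -
  let ?t = "\<lambda>(\<delta> :: ('d, 'p) param) j. xs i \<bullet> (snd \<delta> *v xs j)"
  define W where "W = (\<Sum>t<n. e t)"
  have W: "0 < W" unfolding W_def e_def using n by (intro sum_pos) (auto simp: lessThan_empty_iff)
  have psum: "(\<Sum>j<n. p j) = 1"
    unfolding p_def sum_divide_distrib[symmetric] W_def[symmetric] using W by simp
  have e: "e j = W * p j" for j unfolding p_def W_def[symmetric] using W by simp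
  show attn: "emp_attn (snd \<theta>) xs n i = (\<Sum>j<n. p j *\<^sub>R xs j)"
    unfolding emp_attn_def p_def e_def by (simp add: scaleR_sum_right)
  have lin: "((\<lambda>\<theta>. ?t \<theta> j) has_derivative (\<lambda>\<delta>. ?t \<delta> j)) (at \<theta>)" for j
  proof -
    have "bounded_linear (\<lambda>\<theta> :: ('d, 'p) param. ?t \<theta> j)"
      unfolding linear_conv_bounded_linear[symmetric]
      by (rule linearI) (simp_all add: matrix_vector_mult_add_rdistrib scaleR_matrix_vector_assoc[symmetric] inner_add_right)
    then show ?thesis by (rule bounded_linear_imp_has_derivative)
  qed
  have de: "((\<lambda>\<theta>. exp (?t \<theta> j)) has_derivative (\<lambda>\<delta>. e j * ?t \<delta> j)) (at \<theta>)" for j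
  proof -
    have "(exp has_field_derivative exp (?t \<theta> j)) (at (?t \<theta> j))" by (rule DERIV_exp)
    from has_derivative_compose[OF lin this[unfolded has_field_derivative_def]] show ?thesis by (simp add: e_def)
  qed
  have dW: "((\<lambda>\<theta>. \<Sum>j<n. exp (?t \<theta> j)) has_derivative (\<lambda>\<delta>. \<Sum>j<n. e j * ?t \<delta> j)) (at \<theta>)"
    by (intro has_derivative_sum de)
  have dS: "((\<lambda>\<theta>. \<Sum>j<n. exp (?t \<theta> j) *\<^sub>R xs j) has_derivative (\<lambda>\<delta>. \<Sum>j<n. (e j * ?t \<delta> j) *\<^sub>R xs j)) (at \<theta>)"
    by (intro has_derivative_sum has_derivative_scaleR_left de)
  have dI: "((\<lambda>\<theta>. inverse (\<Sum>j<n. exp (?t \<theta> j))) has_derivative (\<lambda>\<delta>. - (inverse W * (\<Sum>j<n. e j * ?t \<delta> j) * inverse W))) (at \<theta>)"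
    using Deriv.has_derivative_inverse[OF _ dW] W unfolding W_def e_def by simp
  have "((\<lambda>\<theta>. inverse (\<Sum>j<n. exp (?t \<theta> j)) *\<^sub>R (\<Sum>j<n. exp (?t \<theta> j) *\<^sub>R xs j)) has_derivative
      (\<lambda>\<delta>. inverse W *\<^sub>R (\<Sum>j<n. (e j * ?t \<delta> j) *\<^sub>R xs j)
        + (- (inverse W * (\<Sum>j<n. e j * ?t \<delta> j) * inverse W)) *\<^sub>R (\<Sum>j<n. e j *\<^sub>R xs j))) (at \<theta>)"
    using has_derivative_scaleR[OF dI dS] unfolding W_def e_def .
  moreover have "inverse W *\<^sub>R (\<Sum>j<n. (e j * ?t \<delta> j) *\<^sub>R xs j)
        + (- (inverse W * (\<Sum>j<n. e j * ?t \<delta> j) * inverse W)) *\<^sub>R (\<Sum>j<n. e j *\<^sub>R xs j)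
      = (\<Sum>k<n. \<Sum>l<n. (p k * p l * (xs i \<bullet> (snd \<delta> *v (xs k - xs l)))) *\<^sub>R xs k)" for \<delta>
  proof -
    define T where "T = (\<Sum>l<n. p l * ?t \<delta> l)"
    have 1: "inverse W *\<^sub>R (\<Sum>j<n. (e j * ?t \<delta> j) *\<^sub>R xs j) = (\<Sum>k<n. (p k * ?t \<delta> k) *\<^sub>R xs k)"
      unfolding scaleR_sum_right scaleR_scaleR e using W by (intro sum.cong refl) (simp add: field_simps)
    have "(\<Sum>j<n. e j * ?t \<delta> j) = W * T" by (simp add: e T_def sum_distrib_left mult.assoc)
    then have 2: "(- (inverse W * (\<Sum>j<n. e j * ?t \<delta> j) * inverse W)) *\<^sub>R (\<Sum>j<n. e j *\<^sub>R xs j)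
        = - (\<Sum>k<n. (p k * T) *\<^sub>R xs k)"
      unfolding scaleR_sum_right scaleR_scaleR e sum_negf[symmetric] using W
      by (intro sum.cong refl) (simp add: field_simps)
    have "(\<Sum>l<n. (p k * p l * (xs i \<bullet> (snd \<delta> *v (xs k - xs l)))) *\<^sub>R xs k) = (p k * ?t \<delta> k - p k * T) *\<^sub>R xs k" for k
    proof -
      have "(\<Sum>l<n. p k * p l * (xs i \<bullet> (snd \<delta> *v (xs k - xs l)))) = (\<Sum>l<n. p k * ?t \<delta> k * p l - p k * (p l * ?t \<delta> l))"
        by (intro sum.cong refl) (simp add: matrix_vector_mult_diff_distrib inner_diff_right algebra_simps)
      also have "\<dots> = p k * ?t \<delta> k - p k * T"
        unfolding sum_subtractf sum_distrib_left[symmetric] psum T_def by simp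
      finally show ?thesis by (simp only: scaleR_sum_left[symmetric])
    qed
    then show ?thesis unfolding 1 2 by (simp add: scaleR_diff_left sum_subtractf)
  qed
  moreover have "(\<lambda>\<theta> :: ('d, 'p) param. emp_attn (snd \<theta>) xs n i)
      = (\<lambda>\<theta>. inverse (\<Sum>j<n. exp (?t \<theta> j)) *\<^sub>R (\<Sum>j<n. exp (?t \<theta> j) *\<^sub>R xs j))"
    by (simp add: emp_attn_def inverse_eq_divide)
  ultimately show "((\<lambda>\<theta> :: ('d, 'p) param. emp_attn (snd \<theta>) xs n i) has_derivative
      (\<lambda>\<delta>. \<Sum>k<n. \<Sum>l<n. (p k * p l * (xs i \<bullet> (snd \<delta> *v (xs k - xs l)))) *\<^sub>R xs k)) (at \<theta>)"
    by (simp only:)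
qed

lemma emp_loss_has_derivative:
  fixes \<theta> :: "('d::finite, 'p::finite) param" and s :: "nat \<Rightarrow> (real^'d) \<times> (real^'p)"
  assumes n: "0 < n"
  defines "w \<equiv> \<lambda>i j. exp (fst (s i) \<bullet> (snd \<theta> *v fst (s j)))"
  shows "(emp_loss n s has_derivative (\<lambda>\<delta>. (1 / real n) * (\<Sum>i<n. \<Sum>j<n. \<Sum>k<n. \<Sum>l<n.
     w i j * w i k * w i l / (\<Sum>t<n. w i t) ^ 3 * loss_form \<theta> \<delta> (s i) (fst (s j)) (fst (s k)) (fst (s l))))) (at \<theta>)"
proof -
  define p where "p = (\<lambda>i j. w i j / (\<Sum>t<n. w i t))"
  let ?x = "\<lambda>j. fst (s j)"
  let ?a = "\<lambda>i \<theta>. emp_attn (snd \<theta>) ?x n i"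
  let ?r = "\<lambda>i \<theta>. fst \<theta> *v ?a i \<theta> - snd (s i)"
  let ?da = "\<lambda>i \<delta>. \<Sum>k<n. \<Sum>l<n. (p i k * p i l * (?x i \<bullet> (snd \<delta> *v (?x k - ?x l)))) *\<^sub>R ?x k"
  have psum: "(\<Sum>j<n. p i j) = 1" for i
  proof -
    have "0 < (\<Sum>t<n. w i t)" unfolding w_def using n by (intro sum_pos) (auto simp: lessThan_empty_iff)
    then show ?thesis unfolding p_def sum_divide_distrib[symmetric] by simp
  qed
  have a: "?a i \<theta> = (\<Sum>j<n. p i j *\<^sub>R ?x j)" for i
    unfolding p_def w_def by (rule emp_attn_has_derivative(1)[OF n])
  have da: "(?a i has_derivative ?da i) (at \<theta>)" for i
    unfolding p_def w_def by (rule emp_attn_has_derivative(2)[OF n])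
  have dr: "(?r i has_derivative (\<lambda>\<delta>. fst \<theta> *v ?da i \<delta> + fst \<delta> *v ?a i \<theta> - 0)) (at \<theta>)" for i
    by (intro has_derivative_diff has_derivative_const bounded_bilinear.FDERIV[OF bounded_bilinear_matrix_vector_mult]
        bounded_linear_imp_has_derivative[OF bounded_linear_fst] da)
  have "((\<lambda>\<theta>. (1 / (2 * real n)) * (\<Sum>i<n. ?r i \<theta> \<bullet> ?r i \<theta>)) has_derivative
      (\<lambda>\<delta>. (1 / (2 * real n)) * (\<Sum>i<n. ?r i \<theta> \<bullet> (fst \<theta> *v ?da i \<delta> + fst \<delta> *v ?a i \<theta> - 0)
        + (fst \<theta> *v ?da i \<delta> + fst \<delta> *v ?a i \<theta> - 0) \<bullet> ?r i \<theta>))) (at \<theta>)"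
    by (intro has_derivative_mult_right has_derivative_sum has_derivative_inner dr)
  moreover have "(\<lambda>\<theta>. (1 / (2 * real n)) * (\<Sum>i<n. ?r i \<theta> \<bullet> ?r i \<theta>)) = emp_loss n s"
    by (rule ext) (simp add: emp_loss_def power2_norm_eq_inner)
  moreover have "(1 / (2 * real n)) * (\<Sum>i<n. ?r i \<theta> \<bullet> (fst \<theta> *v ?da i \<delta> + fst \<delta> *v ?a i \<theta> - 0)
        + (fst \<theta> *v ?da i \<delta> + fst \<delta> *v ?a i \<theta> - 0) \<bullet> ?r i \<theta>)
    = (1 / real n) * (\<Sum>i<n. \<Sum>j<n. \<Sum>k<n. \<Sum>l<n.
     w i j * w i k * w i l / (\<Sum>t<n. w i t) ^ 3 * loss_form \<theta> \<delta> (s i) (?x j) (?x k) (?x l))" for \<delta>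
  proof -
    let ?d = "\<lambda>i. fst \<theta> *v ?da i \<delta> + fst \<delta> *v ?a i \<theta>"
    let ?v = "\<lambda>i j. fst \<theta> *v ?x j - snd (s i)"
    let ?q = "\<lambda>i k l. (?x i \<bullet> (snd \<delta> *v (?x k - ?x l)))"
    have r: "?r i \<theta> = (\<Sum>j<n. p i j *\<^sub>R ?v i j)" for i
      unfolding a by (simp add: linear_sum linear_scale matrix_vector_mult_scaleR scaleR_diff_right sum_subtractf
          scaleR_sum_left[symmetric] psum)
    have d: "?d i = (\<Sum>k<n. \<Sum>l<n. (p i k * p i l) *\<^sub>R (fst \<delta> *v ?x k + ?q i k l *\<^sub>R (fst \<theta> *v ?x k)))" for i
    proof -
      have "fst \<delta> *v ?a i \<theta> = (\<Sum>k<n. \<Sum>l<n. (p i k * p i l) *\<^sub>R (fst \<delta> *v ?x k))"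
        unfolding a by (simp add: linear_sum linear_scale matrix_vector_mult_scaleR scaleR_sum_left[symmetric]
            sum_distrib_left[symmetric] psum)
      moreover have "fst \<theta> *v ?da i \<delta> = (\<Sum>k<n. \<Sum>l<n. (p i k * p i l) *\<^sub>R (?q i k l *\<^sub>R (fst \<theta> *v ?x k)))"
        by (simp add: linear_sum linear_scale matrix_vector_mult_scaleR)
      ultimately show ?thesis by (simp add: scaleR_add_right sum.distrib)
    qed
    have "?r i \<theta> \<bullet> ?d i = (\<Sum>j<n. \<Sum>k<n. \<Sum>l<n. w i j * w i k * w i l / (\<Sum>t<n. w i t) ^ 3 * loss_form \<theta> \<delta> (s i) (?x j) (?x k) (?x l))" for i
      unfolding r d inner_sum_left
    proof (intro sum.cong refl)
      fix j
      have "p i j *\<^sub>R ?v i j \<bullet> (\<Sum>k<n. \<Sum>l<n. (p i k * p i l) *\<^sub>R (fst \<delta> *v ?x k + ?q i k l *\<^sub>R (fst \<theta> *v ?x k)))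
          = (\<Sum>k<n. \<Sum>l<n. p i j *\<^sub>R ?v i j \<bullet> (p i k * p i l) *\<^sub>R (fst \<delta> *v ?x k + ?q i k l *\<^sub>R (fst \<theta> *v ?x k)))"
        unfolding inner_sum_right ..
      also have "\<dots> = (\<Sum>k<n. \<Sum>l<n. w i j * w i k * w i l / (\<Sum>t<n. w i t) ^ 3 * loss_form \<theta> \<delta> (s i) (?x j) (?x k) (?x l))"
      proof (intro sum.cong refl)
        fix k l
        have c: "w i j * w i k * w i l / (\<Sum>t<n. w i t) ^ 3 = p i j * (p i k * p i l)"
          by (simp add: p_def power3_eq_cube)
        show "p i j *\<^sub>R ?v i j \<bullet> (p i k * p i l) *\<^sub>R (fst \<delta> *v ?x k + ?q i k l *\<^sub>R (fst \<theta> *v ?x k))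
            = w i j * w i k * w i l / (\<Sum>t<n. w i t) ^ 3 * loss_form \<theta> \<delta> (s i) (?x j) (?x k) (?x l)"
          unfolding c loss_form_def
          by (simp only: inner_scaleR_left inner_scaleR_right inner_add_right distrib_left mult_ac)
      qed
      finally show "p i j *\<^sub>R ?v i j \<bullet> (\<Sum>k<n. \<Sum>l<n. (p i k * p i l) *\<^sub>R (fst \<delta> *v ?x k + ?q i k l *\<^sub>R (fst \<theta> *v ?x k)))
          = (\<Sum>k<n. \<Sum>l<n. w i j * w i k * w i l / (\<Sum>t<n. w i t) ^ 3 * loss_form \<theta> \<delta> (s i) (?x j) (?x k) (?x l))" .
    qed
    moreover have "(1 / (2 * real n)) * (\<Sum>i<n. ?r i \<theta> \<bullet> (?d i - 0) + (?d i - 0) \<bullet> ?r i \<theta>) = (1 / real n) * (\<Sum>i<n. ?r i \<theta> \<bullet> ?d i)"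
      unfolding diff_zero inner_commute[of "?d _"] sum.distrib by simp
    ultimately show ?thesis by (simp only:)
  qed
  ultimately show ?thesis by (simp only:)
qed

section \<open>Closed form of the population objective\<close>

lemma norm_matrix_vector_mult_le:
  fixes A :: "real^'n^'m"
  shows "norm (A *v x) \<le> norm A * norm x"
proof (rule power2_le_imp_le)
  have "(norm (A *v x))\<^sup>2 = (\<Sum>i\<in>UNIV. (A $ i \<bullet> x)\<^sup>2)"
    unfolding power2_norm_eq_inner inner_vec_def[of "A *v x"] by (simp add: matrix_vector_mul_component power2_eq_square)
  also have "\<dots> \<le> (\<Sum>i\<in>UNIV. (A $ i \<bullet> A $ i) * (x \<bullet> x))"
    by (intro sum_mono Cauchy_Schwarz_ineq)
  also have "\<dots> = (norm A * norm x)\<^sup>2"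
    by (simp add: power_mult_distrib power2_norm_eq_inner inner_vec_def[of A] sum_distrib_right)
  finally show "(norm (A *v x))\<^sup>2 \<le> (norm A * norm x)\<^sup>2" .
qed simp

lemma norm_transpose: "norm (transpose A) = norm A" for A :: "real^'n^'m"
proof -
  have "transpose A \<bullet> transpose A = A \<bullet> A"
    unfolding inner_vec_def transpose_def by (simp add: inner_vec_def) (rule sum.swap)
  then show ?thesis by (simp add: norm_eq_sqrt_inner)
qed

lemma norm_matrix_mult_le:
  fixes X :: "real^'n^'m" and Y :: "real^'k^'n"
  shows "norm (X ** Y) \<le> norm X * norm Y"
proof (rule power2_le_imp_le)
  have "(transpose (X ** Y)) $ j = X *v (transpose Y $ j)" for j
    by (simp add: transpose_def matrix_matrix_mult_def matrix_vector_mult_def vec_eq_iff)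
  then have "(norm (X ** Y))\<^sup>2 = (\<Sum>j\<in>UNIV. (norm (X *v (transpose Y $ j)))\<^sup>2)"
    by (simp add: norm_transpose[of "X ** Y", symmetric] power2_norm_eq_inner inner_vec_def[of "transpose (X ** Y)"])
  also have "\<dots> \<le> (\<Sum>j\<in>UNIV. (norm X * norm (transpose Y $ j))\<^sup>2)"
    by (intro sum_mono power_mono norm_matrix_vector_mult_le norm_ge_zero)
  also have "\<dots> = (norm X * norm Y)\<^sup>2"
    unfolding norm_transpose[of Y, symmetric]
    by (simp add: power_mult_distrib power2_norm_eq_inner inner_vec_def[of "transpose Y"] sum_distrib_left)
  finally show "(norm (X ** Y))\<^sup>2 \<le> (norm X * norm Y)\<^sup>2" .
qed simp

lemma norm_outer: "norm (outer x) = (norm x)\<^sup>2"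
proof -
  have "outer x \<bullet> outer x = (x \<bullet> x)\<^sup>2"
    by (simp add: inner_outer outer_mult_vec power2_eq_square)
  then show ?thesis by (simp add: norm_eq_sqrt_inner power2_eq_square)
qed

lemma pair_std_gauss_bilinear:
  fixes X Y :: "real^'n^'k" and T T' :: "real^'m^'k"
  shows "integrable (std_gauss \<Otimes>\<^sub>M std_gauss) (\<lambda>(g, u). (X *v g - T *v u) \<bullet> (Y *v g - T' *v u))" (is "integrable _ ?f")
    and "(\<integral>(g, u). (X *v g - T *v u) \<bullet> (Y *v g - T' *v u) \<partial>(std_gauss \<Otimes>\<^sub>M std_gauss)) = X \<bullet> Y + T \<bullet> T'"
proof -
  interpret A: prob_space "std_gauss :: (real^'n) measure" by (rule prob_space_std_gauss)
  interpret B: prob_space "std_gauss :: (real^'m) measure" by (rule prob_space_std_gauss)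
  interpret pair_prob_space "std_gauss :: (real^'n) measure" "std_gauss :: (real^'m) measure" ..
  have p1: "A.prob UNIV = 1" "B.prob UNIV = 1" using A.prob_space B.prob_space by auto
  have le: "t \<le> 4 * exp (1 / 4 * t)" for t :: real
    using exp_ge_add_one_self[of "1 / 4 * t"] by (auto simp del: exp_ge_add_one_self)
  define C where "C = (norm X + norm T) * (norm Y + norm T')"
  have C: "0 \<le> C" by (simp add: C_def)
  show int: "integrable (std_gauss \<Otimes>\<^sub>M std_gauss) ?f"
  proof (rule integrable_pair_std_gauss_bound[where c = "1/4" and C = "8 * C"])
    show "?f \<in> borel_measurable (std_gauss \<Otimes>\<^sub>M std_gauss)" unfolding split_beta' by measurable
    fix g :: "real^'n" and u :: "real^'m"
    define m where "m = max (norm g) (norm u)"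
    have m: "norm g \<le> m" "norm u \<le> m" by (auto simp: m_def)
    have nb: "norm (X' *v g - T'' *v u) \<le> (norm X' + norm T'') * m" for X' :: "real^'n^'k" and T'' :: "real^'m^'k"
    proof -
      have "norm (X' *v g - T'' *v u) \<le> norm (X' *v g) + norm (T'' *v u)" by (rule norm_triangle_ineq4)
      also have "\<dots> \<le> norm X' * norm g + norm T'' * norm u" by (intro add_mono norm_matrix_vector_mult_le)
      also have "\<dots> \<le> norm X' * m + norm T'' * m" using m by (intro add_mono mult_left_mono) auto
      finally show ?thesis by (simp add: distrib_right)
    qed
    have m2: "m\<^sup>2 \<le> (norm g)\<^sup>2 + (norm u)\<^sup>2" unfolding m_def max_def by simp
    have "\<bar>(X *v g - T *v u) \<bullet> (Y *v g - T' *v u)\<bar> \<le> norm (X *v g - T *v u) * norm (Y *v g - T' *v u)"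
      by (rule Cauchy_Schwarz_ineq2)
    also have "\<dots> \<le> ((norm X + norm T) * m) * ((norm Y + norm T') * m)"
      using order_trans[OF norm_ge_zero m(1)] by (intro mult_mono nb) auto
    also have "\<dots> = C * m\<^sup>2" by (simp add: C_def power2_eq_square mult_ac)
    also have "\<dots> \<le> C * (8 * exp (1 / 4 * ((norm g)\<^sup>2 + (norm u)\<^sup>2)))"
    proof (rule mult_left_mono[OF _ C])
      have "m\<^sup>2 \<le> 4 * exp (1 / 4 * ((norm g)\<^sup>2 + (norm u)\<^sup>2))" using m2 le by (rule order_trans)
      also have "\<dots> \<le> 8 * exp (1 / 4 * ((norm g)\<^sup>2 + (norm u)\<^sup>2))" by simp
      finally show "m\<^sup>2 \<le> 8 * exp (1 / 4 * ((norm g)\<^sup>2 + (norm u)\<^sup>2))" .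
    qed
    finally show "\<bar>?f (g, u)\<bar> \<le> 8 * C * exp (1 / 4 * ((norm g)\<^sup>2 + (norm u)\<^sup>2))" by (simp add: mult_ac)
  qed simp
  have inner: "(\<integral>u. (X *v g - T *v u) \<bullet> (Y *v g - T' *v u) \<partial>std_gauss) = (X *v g) \<bullet> (Y *v g) + T \<bullet> T'" for g
  proof -
    define p where "p = - (transpose T *v (Y *v g)) - transpose T' *v (X *v g)"
    have eq: "(X *v g - T *v u) \<bullet> (Y *v g - T' *v u) = ((X *v g) \<bullet> (Y *v g) + p \<bullet> u) + (T *v u) \<bullet> (T' *v u)" for u
      unfolding p_def by (simp add: inner_diff_left inner_diff_right inner_matrix_transpose[symmetric] inner_commute[of "T *v u"]
          del: transpose_matrix_vector)
    show ?thesis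
      unfolding eq Bochner_Integration.integral_add[OF std_gauss_linear_moments(1) std_gauss_frobenius(1)]
        std_gauss_linear_moments(2) std_gauss_frobenius(2) ..
  qed
  have "(\<integral>(g, u). (X *v g - T *v u) \<bullet> (Y *v g - T' *v u) \<partial>(std_gauss \<Otimes>\<^sub>M std_gauss))
      = (\<integral>g. (\<integral>u. (X *v g - T *v u) \<bullet> (Y *v g - T' *v u) \<partial>std_gauss) \<partial>std_gauss)"
    using integral_fst'[OF int] by simp
  also have "\<dots> = X \<bullet> Y + T \<bullet> T'"
    unfolding inner using std_gauss_frobenius[of X Y] by (simp add: p1)
  finally show "(\<integral>(g, u). (X *v g - T *v u) \<bullet> (Y *v g - T' *v u) \<partial>(std_gauss \<Otimes>\<^sub>M std_gauss)) = X \<bullet> Y + T \<bullet> T'" .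
qed

lemma inner_query_key:
  fixes B :: "real^'d^'e"
  assumes S: "psd_mat S"
  shows "x \<bullet> (B *v (msqrt S *v g)) = (msqrt S *v (transpose B *v x)) \<bullet> g"
proof -
  have tR: "transpose (msqrt S) = msqrt S" using msqrt_psd[OF S] by (auto simp: psd_mat_def)
  show ?thesis unfolding inner_matrix_transpose[of x B] inner_matrix_transpose[of _ "msqrt S"] tR ..
qed

lemma msqrt_mult_vec: "psd_mat S \<Longrightarrow> msqrt S *v (msqrt S *v x) = S *v x"
  by (simp add: matrix_vector_mul_assoc msqrt_psd)

lemma integral_exp_sample_dist:
  fixes M :: "real^'d^'p"
  assumes S: "psd_mat S" and [measurable]: "f \<in> borel_measurable borel"
  shows "(\<integral>a. exp (x \<bullet> (B *v fst a)) * f (fst a) \<partial>sample_dist M S T)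
    = exp ((norm (msqrt S *v (transpose B *v x)))\<^sup>2 / 2)
      * (\<integral>g. f (msqrt S *v g + S *v (transpose B *v x)) \<partial>std_gauss)"
proof -
  let ?u = "msqrt S *v (transpose B *v x)"
  have "(\<integral>a. exp (x \<bullet> (B *v fst a)) * f (fst a) \<partial>sample_dist M S T)
      = (\<integral>g. exp (x \<bullet> (B *v (msqrt S *v g))) * f (msqrt S *v g) \<partial>std_gauss)"
    by (rule integral_sample_dist_fst) measurable
  also have "\<dots> = (\<integral>g. exp (?u \<bullet> g) * f (msqrt S *v g) \<partial>std_gauss)"
    unfolding inner_query_key[OF S] ..
  also have "\<dots> = exp ((norm ?u)\<^sup>2 / 2) * (\<integral>g. f (msqrt S *v (g + ?u)) \<partial>std_gauss)"
    by (rule std_gauss_tilt) measurable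
  finally show ?thesis unfolding matrix_vector_right_distrib msqrt_mult_vec[OF S] .
qed

lemma pop_attn_eq:
  fixes S :: "real^'d^'d"
  assumes S: "psd_mat S"
  shows "pop_attn S B x = S *v (transpose B *v x)"
proof -
  interpret prob_space "std_gauss :: (real^'d) measure" by (rule prob_space_std_gauss)
  have p1: "prob UNIV = 1" using prob_space by simp
  let ?R = "msqrt S"
  let ?u = "?R *v (transpose B *v x)"
  let ?Z = "exp ((norm ?u)\<^sup>2 / 2)"
  have Z: "(\<integral>x2. exp (x \<bullet> (B *v x2)) \<partial>gauss S) = ?Z"
    using std_gauss_tilt[of "\<lambda>_. 1" ?u]
    by (simp add: integral_gauss inner_query_key[OF S] p1 del: transpose_matrix_vector)
  have V: "(\<integral>x2. exp (x \<bullet> (B *v x2)) *\<^sub>R x2 \<partial>gauss S) = (\<integral>g. exp (?u \<bullet> g) *\<^sub>R (?R *v g) \<partial>std_gauss)"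
    by (simp add: integral_gauss inner_query_key[OF S] del: transpose_matrix_vector)
  have int: "integrable std_gauss (\<lambda>g. exp (?u \<bullet> g) *\<^sub>R (?R *v g))"
  proof (rule std_gauss_integrable_bound[where c = "1/4" and C = "8 * norm ?R * exp (2 * (norm ?u)\<^sup>2)"])
    fix g :: "real^'d"
    have "?u \<bullet> g \<le> norm ?u * norm g" by (rule norm_cauchy_schwarz)
    also have "\<dots> \<le> 2 * (norm ?u)\<^sup>2 + (norm g)\<^sup>2 / 8"
    proof -
      have "0 \<le> (4 * norm ?u - norm g)\<^sup>2" by simp
      then show ?thesis by (simp add: power2_eq_square algebra_simps)
    qed
    finally have 1: "exp (?u \<bullet> g) \<le> exp (2 * (norm ?u)\<^sup>2) * exp ((norm g)\<^sup>2 / 8)"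
      unfolding exp_add[symmetric] exp_le_cancel_iff .
    have "2 * norm g \<le> 1 + (norm g)\<^sup>2" using sum_squares_bound[of 1 "norm g"] by simp
    moreover have "1 + (norm g)\<^sup>2 / 8 \<le> exp ((norm g)\<^sup>2 / 8)" by (rule exp_ge_add_one_self)
    ultimately have 2: "norm g \<le> 8 * exp ((norm g)\<^sup>2 / 8)" using norm_ge_zero[of g] by linarith
    have "norm (exp (?u \<bullet> g) *\<^sub>R (?R *v g)) = exp (?u \<bullet> g) * norm (?R *v g)" by simp
    also have "\<dots> \<le> (exp (2 * (norm ?u)\<^sup>2) * exp ((norm g)\<^sup>2 / 8)) * (norm ?R * (8 * exp ((norm g)\<^sup>2 / 8)))"
      using 2 by (intro mult_mono 1 order_trans[OF norm_matrix_vector_mult_le] mult_left_mono) auto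
    also have "\<dots> = 8 * norm ?R * exp (2 * (norm ?u)\<^sup>2) * (exp ((norm g)\<^sup>2 / 8) * exp ((norm g)\<^sup>2 / 8))"
      by (simp only: mult_ac)
    also have "exp ((norm g)\<^sup>2 / 8) * exp ((norm g)\<^sup>2 / 8) = exp (1 / 4 * (norm g)\<^sup>2)"
      unfolding exp_add[symmetric] by simp
    finally show "norm (exp (?u \<bullet> g) *\<^sub>R (?R *v g))
        \<le> 8 * norm ?R * exp (2 * (norm ?u)\<^sup>2) * exp (1 / 4 * (norm g)\<^sup>2)" .
  next
    show "(\<lambda>g. exp (?u \<bullet> g) *\<^sub>R (?R *v g)) \<in> borel_measurable borel" by measurable
  qed simp
  have "(\<integral>g. exp (?u \<bullet> g) *\<^sub>R (?R *v g) \<partial>std_gauss) \<bullet> v = (?Z *\<^sub>R (?R *v ?u)) \<bullet> v" for v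
  proof -
    have tR: "transpose ?R = ?R" using msqrt_psd[OF S] by (auto simp: psd_mat_def)
    have "(\<integral>g. exp (?u \<bullet> g) *\<^sub>R (?R *v g) \<partial>std_gauss) \<bullet> v = (\<integral>g. exp (?u \<bullet> g) * ((?R *v g) \<bullet> v) \<partial>std_gauss)"
      using integral_inner_left[of v std_gauss, OF int] by (simp del: transpose_matrix_vector)
    also have "\<dots> = ?Z * (\<integral>g. (?R *v (g + ?u)) \<bullet> v \<partial>std_gauss)"
      by (rule std_gauss_tilt) measurable
    also have "(\<lambda>g. (?R *v (g + ?u)) \<bullet> v) = (\<lambda>g. (?R *v ?u) \<bullet> v + (?R *v v) \<bullet> g)"
    proof (rule ext)
      fix g
      have "(?R *v g) \<bullet> v = (?R *v v) \<bullet> g"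
        using inner_symmetric_matrix[OF tR, of v g] by (simp only: inner_commute[of "?R *v g" v])
      then show "(?R *v (g + ?u)) \<bullet> v = (?R *v ?u) \<bullet> v + (?R *v v) \<bullet> g"
        by (simp only: matrix_vector_right_distrib inner_add_left)
    qed
    finally show ?thesis unfolding std_gauss_linear_moments(2) by simp
  qed
  then have "(\<integral>g. exp (?u \<bullet> g) *\<^sub>R (?R *v g) \<partial>std_gauss) = ?Z *\<^sub>R (?R *v ?u)"
    by (rule vector_eq_rdot[THEN iffD1, OF allI])
  then show ?thesis unfolding pop_attn_def Z V by (simp add: msqrt_mult_vec[OF S] del: transpose_matrix_vector)
qed

lemma pop_loss_eq:
  fixes M :: "real^'d^'p"
  assumes S: "psd_mat S"
  shows "pop_loss M S T \<theta> = 1 / 2 * (((fst \<theta> ** S ** transpose (snd \<theta>) - M) ** msqrt S) \<bullet> ((fst \<theta> ** S ** transpose (snd \<theta>) - M) ** msqrt S)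
    + msqrt T \<bullet> msqrt T)"
proof -
  let ?X = "(fst \<theta> ** S ** transpose (snd \<theta>) - M) ** msqrt S"
  have "(\<integral>xz. (norm (fst \<theta> *v pop_attn S (snd \<theta>) (fst xz) - (M *v fst xz + snd xz)))\<^sup>2 \<partial>(gauss S \<Otimes>\<^sub>M gauss T))
      = (\<integral>(g, u). (?X *v g - msqrt T *v u) \<bullet> (?X *v g - msqrt T *v u) \<partial>(std_gauss \<Otimes>\<^sub>M std_gauss))"
    unfolding pair_gauss_eq pop_attn_eq[OF S]
    by (subst integral_distr)
      (measurable, simp add: split_beta' power2_norm_eq_inner matrix_vector_mul_assoc matrix_vector_mult_diff_rdistrib
        bounded_bilinear.diff_left[OF bounded_bilinear_matrix_mult] matrix_mul_assoc diff_diff_eq del: transpose_matrix_vector)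
  then show ?thesis unfolding pop_loss_def pair_std_gauss_bilinear(2) by simp
qed

lemma pop_loss_has_derivative:
  fixes M :: "real^'d^'p"
  assumes S: "psd_mat S"
  shows "(pop_loss M S T has_derivative (\<lambda>\<delta>. ((fst \<theta> ** S ** transpose (snd \<theta>) - M) ** msqrt S)
     \<bullet> ((fst \<delta> ** S ** transpose (snd \<theta>) + fst \<theta> ** S ** transpose (snd \<delta>)) ** msqrt S))) (at \<theta>)"
proof -
  note mm = bounded_bilinear_matrix_mult
  let ?X = "\<lambda>\<theta>. (fst \<theta> ** S ** transpose (snd \<theta>) - M) ** msqrt S"
  let ?X' = "\<lambda>\<delta>. (fst \<theta> ** S ** transpose (snd \<delta>) + fst \<delta> ** S ** transpose (snd \<theta>) - 0) ** msqrt S"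
  have dX: "(?X has_derivative ?X') (at \<theta>)"
    by (intro bounded_linear.has_derivative[OF bounded_bilinear.bounded_linear_left[OF mm]] has_derivative_diff
        bounded_bilinear.FDERIV[OF mm] has_derivative_const
        bounded_linear_imp_has_derivative[OF bounded_linear_fst]
        bounded_linear.has_derivative[OF bounded_linear_transpose bounded_linear_imp_has_derivative[OF bounded_linear_snd]])
  have "((\<lambda>\<theta>. 1 / 2 * (?X \<theta> \<bullet> ?X \<theta> + msqrt T \<bullet> msqrt T)) has_derivative
      (\<lambda>\<delta>. 1 / 2 * ((?X \<theta> \<bullet> ?X' \<delta> + ?X' \<delta> \<bullet> ?X \<theta>) + 0))) (at \<theta>)"
    by (intro has_derivative_mult_right has_derivative_add has_derivative_inner dX has_derivative_const)
  moreover have "(\<lambda>\<theta>. 1 / 2 * (?X \<theta> \<bullet> ?X \<theta> + msqrt T \<bullet> msqrt T)) = pop_loss M S T"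
    by (rule ext) (rule pop_loss_eq[OF S, symmetric])
  moreover have "1 / 2 * ((?X \<theta> \<bullet> ?X' \<delta> + ?X' \<delta> \<bullet> ?X \<theta>) + 0)
      = ?X \<theta> \<bullet> ((fst \<delta> ** S ** transpose (snd \<theta>) + fst \<theta> ** S ** transpose (snd \<delta>)) ** msqrt S)" for \<delta>
    unfolding inner_commute[of "?X' \<delta>"] diff_zero add.commute[of "fst \<theta> ** S ** transpose (snd \<delta>)"]
    by (simp add: inner_commute)
  ultimately show ?thesis by (simp only:)
qed

section \<open>Bias of weighted statistics\<close>

lemma inverse_sum_power_le:
  fixes v :: "'i \<Rightarrow> real"
  assumes "finite S" "S \<noteq> {}" and pos: "\<And>t. t \<in> S \<Longrightarrow> 0 < v t"
  shows "1 / (\<Sum>t\<in>S. v t) ^ p \<le> (\<Sum>t\<in>S. 1 / v t ^ p) / real (card S) ^ Suc p"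
proof -
  define c where "c = real (card S)"
  define W where "W = (\<Sum>t\<in>S. v t)"
  have c: "c > 0" unfolding c_def using assms(1,2) by (simp add: card_gt_0_iff)
  have W: "W > 0" unfolding W_def using assms by (intro sum_pos) auto
  have B: "1 + real p * (1 - c * v t / W) \<le> (W / (c * v t)) ^ p" if t: "t \<in> S" for t
  proof -
    define r where "r = c * v t / W"
    have r: "r > 0" using c W pos[OF t] by (simp add: r_def)
    have "1 + real p * (1 / r - 1) \<le> (1 + (1 / r - 1)) ^ p"
      using r by (intro Bernoulli_inequality) simp
    moreover have "1 - r \<le> 1 / r - 1"
    proof -
      have "0 \<le> (r - 1)\<^sup>2" by simp
      then show ?thesis using r by (simp add: field_simps power2_eq_square)
    qed
    then have "real p * (1 - r) \<le> real p * (1 / r - 1)" by (intro mult_left_mono) auto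
    ultimately show ?thesis by (simp add: r_def)
  qed
  have "c = (\<Sum>t\<in>S. 1 + real p * (1 - c * v t / W))"
    using W by (simp add: sum.distrib sum_subtractf sum_divide_distrib[symmetric]
        sum_distrib_left[symmetric] c_def W_def[symmetric])
  also have "\<dots> \<le> (\<Sum>t\<in>S. (W / (c * v t)) ^ p)"
    by (intro sum_mono B)
  also have "\<dots> = W ^ p / c ^ p * (\<Sum>t\<in>S. 1 / v t ^ p)"
    by (simp add: sum_distrib_left power_divide power_mult_distrib)
  finally have "c \<le> W ^ p / c ^ p * (\<Sum>t\<in>S. 1 / v t ^ p)" .
  then show ?thesis
    unfolding W_def[symmetric] c_def[symmetric] using c W by (simp add: field_simps)
qed

lemma inverse_cube_diff_le:
  fixes V W :: real
  assumes "0 < V" "V \<le> W"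
  shows "\<bar>1 / W ^ 3 - 1 / V ^ 3\<bar> \<le> 3 * (W - V) / V ^ 4"
proof -
  have W: "W > 0" using assms by simp
  have "1 + real 3 * (V / W - 1) \<le> (1 + (V / W - 1)) ^ 3"
    using assms W by (intro Bernoulli_inequality) simp
  then have "1 - (V / W) ^ 3 \<le> 3 * (W - V) / W" using W by (simp add: field_simps)
  also have "\<dots> \<le> 3 * (W - V) / V" using assms by (intro divide_left_mono) auto
  finally have "(1 - (V / W) ^ 3) / V ^ 3 \<le> 3 * (W - V) / V / V ^ 3"
    using assms by (intro divide_right_mono) auto
  then have "1 / V ^ 3 - 1 / W ^ 3 \<le> 3 * (W - V) / V ^ 4"
    using assms W by (simp add: diff_divide_distrib power_divide eval_nat_numeral)
  moreover have "1 / W ^ 3 \<le> 1 / V ^ 3"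
    using assms by (intro divide_left_mono power_mono) auto
  ultimately show ?thesis by simp
qed

locale weighted_statistic = prob_space N for N :: "'s measure" +
  fixes w :: "'s \<Rightarrow> 's \<Rightarrow> real" and \<phi> :: "'s \<Rightarrow> real"
    and H :: "'s \<Rightarrow> 's \<Rightarrow> 's \<Rightarrow> 's \<Rightarrow> real" and K :: real
  assumes space_N: "space N = UNIV"
    and measurable_w: "(\<lambda>(s, a). w s a) \<in> borel_measurable (N \<Otimes>\<^sub>M N)"
    and measurable_\<phi> [measurable]: "\<phi> \<in> borel_measurable N"
    and measurable_H: "(\<lambda>(s, a, b, c). H s a b c) \<in> borel_measurable (N \<Otimes>\<^sub>M N \<Otimes>\<^sub>M N \<Otimes>\<^sub>M N)"
    and \<phi>_ge1: "1 \<le> \<phi> s"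
    and w_pos: "0 < w s a"
    and w_le: "w s a \<le> \<phi> s ^ 4 * \<phi> a ^ 4"
    and w_inverse_le: "1 / w s a \<le> \<phi> s ^ 4 * \<phi> a ^ 4"
    and H_le: "\<bar>H s a b c\<bar> \<le> K * \<phi> s * \<phi> a * \<phi> b * \<phi> c"
    and \<phi>_moment: "integrable N (\<lambda>s. \<phi> s ^ 63)"
    and mean_w_ge1: "1 \<le> (\<integral>a. w s a \<partial>N)"
begin

definition L :: real where "L = (\<integral>s. \<phi> s ^ 63 \<partial>N)"

definition mean_w :: "'s \<Rightarrow> real" where "mean_w s = (\<integral>a. w s a \<partial>N)"

definition H1 :: "'s \<Rightarrow> 's \<Rightarrow> 's \<Rightarrow> real" where
  "H1 s b c = (\<integral>a. w s a / mean_w s * H s a b c \<partial>N)"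

definition H2 :: "'s \<Rightarrow> 's \<Rightarrow> real" where
  "H2 s c = (\<integral>b. w s b / mean_w s * H1 s b c \<partial>N)"

definition H3 :: "'s \<Rightarrow> real" where
  "H3 s = (\<integral>c. w s c / mean_w s * H2 s c \<partial>N)"

definition statistic :: "nat \<Rightarrow> (nat \<Rightarrow> 's) \<Rightarrow> real" where
  "statistic n x = (1 / real n) * (\<Sum>i<n. \<Sum>j<n. \<Sum>k<n. \<Sum>l<n.
     w (x i) (x j) * w (x i) (x k) * w (x i) (x l) / (\<Sum>t<n. w (x i) (x t)) ^ 3
       * H (x i) (x j) (x k) (x l))"

lemma measurable_w_comp [measurable (raw)]:
  assumes [measurable]: "f \<in> measurable M N" "g \<in> measurable M N"
  shows "(\<lambda>x. w (f x) (g x)) \<in> borel_measurable M"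
proof -
  have "(\<lambda>x. (\<lambda>(s, a). w s a) (f x, g x)) \<in> borel_measurable M"
    by (rule measurable_compose[OF _ measurable_w]) measurable
  then show ?thesis by simp
qed

lemma measurable_H_comp [measurable (raw)]:
  assumes [measurable]: "f \<in> measurable M N" "g \<in> measurable M N" "h \<in> measurable M N" "k \<in> measurable M N"
  shows "(\<lambda>x. H (f x) (g x) (h x) (k x)) \<in> borel_measurable M"
proof -
  have "(\<lambda>x. (\<lambda>(s, a, b, c). H s a b c) (f x, g x, h x, k x)) \<in> borel_measurable M"
    by (rule measurable_compose[OF _ measurable_H]) measurable
  then show ?thesis by simp
qed

lemma measurable_mean_w [measurable]: "mean_w \<in> borel_measurable N"
  unfolding mean_w_def[abs_def] by measurable

lemma measurable_H1_comp [measurable (raw)]: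
  assumes [measurable]: "f \<in> measurable M N" "g \<in> measurable M N" "h \<in> measurable M N"
  shows "(\<lambda>x. H1 (f x) (g x) (h x)) \<in> borel_measurable M"
  unfolding H1_def by measurable

lemma measurable_H2_comp [measurable (raw)]:
  assumes [measurable]: "f \<in> measurable M N" "g \<in> measurable M N"
  shows "(\<lambda>x. H2 (f x) (g x)) \<in> borel_measurable M"
  unfolding H2_def by measurable

lemma measurable_H3 [measurable]: "H3 \<in> borel_measurable N"
  unfolding H3_def[abs_def] by measurable

lemma K_nonneg: "0 \<le> K"
proof -
  fix s
  have "0 \<le> K * (\<phi> s * \<phi> s * \<phi> s * \<phi> s)" using H_le[of s s s s] by (simp add: mult.assoc)
  moreover have "0 < \<phi> s * \<phi> s * \<phi> s * \<phi> s" using \<phi>_ge1[of s] by simp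
  ultimately show ?thesis by (simp add: zero_le_mult_iff)
qed

lemma \<phi>_pos: "0 < \<phi> s" using \<phi>_ge1[of s] by simp

lemma \<phi>_power_mono: "p \<le> q \<Longrightarrow> \<phi> s ^ p \<le> \<phi> s ^ q"
  by (simp add: \<phi>_ge1 power_increasing)

lemma \<phi>_power_ge1: "1 \<le> \<phi> s ^ p"
  by (simp add: \<phi>_ge1)

lemma integrable_\<phi>_power: "p \<le> 63 \<Longrightarrow> integrable N (\<lambda>s. \<phi> s ^ p)"
  by (rule Bochner_Integration.integrable_bound[OF \<phi>_moment])
    (use \<phi>_pos in \<open>auto intro!: AE_I2 \<phi>_power_mono simp: abs_of_pos\<close>)

lemma integral_\<phi>_power_le: "p \<le> 63 \<Longrightarrow> (\<integral>s. \<phi> s ^ p \<partial>N) \<le> L"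
  unfolding L_def by (intro integral_mono integrable_\<phi>_power \<phi>_moment \<phi>_power_mono)

lemma L_ge1: "1 \<le> L"
  using integral_\<phi>_power_le[of 0] by (simp add: prob_space)

lemma mean_w_pos: "0 < mean_w s"
  using mean_w_ge1[of s] by (simp add: mean_w_def)

lemma normalized_w_le: "w s a / mean_w s \<le> \<phi> s ^ 4 * \<phi> a ^ 4"
proof -
  have "w s a / mean_w s \<le> w s a / 1"
    using mean_w_ge1[of s] w_pos[of s a] by (intro divide_left_mono) (auto simp: mean_w_def)
  then show ?thesis using w_le[of s a] by simp
qed

lemma weighted_mean_bound:
  assumes [measurable]: "f \<in> borel_measurable N" and f: "\<And>a. \<bar>f a\<bar> \<le> C * \<phi> a"
  shows "integrable N (\<lambda>a. w s a / mean_w s * f a)"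
    and "\<bar>\<integral>a. w s a / mean_w s * f a \<partial>N\<bar> \<le> C * \<phi> s ^ 4 * L"
proof -
  have sp: "s \<in> space N" by (simp add: space_N)
  have bd: "\<bar>w s a / mean_w s * f a\<bar> \<le> C * \<phi> s ^ 4 * \<phi> a ^ 5" for a
  proof -
    have "\<bar>w s a / mean_w s * f a\<bar> = w s a / mean_w s * \<bar>f a\<bar>"
      using w_pos mean_w_pos by (simp add: abs_mult abs_of_pos)
    also have "\<dots> \<le> \<phi> s ^ 4 * \<phi> a ^ 4 * (C * \<phi> a)"
      using \<phi>_pos[of a] \<phi>_pos[of s] by (intro mult_mono normalized_w_le f) auto
    finally show ?thesis by (simp add: eval_nat_numeral mult_ac)
  qed
  have C: "0 \<le> C"
    using f[of s] \<phi>_pos[of s] by (metis abs_ge_zero order_trans zero_le_mult_iff not_le)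
  have i: "integrable N (\<lambda>a. C * \<phi> s ^ 4 * \<phi> a ^ 5)"
    by (intro integrable_mult_right integrable_\<phi>_power) simp
  show int: "integrable N (\<lambda>a. w s a / mean_w s * f a)"
    by (rule Bochner_Integration.integrable_bound[OF i]) (use sp in \<open>auto intro!: AE_I2 order_trans[OF bd[simplified]]\<close>)
  have "\<bar>\<integral>a. w s a / mean_w s * f a \<partial>N\<bar> \<le> (\<integral>a. \<bar>w s a / mean_w s * f a\<bar> \<partial>N)"
    by (rule integral_abs_bound)
  also have "\<dots> \<le> (\<integral>a. C * \<phi> s ^ 4 * \<phi> a ^ 5 \<partial>N)"
    by (intro integral_mono integrable_abs int i bd)
  also have "\<dots> = C * \<phi> s ^ 4 * (\<integral>a. \<phi> a ^ 5 \<partial>N)" by simp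
  also have "\<dots> \<le> C * \<phi> s ^ 4 * L"
    using C \<phi>_pos[of s] by (intro mult_left_mono integral_\<phi>_power_le) auto
  finally show "\<bar>\<integral>a. w s a / mean_w s * f a \<partial>N\<bar> \<le> C * \<phi> s ^ 4 * L" .
qed

lemma measurable_fixed_args [measurable]:
  "(\<lambda>a. H s a b c) \<in> borel_measurable N"
  "(\<lambda>a. H1 s a b) \<in> borel_measurable N"
  "(\<lambda>a. H2 s a) \<in> borel_measurable N"
  "(\<lambda>a. w s a) \<in> borel_measurable N"
     apply (rule measurable_H_comp; simp add: space_N)
    apply (rule measurable_H1_comp; simp add: space_N)
   apply (rule measurable_H2_comp; simp add: space_N)
  apply (rule measurable_w_comp; simp add: space_N)
  done

lemma H1_le: "\<bar>H1 s b c\<bar> \<le> K * L * \<phi> s ^ 5 * \<phi> b * \<phi> c"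
proof -
  have "\<bar>H1 s b c\<bar> \<le> (K * \<phi> s * \<phi> b * \<phi> c) * \<phi> s ^ 4 * L"
    unfolding H1_def using H_le[of s _ b c]
    by (intro weighted_mean_bound) (auto simp: mult_ac)
  then show ?thesis by (simp add: eval_nat_numeral mult_ac)
qed

lemma H2_le: "\<bar>H2 s c\<bar> \<le> K * L ^ 2 * \<phi> s ^ 9 * \<phi> c"
proof -
  have "\<bar>H2 s c\<bar> \<le> (K * L * \<phi> s ^ 5 * \<phi> c) * \<phi> s ^ 4 * L"
    unfolding H2_def using H1_le[of s _ c]
    by (intro weighted_mean_bound) (auto simp: mult_ac)
  then show ?thesis by (simp add: eval_nat_numeral mult_ac)
qed

lemma H3_le: "\<bar>H3 s\<bar> \<le> K * L ^ 3 * \<phi> s ^ 13"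
proof -
  have "\<bar>H3 s\<bar> \<le> (K * L ^ 2 * \<phi> s ^ 9) * \<phi> s ^ 4 * L"
    unfolding H3_def using H2_le[of s]
    by (intro weighted_mean_bound) (auto simp: mult_ac)
  then show ?thesis by (simp add: eval_nat_numeral mult_ac)
qed

lemma common_bound:
  assumes v: "\<bar>v\<bar> \<le> K * L ^ e * \<phi> s ^ p * \<phi> a ^ q1 * \<phi> b ^ q2 * \<phi> c ^ q3"
    and le: "e \<le> 3" "p \<le> 13" "q1 \<le> 1" "q2 \<le> 1" "q3 \<le> 1"
  shows "\<bar>v\<bar> \<le> K * L ^ 3 * \<phi> s ^ 13 * \<phi> a * \<phi> b * \<phi> c"
proof -
  have nn: "0 \<le> \<phi> t ^ d" for t d using \<phi>_pos[of t] by simp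
  have step: "X * \<phi> t ^ d \<le> Y * \<phi> t ^ d'" if "0 \<le> X" "X \<le> Y" "d \<le> d'" for X Y t d d'
    using that nn[of t d] \<phi>_power_mono[of d d' t] by (intro mult_mono) auto
  have 0: "0 \<le> K * L ^ e" using K_nonneg L_ge1 by simp
  have 1: "K * L ^ e \<le> K * L ^ 3"
    using K_nonneg L_ge1 le by (intro mult_left_mono power_increasing) auto
  note 2 = step[OF 0 1 le(2), of s]
  note 3 = step[OF mult_nonneg_nonneg[OF 0 nn] 2 le(3), of a]
  note 4 = step[OF mult_nonneg_nonneg[OF mult_nonneg_nonneg[OF 0 nn] nn] 3 le(4), of b]
  note 5 = step[OF mult_nonneg_nonneg[OF mult_nonneg_nonneg[OF mult_nonneg_nonneg[OF 0 nn] nn] nn] 4 le(5), of c]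
  show ?thesis using order_trans[OF v 5] by simp
qed

lemma H_bounds:
  "\<bar>H s a b c\<bar> \<le> K * L ^ 3 * \<phi> s ^ 13 * \<phi> a * \<phi> b * \<phi> c"
  "\<bar>H1 s b c\<bar> \<le> K * L ^ 3 * \<phi> s ^ 13 * \<phi> a * \<phi> b * \<phi> c"
  "\<bar>H2 s c\<bar> \<le> K * L ^ 3 * \<phi> s ^ 13 * \<phi> a * \<phi> b * \<phi> c"
  "\<bar>H3 s\<bar> \<le> K * L ^ 3 * \<phi> s ^ 13 * \<phi> a * \<phi> b * \<phi> c"
  using common_bound[of "H s a b c" 0 s 1 a 1 b 1 c 1] common_bound[of "H1 s b c" 1 s 5 a 0 b 1 c 1]
    common_bound[of "H2 s c" 2 s 9 a 0 b 0 c 1] common_bound[of "H3 s" 3 s 13 a 0 b 0 c 0]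
    H_le[of s a b c] H1_le[of s b c] H2_le[of s c] H3_le[of s] by simp_all

lemma centered_H:
  "(\<integral>a. w s a * (H s a b c - H1 s b c) \<partial>N) = 0"
  "(\<integral>b. w s b * (H1 s b c - H2 s c) \<partial>N) = 0"
  "(\<integral>c. w s c * (H2 s c - H3 s) \<partial>N) = 0"
proof -
  have gen: "(\<integral>a. w s a * (f a - (\<integral>a. w s a / mean_w s * f a \<partial>N)) \<partial>N) = 0"
    if [measurable]: "f \<in> borel_measurable N" and f: "\<And>a. \<bar>f a\<bar> \<le> C * \<phi> a" for f C
  proof -
    let ?m = "\<integral>a. w s a / mean_w s * f a \<partial>N"
    have i1: "integrable N (\<lambda>a. w s a / mean_w s * f a)"
      by (rule weighted_mean_bound[OF that])
    have i2: "integrable N (\<lambda>a. w s a / mean_w s * 1)"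
      by (rule weighted_mean_bound[of _ 1]) (use \<phi>_ge1 in auto)
    have "(\<integral>a. w s a * (f a - ?m) \<partial>N)
        = (\<integral>a. mean_w s * (w s a / mean_w s * f a) - ?m * mean_w s * (w s a / mean_w s * 1) \<partial>N)"
      using mean_w_pos[of s] by (intro Bochner_Integration.integral_cong) (auto simp: field_simps)
    also have "\<dots> = mean_w s * ?m - ?m * mean_w s * (\<integral>a. w s a / mean_w s * 1 \<partial>N)"
      by (simp only: Bochner_Integration.integral_diff[OF integrable_mult_right[OF i1]
          integrable_mult_right[OF i2]] integral_mult_right_zero)
    also have "(\<integral>a. w s a / mean_w s * 1 \<partial>N) = 1"
      using mean_w_pos[of s] by (simp add: mean_w_def)
    finally show ?thesis by simp
  qed
  show "(\<integral>a. w s a * (H s a b c - H1 s b c) \<partial>N) = 0"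
    unfolding H1_def using H_le[of s _ b c]
    by (intro gen[of _ "K * \<phi> s * \<phi> b * \<phi> c"]) (auto simp: mult_ac)
  show "(\<integral>b. w s b * (H1 s b c - H2 s c) \<partial>N) = 0"
    unfolding H2_def using H1_le[of s _ c]
    by (intro gen[of _ "K * L * \<phi> s ^ 5 * \<phi> c"]) (auto simp: mult_ac)
  show "(\<integral>c. w s c * (H2 s c - H3 s) \<partial>N) = 0"
    unfolding H3_def using H2_le[of s]
    by (intro gen[of _ "K * L ^ 2 * \<phi> s ^ 9"]) (auto simp: mult_ac)
qed

sublocale product_sigma_finite "\<lambda>_ :: nat. N"
  by standard

lemma \<phi>_prod_moment:
  assumes I: "finite (I :: nat set)" and e: "\<And>t. e t \<le> 63"
  shows "integrable (PiM I (\<lambda>_. N)) (\<lambda>x. \<Prod>t\<in>I. \<phi> (x t) ^ e t)"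
    and "(\<integral>x. (\<Prod>t\<in>I. \<phi> (x t) ^ e t) \<partial>PiM I (\<lambda>_. N)) \<le> L ^ card {t \<in> I. e t \<noteq> 0}"
proof -
  show "integrable (PiM I (\<lambda>_. N)) (\<lambda>x. \<Prod>t\<in>I. \<phi> (x t) ^ e t)"
    by (rule product_integrable_prod[OF I]) (rule integrable_\<phi>_power[OF e])
  have "(\<integral>x. (\<Prod>t\<in>I. \<phi> (x t) ^ e t) \<partial>PiM I (\<lambda>_. N)) = (\<Prod>t\<in>I. \<integral>s. \<phi> s ^ e t \<partial>N)"
    by (rule product_integral_prod[OF I]) (rule integrable_\<phi>_power[OF e])
  also have "\<dots> \<le> (\<Prod>t\<in>I. if e t \<noteq> 0 then L else 1)"
    by (intro prod_mono conjI integral_nonneg_AE AE_I2)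
      (use \<phi>_pos[THEN less_imp_le] in \<open>auto simp: prob_space intro: integral_\<phi>_power_le[OF e]\<close>)
  also have "\<dots> = L ^ card {t \<in> I. e t \<noteq> 0}"
    using I by (simp add: prod.If_cases Int_def)
  finally show "(\<integral>x. (\<Prod>t\<in>I. \<phi> (x t) ^ e t) \<partial>PiM I (\<lambda>_. N)) \<le> L ^ card {t \<in> I. e t \<noteq> 0}" .
qed

lemma \<phi>_five_moment:
  assumes I: "finite (I :: nat set)" "i \<in> I" "j \<in> I" "k \<in> I" "l \<in> I" "m \<in> I"
    and e: "\<And>t. (if t = i then p else 0) + (if t = j then q else 0) + (if t = k then q else 0)
        + (if t = l then q else 0) + (if t = m then r else 0) \<le> (63::nat)"
  shows "integrable (PiM I (\<lambda>_. N)) (\<lambda>x. \<phi> (x i) ^ p * \<phi> (x j) ^ q * \<phi> (x k) ^ q * \<phi> (x l) ^ q * \<phi> (x m) ^ r)"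
    and "(\<integral>x. \<phi> (x i) ^ p * \<phi> (x j) ^ q * \<phi> (x k) ^ q * \<phi> (x l) ^ q * \<phi> (x m) ^ r \<partial>PiM I (\<lambda>_. N)) \<le> L ^ 5"
proof -
  define e where "e = (\<lambda>t. (if t = i then p else 0) + (if t = j then q else 0) + (if t = k then q else 0)
        + (if t = l then q else 0) + (if t = m then r else 0))"
  have e63: "e t \<le> 63" for t unfolding e_def by (rule assms(7))
  have pd: "(\<Prod>t\<in>I. \<phi> (x t) ^ (if t = u then d else 0)) = \<phi> (x u) ^ d" if "u \<in> I" for x :: "nat \<Rightarrow> 's" and u d
  proof -
    have "(\<Prod>t\<in>I. \<phi> (x t) ^ (if t = u then d else 0)) = (\<Prod>t\<in>I. if t = u then \<phi> (x u) ^ d else 1)"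
      by (intro prod.cong) auto
    then show ?thesis using that I(1) by simp
  qed
  have eq: "(\<lambda>x. \<Prod>t\<in>I. \<phi> (x t) ^ e t)
      = (\<lambda>x. \<phi> (x i) ^ p * \<phi> (x j) ^ q * \<phi> (x k) ^ q * \<phi> (x l) ^ q * \<phi> (x m) ^ r)"
    unfolding e_def power_add prod.distrib pd[OF I(2)] pd[OF I(3)] pd[OF I(4)] pd[OF I(5)] pd[OF I(6)] ..
  have e0: "e t = 0" if "t \<noteq> i" "t \<noteq> j" "t \<noteq> k" "t \<noteq> l" "t \<noteq> m" for t
    unfolding e_def by (simp only: that if_False add_0)
  have "{t \<in> I. e t \<noteq> 0} \<subseteq> {i, j, k, l, m}"
  proof
    fix t assume "t \<in> {t \<in> I. e t \<noteq> 0}"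
    then have "e t \<noteq> 0" by simp
    with e0[of t] show "t \<in> {i, j, k, l, m}" by (cases "t = i \<or> t = j \<or> t = k \<or> t = l \<or> t = m") auto
  qed
  then have "card {t \<in> I. e t \<noteq> 0} \<le> card {i, j, k, l, m}" by (intro card_mono) auto
  also have "\<dots> \<le> 5" using card_length[of "[i, j, k, l, m]"] by simp
  finally have le: "L ^ card {t \<in> I. e t \<noteq> 0} \<le> L ^ 5" using L_ge1 by (intro power_increasing)
  note moment = \<phi>_prod_moment[of I e, OF I(1) e63]
  show "integrable (PiM I (\<lambda>_. N)) (\<lambda>x. \<phi> (x i) ^ p * \<phi> (x j) ^ q * \<phi> (x k) ^ q * \<phi> (x l) ^ q * \<phi> (x m) ^ r)"
    using moment(1) unfolding eq .
  show "(\<integral>x. \<phi> (x i) ^ p * \<phi> (x j) ^ q * \<phi> (x k) ^ q * \<phi> (x l) ^ q * \<phi> (x m) ^ r \<partial>PiM I (\<lambda>_. N)) \<le> L ^ 5"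
    using order_trans[OF moment(2) le] unfolding eq .
qed

lemma H_diff_bounds:
  "\<bar>H s a b c - H1 s b c\<bar> \<le> 2 * K * L ^ 3 * \<phi> s ^ 13 * \<phi> a * \<phi> b * \<phi> c"
  "\<bar>H1 s b c - H2 s c\<bar> \<le> 2 * K * L ^ 3 * \<phi> s ^ 13 * \<phi> a * \<phi> b * \<phi> c"
  "\<bar>H2 s c - H3 s\<bar> \<le> 2 * K * L ^ 3 * \<phi> s ^ 13 * \<phi> a * \<phi> b * \<phi> c"
  "\<bar>H s a b c - H3 s\<bar> \<le> 2 * K * L ^ 3 * \<phi> s ^ 13 * \<phi> a * \<phi> b * \<phi> c"
proof -
  have 2: "2 * K * L ^ 3 * \<phi> s ^ 13 * \<phi> a * \<phi> b * \<phi> c = 2 * (K * L ^ 3 * \<phi> s ^ 13 * \<phi> a * \<phi> b * \<phi> c)"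
    by simp
  note b = H_bounds[where s = s and a = a and b = b and c = c]
  show "\<bar>H s a b c - H1 s b c\<bar> \<le> 2 * K * L ^ 3 * \<phi> s ^ 13 * \<phi> a * \<phi> b * \<phi> c"
    using b(1,2) unfolding 2 by linarith
  show "\<bar>H1 s b c - H2 s c\<bar> \<le> 2 * K * L ^ 3 * \<phi> s ^ 13 * \<phi> a * \<phi> b * \<phi> c"
    using b(2,3) unfolding 2 by linarith
  show "\<bar>H2 s c - H3 s\<bar> \<le> 2 * K * L ^ 3 * \<phi> s ^ 13 * \<phi> a * \<phi> b * \<phi> c"
    using b(3,4) unfolding 2 by linarith
  show "\<bar>H s a b c - H3 s\<bar> \<le> 2 * K * L ^ 3 * \<phi> s ^ 13 * \<phi> a * \<phi> b * \<phi> c"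
    using b(1,4) unfolding 2 by linarith
qed

lemma weighted_term_le:
  assumes D: "\<bar>d\<bar> \<le> C * \<phi> s ^ 13 * \<phi> a * \<phi> b * \<phi> c"
  shows "\<bar>w s a * w s b * w s c * d\<bar> \<le> C * (\<phi> s ^ 25 * \<phi> a ^ 5 * \<phi> b ^ 5 * \<phi> c ^ 5)"
proof -
  have "\<bar>w s a * w s b * w s c * d\<bar> = w s a * w s b * w s c * \<bar>d\<bar>"
    using w_pos by (simp add: abs_mult abs_of_pos)
  also have "\<dots> \<le> (\<phi> s ^ 4 * \<phi> a ^ 4) * (\<phi> s ^ 4 * \<phi> b ^ 4) * (\<phi> s ^ 4 * \<phi> c ^ 4)
      * (C * \<phi> s ^ 13 * \<phi> a * \<phi> b * \<phi> c)"
    using w_pos[THEN less_imp_le] \<phi>_pos[THEN less_imp_le] by (intro mult_mono w_le D) auto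
  also have "\<dots> = C * (\<phi> s ^ 25 * \<phi> a ^ 5 * \<phi> b ^ 5 * \<phi> c ^ 5)"
    by (simp add: eval_nat_numeral mult_ac)
  finally show ?thesis .
qed

lemma inverse_weight_sum_le:
  assumes "finite S" "S \<noteq> {}"
  shows "1 / (\<Sum>t\<in>S. w s (x t)) ^ p
    \<le> (\<Sum>t\<in>S. \<phi> s ^ (4 * p) * \<phi> (x t) ^ (4 * p)) / real (card S) ^ Suc p"
proof -
  have "1 / (\<Sum>t\<in>S. w s (x t)) ^ p \<le> (\<Sum>t\<in>S. 1 / w s (x t) ^ p) / real (card S) ^ Suc p"
    by (rule inverse_sum_power_le[OF assms w_pos])
  also have "\<dots> \<le> (\<Sum>t\<in>S. \<phi> s ^ (4 * p) * \<phi> (x t) ^ (4 * p)) / real (card S) ^ Suc p"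
  proof (intro divide_right_mono sum_mono)
    fix t
    have "(1 / w s (x t)) ^ p \<le> (\<phi> s ^ 4 * \<phi> (x t) ^ 4) ^ p"
      using w_pos[of s "x t"] by (intro power_mono w_inverse_le) auto
    then show "1 / w s (x t) ^ p \<le> \<phi> s ^ (4 * p) * \<phi> (x t) ^ (4 * p)"
      by (simp add: power_divide power_mult_distrib power_mult)
  qed auto
  finally show ?thesis .
qed

lemma dominated_integral:
  assumes S: "finite (I :: nat set)" "i \<in> I" "j \<in> I" "k \<in> I" "l \<in> I" "S \<subseteq> I" "S \<noteq> {}"
    and e: "\<And>m t. m \<in> S \<Longrightarrow> (if t = i then p else 0) + (if t = j then q else 0) + (if t = k then q else 0)
        + (if t = l then q else 0) + (if t = m then r else 0) \<le> (63::nat)"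
    and [measurable]: "f \<in> borel_measurable (PiM I (\<lambda>_. N))"
    and C: "0 \<le> C"
    and f: "\<And>x. \<bar>f x\<bar> \<le> C * (\<Sum>m\<in>S. \<phi> (x i) ^ p * \<phi> (x j) ^ q * \<phi> (x k) ^ q * \<phi> (x l) ^ q * \<phi> (x m) ^ r)
        / real (card S) ^ Suc d"
  shows "integrable (PiM I (\<lambda>_. N)) f"
    and "\<bar>\<integral>x. f x \<partial>PiM I (\<lambda>_. N)\<bar> \<le> C * L ^ 5 / real (card S) ^ d"
proof -
  let ?P = "PiM I (\<lambda>_. N)"
  let ?g = "\<lambda>m x. \<phi> (x i) ^ p * \<phi> (x j) ^ q * \<phi> (x k) ^ q * \<phi> (x l) ^ q * \<phi> (x m) ^ r"
  have fS: "finite S" using S finite_subset by blast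
  have c: "0 < real (card S)" using fS S(7) by (simp add: card_gt_0_iff)
  have i: "integrable ?P (?g m)" and v: "integral\<^sup>L ?P (?g m) \<le> L ^ 5" if "m \<in> S" for m
    using \<phi>_five_moment[OF S(1-5) subsetD[OF S(6) that] e[OF that]] by auto
  have dom: "integrable ?P (\<lambda>x. C * (\<Sum>m\<in>S. ?g m x) / real (card S) ^ Suc d)"
    by (intro integrable_divide integrable_mult_right Bochner_Integration.integrable_sum i)
  show int: "integrable ?P f"
    by (rule Bochner_Integration.integrable_bound[OF dom])
      (simp, rule AE_I2, simp only: real_norm_def, rule order_trans[OF f abs_ge_self])
  have "\<bar>\<integral>x. f x \<partial>?P\<bar> \<le> (\<integral>x. \<bar>f x\<bar> \<partial>?P)" by (rule integral_abs_bound)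
  also have "\<dots> \<le> (\<integral>x. C * (\<Sum>m\<in>S. ?g m x) / real (card S) ^ Suc d \<partial>?P)"
    by (intro integral_mono integrable_abs int dom f)
  also have "\<dots> = C * (\<Sum>m\<in>S. integral\<^sup>L ?P (?g m)) / real (card S) ^ Suc d"
    by (simp only: integral_divide_zero integral_mult_right_zero Bochner_Integration.integral_sum[OF i])
  also have "\<dots> \<le> C * (\<Sum>m\<in>S. L ^ 5) / real (card S) ^ Suc d"
    using C by (intro divide_right_mono mult_left_mono sum_mono v) auto
  also have "\<dots> = C * L ^ 5 / real (card S) ^ d"
    using c by (simp add: field_simps)
  finally show "\<bar>\<integral>x. f x \<partial>?P\<bar> \<le> C * L ^ 5 / real (card S) ^ d" .
qed

lemma term_over_partial_sum:
  assumes ijkl: "finite (I :: nat set)" "i \<in> I" "j \<in> I" "k \<in> I" "l \<in> I"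
    and S: "S = I - {i, j, k, l}" "S \<noteq> {}"
    and [measurable]: "f \<in> borel_measurable (PiM I (\<lambda>_. N))"
    and C: "0 \<le> C"
    and f: "\<And>x. \<bar>f x\<bar> \<le> C * (\<phi> (x i) ^ 25 * \<phi> (x j) ^ 5 * \<phi> (x k) ^ 5 * \<phi> (x l) ^ 5) / (\<Sum>t\<in>S. w (x i) (x t)) ^ 3"
  shows "integrable (PiM I (\<lambda>_. N)) f"
    and "\<bar>\<integral>x. f x \<partial>PiM I (\<lambda>_. N)\<bar> \<le> C * L ^ 5 / real (card S) ^ 3"
proof -
  have SI: "S \<subseteq> I" "finite S" using S ijkl(1) by auto
  have e: "(if t = i then 37 else 0) + (if t = j then 5 else 0) + (if t = k then 5 else 0)
        + (if t = l then 5 else 0) + (if t = m then 12 else 0) \<le> (63::nat)" if "m \<in> S" for m t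
  proof (cases "t = m")
    case True
    then have ne: "t \<noteq> i" "t \<noteq> j" "t \<noteq> k" "t \<noteq> l" using that S(1) by auto
    show ?thesis unfolding if_not_P[OF ne(1)] if_not_P[OF ne(2)] if_not_P[OF ne(3)] if_not_P[OF ne(4)] if_P[OF True]
      by simp
  next
    case False
    have le: "(if b then c else 0) \<le> (c::nat)" for b c by simp
    have "(if t = i then 37 else 0) + (if t = j then 5 else 0) + (if t = k then 5 else 0)
        + (if t = l then 5 else 0) \<le> (37 + 5 + 5 + 5 :: nat)"
      by (intro add_mono le)
    then show ?thesis unfolding if_not_P[OF False] by (rule order_trans[OF eq_refl[OF add_0_right] order_trans]) simp
  qed
  have bd: "\<bar>f x\<bar> \<le> C * (\<Sum>m\<in>S. \<phi> (x i) ^ 37 * \<phi> (x j) ^ 5 * \<phi> (x k) ^ 5 * \<phi> (x l) ^ 5 * \<phi> (x m) ^ 12)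
        / real (card S) ^ Suc 3" for x
  proof -
    let ?A = "\<phi> (x i) ^ 25 * \<phi> (x j) ^ 5 * \<phi> (x k) ^ 5 * \<phi> (x l) ^ 5"
    have "\<bar>f x\<bar> \<le> C * ?A * (1 / (\<Sum>t\<in>S. w (x i) (x t)) ^ 3)" using f[of x] by simp
    also have "\<dots> \<le> C * ?A * ((\<Sum>t\<in>S. \<phi> (x i) ^ (4 * 3) * \<phi> (x t) ^ (4 * 3)) / real (card S) ^ Suc 3)"
      using C \<phi>_pos[THEN less_imp_le] by (intro mult_left_mono inverse_weight_sum_le SI S) auto
    also have "\<dots> = C * (\<Sum>t\<in>S. ?A * (\<phi> (x i) ^ (4 * 3) * \<phi> (x t) ^ (4 * 3))) / real (card S) ^ Suc 3"
      by (simp add: sum_distrib_left mult_ac)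
    also have "(\<Sum>t\<in>S. ?A * (\<phi> (x i) ^ (4 * 3) * \<phi> (x t) ^ (4 * 3)))
      = (\<Sum>m\<in>S. \<phi> (x i) ^ 37 * \<phi> (x j) ^ 5 * \<phi> (x k) ^ 5 * \<phi> (x l) ^ 5 * \<phi> (x m) ^ 12)"
      using power_add[of "\<phi> (x i)" 25 12] by (intro sum.cong) (simp_all add: mult_ac)
    finally show ?thesis .
  qed
  show "integrable (PiM I (\<lambda>_. N)) f"
    by (rule dominated_integral(1)[OF ijkl SI(1) S(2) e assms(8) C bd])
  show "\<bar>\<integral>x. f x \<partial>PiM I (\<lambda>_. N)\<bar> \<le> C * L ^ 5 / real (card S) ^ 3"
    by (rule dominated_integral(2)[OF ijkl SI(1) S(2) e assms(8) C bd])
qed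

lemma integral_PiM_update_eq_0:
  fixes F :: "(nat \<Rightarrow> 's) \<Rightarrow> real"
  assumes "finite I" "j \<in> I" and int: "integrable (PiM I (\<lambda>_. N)) F"
    and 0: "\<And>x. (\<integral>a. F (x(j := a)) \<partial>N) = 0"
  shows "(\<integral>x. F x \<partial>PiM I (\<lambda>_. N)) = 0"
proof -
  have I: "I = insert j (I - {j})" using assms by auto
  have "(\<integral>x. F x \<partial>PiM (insert j (I - {j})) (\<lambda>_. N))
      = (\<integral>x. (\<integral>a. F (x(j := a)) \<partial>N) \<partial>PiM (I - {j}) (\<lambda>_. N))"
    using assms I by (intro product_integral_insert) auto
  then show ?thesis unfolding I[symmetric] by (simp add: 0)
qed

lemma distinct_term_centered:
  assumes ijkl: "finite (I :: nat set)" "i \<in> I" "j \<in> I" "k \<in> I" "l \<in> I"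
    and S: "S = I - {i, j, k, l}" "S \<noteq> {}"
    and dist: "distinct [i, j, k, l]"
  shows "(\<integral>x. w (x i) (x j) * w (x i) (x k) * w (x i) (x l) * (H (x i) (x j) (x k) (x l) - H3 (x i))
     / (\<Sum>t\<in>S. w (x i) (x t)) ^ 3 \<partial>PiM I (\<lambda>_. N)) = 0"
proof -
  let ?P = "PiM I (\<lambda>_. N)"
  let ?w = "\<lambda>x. w (x i) (x j) * w (x i) (x k) * w (x i) (x l)"
  let ?V = "\<lambda>x. (\<Sum>t\<in>S. w (x i) (x t)) ^ 3"
  let ?d1 = "\<lambda>x. H (x i) (x j) (x k) (x l) - H1 (x i) (x k) (x l)"
  let ?d2 = "\<lambda>x. H1 (x i) (x k) (x l) - H2 (x i) (x l)"
  let ?d3 = "\<lambda>x. H2 (x i) (x l) - H3 (x i)"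
  have SI: "S \<subseteq> I" "finite S" using S ijkl(1) by auto
  have nS: "t \<noteq> i" "t \<noteq> j" "t \<noteq> k" "t \<noteq> l" if "t \<in> S" for t using that S by auto
  note [measurable] = ijkl
  have [measurable]: "t \<in> S \<Longrightarrow> t \<in> I" for t using SI by auto
  have Vpos: "0 < ?V x" for x using S(2) SI by (intro zero_less_power sum_pos w_pos) auto
  have int: "integrable ?P (\<lambda>x. ?w x * d x / ?V x)"
    if [measurable]: "d \<in> borel_measurable ?P"
      and d: "\<And>x. \<bar>d x\<bar> \<le> 2 * K * L ^ 3 * \<phi> (x i) ^ 13 * \<phi> (x j) * \<phi> (x k) * \<phi> (x l)" for d
  proof (rule term_over_partial_sum(1)[OF ijkl S])
    show "(\<lambda>x. ?w x * d x / ?V x) \<in> borel_measurable ?P" by measurable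
    show "0 \<le> 2 * K * L ^ 3" using K_nonneg L_ge1 by simp
    fix x
    show "\<bar>?w x * d x / ?V x\<bar> \<le> 2 * K * L ^ 3 * (\<phi> (x i) ^ 25 * \<phi> (x j) ^ 5 * \<phi> (x k) ^ 5 * \<phi> (x l) ^ 5) / ?V x"
      unfolding abs_divide abs_of_pos[OF Vpos]
      by (intro divide_right_mono weighted_term_le d less_imp_le[OF Vpos])
  qed
  have i1: "integrable ?P (\<lambda>x. ?w x * ?d1 x / ?V x)"
    by (intro int H_diff_bounds) measurable
  have i2: "integrable ?P (\<lambda>x. ?w x * ?d2 x / ?V x)"
    by (intro int H_diff_bounds) measurable
  have i3: "integrable ?P (\<lambda>x. ?w x * ?d3 x / ?V x)"
    by (intro int H_diff_bounds) measurable
  have dst: "i \<noteq> j" "i \<noteq> k" "i \<noteq> l" "j \<noteq> k" "j \<noteq> l" "k \<noteq> l" using dist by auto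
  have upd: "(x(u := a)) v = x v" if "v \<noteq> u" for x :: "nat \<Rightarrow> 's" and u v a using that by simp
  have Vupd: "(\<Sum>t\<in>S. w s ((x(u := a)) t)) = (\<Sum>t\<in>S. w s (x t))"
    if "u \<notin> S" for x s u a
    using that by (intro sum.cong refl) (metis upd)
  have jS: "j \<notin> S" "k \<notin> S" "l \<notin> S" using S by auto
  note Vupdj = Vupd[OF jS(1)] and Vupdk = Vupd[OF jS(2)] and Vupdl = Vupd[OF jS(3)]
  note upds = fun_upd_same dst[THEN fun_upd_other] dst(4-6)[symmetric, THEN fun_upd_other]
  have z1: "(\<integral>x. ?w x * ?d1 x / ?V x \<partial>?P) = 0"
  proof (rule integral_PiM_update_eq_0[OF ijkl(1,3) i1])
    fix x
    have "(\<integral>a. ?w (x(j := a)) * ?d1 (x(j := a)) / ?V (x(j := a)) \<partial>N)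
      = (\<integral>a. (w (x i) (x k) * w (x i) (x l) / ?V x) * (w (x i) a * (H (x i) a (x k) (x l) - H1 (x i) (x k) (x l))) \<partial>N)"
      by (intro Bochner_Integration.integral_cong refl)
        (simp only: Vupdj upds mult_ac times_divide_eq_left times_divide_eq_right)
    then show "(\<integral>a. ?w (x(j := a)) * ?d1 (x(j := a)) / ?V (x(j := a)) \<partial>N) = 0"
      by (simp only: integral_mult_right_zero centered_H mult_zero_right)
  qed
  have z2: "(\<integral>x. ?w x * ?d2 x / ?V x \<partial>?P) = 0"
  proof (rule integral_PiM_update_eq_0[OF ijkl(1,4) i2])
    fix x
    have "(\<integral>a. ?w (x(k := a)) * ?d2 (x(k := a)) / ?V (x(k := a)) \<partial>N)
      = (\<integral>a. (w (x i) (x j) * w (x i) (x l) / ?V x) * (w (x i) a * (H1 (x i) a (x l) - H2 (x i) (x l))) \<partial>N)"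
      by (intro Bochner_Integration.integral_cong refl)
        (simp only: Vupdk upds mult_ac times_divide_eq_left times_divide_eq_right)
    then show "(\<integral>a. ?w (x(k := a)) * ?d2 (x(k := a)) / ?V (x(k := a)) \<partial>N) = 0"
      by (simp only: integral_mult_right_zero centered_H mult_zero_right)
  qed
  have z3: "(\<integral>x. ?w x * ?d3 x / ?V x \<partial>?P) = 0"
  proof (rule integral_PiM_update_eq_0[OF ijkl(1,5) i3])
    fix x
    have "(\<integral>a. ?w (x(l := a)) * ?d3 (x(l := a)) / ?V (x(l := a)) \<partial>N)
      = (\<integral>a. (w (x i) (x j) * w (x i) (x k) / ?V x) * (w (x i) a * (H2 (x i) a - H3 (x i))) \<partial>N)"
      by (intro Bochner_Integration.integral_cong refl)
        (simp only: Vupdl upds mult_ac times_divide_eq_left times_divide_eq_right)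
    then show "(\<integral>a. ?w (x(l := a)) * ?d3 (x(l := a)) / ?V (x(l := a)) \<partial>N) = 0"
      by (simp only: integral_mult_right_zero centered_H mult_zero_right)
  qed
  have "(\<integral>x. ?w x * (H (x i) (x j) (x k) (x l) - H3 (x i)) / ?V x \<partial>?P)
      = (\<integral>x. ?w x * ?d1 x / ?V x + ?w x * ?d2 x / ?V x + ?w x * ?d3 x / ?V x \<partial>?P)"
    by (intro Bochner_Integration.integral_cong refl)
      (simp add: add_divide_distrib[symmetric] distrib_left[symmetric] del: minus_diff_eq)
  then show ?thesis
    by (simp only: Bochner_Integration.integral_add[OF Bochner_Integration.integrable_add[OF i1 i2] i3]
      Bochner_Integration.integral_add[OF i1 i2] z1 z2 z3 add_0)
qed

lemma term_bound:
  assumes n: "5 \<le> n" and "i < n" "j < n" "k < n" "l < n"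
  defines "P \<equiv> PiM {..<n} (\<lambda>_. N)"
    and "F \<equiv> \<lambda>x. w (x i) (x j) * w (x i) (x k) * w (x i) (x l) * (H (x i) (x j) (x k) (x l) - H3 (x i))
      / (\<Sum>t<n. w (x i) (x t)) ^ 3"
  shows "integrable P F"
    and "\<bar>\<integral>x. F x \<partial>P\<bar> \<le> 2 * K * L ^ 8 / real (n - 4) ^ 3"
    and "distinct [i, j, k, l] \<Longrightarrow> \<bar>\<integral>x. F x \<partial>P\<bar> \<le> 24 * K * L ^ 8 / real (n - 4) ^ 4"
proof -
  define I where "I = {..<n}"
  define S where "S = I - {i, j, k, l}"
  define u where "u = (\<lambda>x. w (x i) (x j) * w (x i) (x k) * w (x i) (x l) * (H (x i) (x j) (x k) (x l) - H3 (x i)))"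
  define V where "V = (\<lambda>x. \<Sum>t\<in>S. w (x i) (x t))"
  define W where "W = (\<lambda>x. \<Sum>t\<in>I. w (x i) (x t))"
  define C where "C = 2 * K * L ^ 3"
  have C: "0 \<le> C" using K_nonneg L_ge1 by (simp add: C_def)
  have ijkl: "finite I" "i \<in> I" "j \<in> I" "k \<in> I" "l \<in> I" using assms by (auto simp: I_def)
  have card4: "card {i, j, k, l} \<le> 4" using card_length[of "[i, j, k, l]"] by simp
  have "card S = card I - card {i, j, k, l}" unfolding S_def using ijkl by (intro card_Diff_subset) auto
  then have cardS: "n - 4 \<le> card S" using card4 by (simp add: I_def)
  have Sne: "S \<noteq> {}" using cardS n by auto
  have fS: "finite S" "S \<subseteq> I" by (auto simp: S_def ijkl)
  have cn: "0 < real (n - 4)" using n by simp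
  note [measurable] = ijkl
  have [measurable]: "t \<in> S \<Longrightarrow> t \<in> I" for t using fS by auto
  have meas [measurable]: "u \<in> borel_measurable P" "V \<in> borel_measurable P" "W \<in> borel_measurable P"
    unfolding P_def I_def[symmetric] u_def V_def W_def by measurable
  have Vpos: "0 < V x" for x unfolding V_def using Sne fS by (intro sum_pos w_pos) auto
  have Wsplit: "W x = V x + (\<Sum>t\<in>{i, j, k, l}. w (x i) (x t))" for x
    unfolding W_def V_def S_def using ijkl by (subst sum.subset_diff[of "{i, j, k, l}"]) auto
  have VW: "V x \<le> W x" for x unfolding Wsplit using w_pos[THEN less_imp_le] by (simp add: sum_nonneg)
  have Wpos: "0 < W x" for x using Vpos VW by (rule less_le_trans)
  have u_le: "\<bar>u x\<bar> \<le> C * (\<phi> (x i) ^ 25 * \<phi> (x j) ^ 5 * \<phi> (x k) ^ 5 * \<phi> (x l) ^ 5)" for x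
    unfolding u_def C_def by (intro weighted_term_le H_diff_bounds)
  have F: "F = (\<lambda>x. u x / W x ^ 3)" unfolding F_def u_def W_def I_def ..
  have le: "\<bar>u x / W x ^ 3\<bar> \<le> C * (\<phi> (x i) ^ 25 * \<phi> (x j) ^ 5 * \<phi> (x k) ^ 5 * \<phi> (x l) ^ 5) / V x ^ 3" for x
    unfolding abs_divide abs_of_pos[OF zero_less_power[OF Wpos]]
    using u_le[of x] Vpos[of x] VW[of x] by (intro frac_le power_mono) auto
  have le': "\<bar>u x / V x ^ 3\<bar> \<le> C * (\<phi> (x i) ^ 25 * \<phi> (x j) ^ 5 * \<phi> (x k) ^ 5 * \<phi> (x l) ^ 5) / V x ^ 3" for x
    unfolding abs_divide abs_of_pos[OF zero_less_power[OF Vpos]]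
    using u_le[of x] Vpos[of x] by (intro divide_right_mono) auto
  have V_eq: "(\<Sum>t\<in>S. w (x i) (x t)) = V x" for x by (simp add: V_def)
  note top = term_over_partial_sum[OF ijkl S_def Sne, unfolded V_eq, unfolded I_def, folded P_def]
  have mW: "(\<lambda>x. u x / W x ^ 3) \<in> borel_measurable P" by measurable
  have mV: "(\<lambda>x. u x / V x ^ 3) \<in> borel_measurable P" by measurable
  show intF: "integrable P F" unfolding F by (rule top(1)[OF mW C le])
  have intV: "integrable P (\<lambda>x. u x / V x ^ 3)" by (rule top(1)[OF mV C le'])
  have CL: "C * L ^ 5 = 2 * K * L ^ 8" unfolding C_def using power_add[of L 3 5] by simp
  have "\<bar>\<integral>x. F x \<partial>P\<bar> \<le> C * L ^ 5 / real (card S) ^ 3" unfolding F by (rule top(2)[OF mW C le])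
  also have "\<dots> \<le> C * L ^ 5 / real (n - 4) ^ 3"
    using C L_ge1 cn cardS by (intro divide_left_mono power_mono) auto
  finally show "\<bar>\<integral>x. F x \<partial>P\<bar> \<le> 2 * K * L ^ 8 / real (n - 4) ^ 3" unfolding CL .
  assume dist: "distinct [i, j, k, l]"
  have z: "(\<integral>x. u x / V x ^ 3 \<partial>P) = 0"
    unfolding P_def u_def V_def I_def[symmetric] by (rule distinct_term_centered[OF ijkl S_def Sne dist])
  have WV: "W x - V x \<le> 4 * (\<phi> (x i) ^ 8 * \<phi> (x j) ^ 4 * \<phi> (x k) ^ 4 * \<phi> (x l) ^ 4)" for x
  proof -
    have g1: "1 \<le> \<phi> (x t) ^ 4" for t by (rule \<phi>_power_ge1)
    have n0: "0 \<le> \<phi> (x t) ^ 4" for t using g1[of t] by simp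
    let ?B = "\<phi> (x i) ^ 4 * (\<phi> (x i) ^ 4 * \<phi> (x j) ^ 4 * \<phi> (x k) ^ 4 * \<phi> (x l) ^ 4)"
    have p: "y \<le> y * z" "y \<le> z * y" "1 \<le> y * z" if "1 \<le> y" "1 \<le> z" for y z :: real
      using that mult_left_mono[of 1 z y] mult_right_mono[of 1 z y] by linarith+
    have q: "\<phi> (x t) ^ 4 \<le> \<phi> (x i) ^ 4 * \<phi> (x j) ^ 4 * \<phi> (x k) ^ 4 * \<phi> (x l) ^ 4" if "t \<in> {i, j, k, l}" for t
    proof -
      let ?a = "\<phi> (x i) ^ 4" and ?b = "\<phi> (x j) ^ 4" and ?c = "\<phi> (x k) ^ 4" and ?d = "\<phi> (x l) ^ 4"
      have ab: "1 \<le> ?a * ?b" by (rule p(3)[OF g1 g1])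
      have abc: "1 \<le> ?a * ?b * ?c" by (rule p(3)[OF ab g1])
      note abcd = p(1)[OF abc g1[of l]]
      have "?a \<le> ?a * ?b * ?c * ?d" by (rule order_trans[OF order_trans[OF p(1)[OF g1 g1] p(1)[OF ab g1]] abcd])
      moreover have "?b \<le> ?a * ?b * ?c * ?d" by (rule order_trans[OF order_trans[OF p(2)[OF g1 g1] p(1)[OF ab g1]] abcd])
      moreover have "?c \<le> ?a * ?b * ?c * ?d" by (rule order_trans[OF p(2)[OF g1 ab] abcd])
      moreover have "?d \<le> ?a * ?b * ?c * ?d" by (rule p(2)[OF g1 abc])
      ultimately show ?thesis using that by (elim insertE emptyE) (simp_all only:)
    qed
    have "W x - V x = (\<Sum>t\<in>{i, j, k, l}. w (x i) (x t))" unfolding Wsplit by simp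
    also have "\<dots> \<le> (\<Sum>t\<in>{i, j, k, l}. ?B)"
      by (intro sum_mono order_trans[OF w_le] mult_left_mono q n0)
    also have "\<dots> = 4 * ?B" using dist by simp
    also have "?B = \<phi> (x i) ^ 8 * \<phi> (x j) ^ 4 * \<phi> (x k) ^ 4 * \<phi> (x l) ^ 4"
      using power_add[of "\<phi> (x i)" 4 4] by simp
    finally show ?thesis .
  qed
  have e: "(if t = i then 49 else 0) + (if t = j then 9 else 0) + (if t = k then 9 else 0)
        + (if t = l then 9 else 0) + (if t = m then 16 else 0) \<le> (63::nat)" if "m \<in> S" for m t
  proof -
    have "i \<noteq> j" "i \<noteq> k" "i \<noteq> l" "j \<noteq> k" "j \<noteq> l" "k \<noteq> l" "m \<noteq> i" "m \<noteq> j" "m \<noteq> k" "m \<noteq> l"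
      using dist that by (auto simp: S_def)
    then show ?thesis
      by (cases "t = i"; cases "t = j"; cases "t = k"; cases "t = l"; cases "t = m"; simp only: if_True if_False; simp)
  qed
  have le3: "\<bar>u x / W x ^ 3 - u x / V x ^ 3\<bar> \<le> 12 * C * (\<Sum>m\<in>S. \<phi> (x i) ^ 49 * \<phi> (x j) ^ 9 * \<phi> (x k) ^ 9 * \<phi> (x l) ^ 9
      * \<phi> (x m) ^ 16) / real (card S) ^ Suc 4" for x
  proof -
    let ?A = "C * (\<phi> (x i) ^ 25 * \<phi> (x j) ^ 5 * \<phi> (x k) ^ 5 * \<phi> (x l) ^ 5)"
    let ?B = "4 * (\<phi> (x i) ^ 8 * \<phi> (x j) ^ 4 * \<phi> (x k) ^ 4 * \<phi> (x l) ^ 4)"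
    let ?D = "(\<Sum>t\<in>S. \<phi> (x i) ^ (4 * 4) * \<phi> (x t) ^ (4 * 4)) / real (card S) ^ Suc 4"
    have A0: "0 \<le> ?A" and B0: "0 \<le> ?B" using C \<phi>_pos[THEN less_imp_le] by auto
    have "\<bar>u x / W x ^ 3 - u x / V x ^ 3\<bar> = \<bar>u x\<bar> * \<bar>1 / W x ^ 3 - 1 / V x ^ 3\<bar>"
      by (simp add: abs_mult[symmetric] right_diff_distrib)
    also have "\<dots> \<le> ?A * (3 * (W x - V x) / V x ^ 4)"
      using A0 by (intro mult_mono u_le inverse_cube_diff_le Vpos VW) auto
    also have "\<dots> = ?A * (3 * (W x - V x) * (1 / V x ^ 4))" by simp
    also have "\<dots> \<le> ?A * (3 * ?B * ?D)"
      using A0 B0 VW[of x] less_imp_le[OF Vpos[of x]]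
      by (intro mult_left_mono mult_mono WV inverse_weight_sum_le[OF fS(1) Sne, of "x i" x 4, unfolded V_eq]) auto
    also have "\<dots> = 12 * C * (\<Sum>m\<in>S. \<phi> (x i) ^ 49 * \<phi> (x j) ^ 9 * \<phi> (x k) ^ 9 * \<phi> (x l) ^ 9
      * \<phi> (x m) ^ 16) / real (card S) ^ Suc 4"
    proof -
      have "?A * (3 * ?B) * (\<phi> (x i) ^ (4 * 4) * y) = 12 * C * (\<phi> (x i) ^ 49 * \<phi> (x j) ^ 9 * \<phi> (x k) ^ 9 * \<phi> (x l) ^ 9 * y)" for y
      proof -
        have pw: "\<phi> (x i) ^ 49 = \<phi> (x i) ^ 25 * \<phi> (x i) ^ 8 * \<phi> (x i) ^ (4 * 4)" "\<phi> (x t) ^ 9 = \<phi> (x t) ^ 5 * \<phi> (x t) ^ 4" for t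
          by (simp_all flip: power_add)
        show ?thesis unfolding pw by (simp add: mult_ac)
      qed
      then show ?thesis by (simp only: times_divide_eq_right mult.assoc[symmetric] sum_distrib_left) (simp add: mult.assoc)
    qed
    finally show ?thesis .
  qed
  have "(\<integral>x. F x \<partial>P) = (\<integral>x. F x \<partial>P) - (\<integral>x. u x / V x ^ 3 \<partial>P)" by (simp only: z diff_zero)
  also have "\<dots> = (\<integral>x. u x / W x ^ 3 - u x / V x ^ 3 \<partial>P)"
    using intF intV unfolding F by (simp only: Bochner_Integration.integral_diff)
  finally have "\<bar>\<integral>x. F x \<partial>P\<bar> = \<bar>\<integral>x. u x / W x ^ 3 - u x / V x ^ 3 \<partial>P\<bar>" by (rule arg_cong)
  also have "\<dots> \<le> 12 * C * L ^ 5 / real (card S) ^ 4"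
  proof -
    have m: "(\<lambda>x. u x / W x ^ 3 - u x / V x ^ 3) \<in> borel_measurable (PiM I (\<lambda>_. N))"
      unfolding I_def P_def[symmetric] by measurable
    have C12: "0 \<le> 12 * C" using C by simp
    show ?thesis
      unfolding P_def I_def[symmetric] by (rule dominated_integral(2)[OF ijkl fS(2) Sne e m C12 le3])
  qed
  also have "\<dots> \<le> 12 * C * L ^ 5 / real (n - 4) ^ 4"
    using C L_ge1 cn cardS by (intro divide_left_mono power_mono) auto
  also have "12 * C * L ^ 5 = 24 * K * L ^ 8" using CL by simp
  finally show "\<bar>\<integral>x. F x \<partial>P\<bar> \<le> 24 * K * L ^ 8 / real (n - 4) ^ 4" .
qed

lemma integrable_H3: "integrable N H3"
proof (rule Bochner_Integration.integrable_bound)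
  show "integrable N (\<lambda>s. K * L ^ 3 * \<phi> s ^ 13)"
    by (intro integrable_mult_right integrable_\<phi>_power) simp
  show "AE s in N. norm (H3 s) \<le> norm (K * L ^ 3 * \<phi> s ^ 13)"
    using H3_le by (auto intro!: AE_I2 intro: order_trans[OF _ abs_ge_self])
qed measurable

lemma integral_component:
  assumes "i < n" and f: "integrable N f"
  shows "integrable (PiM {..<n} (\<lambda>_. N)) (\<lambda>x. f (x i) :: real)"
    and "(\<integral>x. f (x i) \<partial>PiM {..<n} (\<lambda>_. N)) = (\<integral>s. f s \<partial>N)"
proof -
  have d: "distr (PiM {..<n} (\<lambda>_. N)) N (\<lambda>x. x i) = N"
    using assms distr_PiM_component[of "{..<n}" "\<lambda>_. N" i] prob_space_axioms by simp
  have [measurable]: "f \<in> borel_measurable N" using f by simp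
  have m: "(\<lambda>x. x i) \<in> measurable (PiM {..<n} (\<lambda>_. N)) N" using assms by simp
  show "integrable (PiM {..<n} (\<lambda>_. N)) (\<lambda>x. f (x i))"
    using f integrable_distr_eq[OF m, of f] unfolding d by simp
  show "(\<integral>x. f (x i) \<partial>PiM {..<n} (\<lambda>_. N)) = (\<integral>s. f s \<partial>N)"
    using integral_distr[OF m, of f] unfolding d by simp
qed

theorem statistic_bias:
  assumes n: "8 \<le> n"
  shows "integrable (PiM {..<n} (\<lambda>_. N)) (statistic n)"
    and "\<bar>(\<integral>x. statistic n x \<partial>PiM {..<n} (\<lambda>_. N)) - (\<integral>s. H3 s \<partial>N)\<bar> \<le> 480 * K * L ^ 8 / real n"
proof -
  let ?P = "PiM {..<n} (\<lambda>_. N)"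
  define F where "F = (\<lambda>i j k l x. w (x i) (x j) * w (x i) (x k) * w (x i) (x l)
      * (H (x i) (x j) (x k) (x l) - H3 (x i)) / (\<Sum>t<n. w (x i) (x t)) ^ 3)"
  define \<alpha> where "\<alpha> = 24 * K * L ^ 8 / real (n - 4) ^ 4"
  define \<beta> where "\<beta> = 2 * K * L ^ 8 / real (n - 4) ^ 3"
  have n5: "5 \<le> n" and n0: "0 < real n" using n by auto
  have KL: "0 \<le> K * L ^ 8" using K_nonneg L_ge1 by simp
  have \<alpha>: "0 \<le> \<alpha>" and \<beta>: "0 \<le> \<beta>" using KL by (auto simp: \<alpha>_def \<beta>_def mult.assoc)
  have intF: "integrable ?P (F i j k l)"
    and F_le: "\<bar>\<integral>x. F i j k l x \<partial>?P\<bar> \<le> (if distinct [i, j, k, l] then \<alpha> else \<beta>)"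
    if "i < n" "j < n" "k < n" "l < n" for i j k l
    using term_bound[OF n5 that, folded \<alpha>_def \<beta>_def] unfolding F_def by auto
  have decomp: "(\<Sum>j<n. \<Sum>k<n. \<Sum>l<n. w (x i) (x j) * w (x i) (x k) * w (x i) (x l) / (\<Sum>t<n. w (x i) (x t)) ^ 3
       * H (x i) (x j) (x k) (x l)) = H3 (x i) + (\<Sum>j<n. \<Sum>k<n. \<Sum>l<n. F i j k l x)" for x i
  proof -
    define W where "W = (\<Sum>t<n. w (x i) (x t))"
    have W: "0 < W" unfolding W_def using n by (intro sum_pos w_pos) (auto simp: lessThan_empty_iff)
    have "(\<Sum>j<n. \<Sum>k<n. \<Sum>l<n. w (x i) (x j) * w (x i) (x k) * w (x i) (x l)) = W * (W * W)"
      by (simp only: mult.assoc sum_distrib_left[symmetric] sum_distrib_right[symmetric] W_def)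
    then have one: "(\<Sum>j<n. \<Sum>k<n. \<Sum>l<n. w (x i) (x j) * w (x i) (x k) * w (x i) (x l) / W ^ 3 * H3 (x i)) = H3 (x i)"
      using W by (simp only: sum_distrib_right[symmetric] sum_divide_distrib[symmetric]) (simp add: eval_nat_numeral)
    have "(\<Sum>j<n. \<Sum>k<n. \<Sum>l<n. w (x i) (x j) * w (x i) (x k) * w (x i) (x l) / W ^ 3 * H (x i) (x j) (x k) (x l))
      = (\<Sum>j<n. \<Sum>k<n. \<Sum>l<n. w (x i) (x j) * w (x i) (x k) * w (x i) (x l) / W ^ 3 * H3 (x i) + F i j k l x)"
      unfolding F_def W_def[symmetric]
      by (intro sum.cong refl) (simp add: right_diff_distrib diff_divide_distrib)
    then show ?thesis by (simp only: sum.distrib one W_def[symmetric])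
  qed
  have st: "statistic n = (\<lambda>x. (1 / real n) * (\<Sum>i<n. H3 (x i) + (\<Sum>j<n. \<Sum>k<n. \<Sum>l<n. F i j k l x)))"
    unfolding statistic_def decomp ..
  have int3: "integrable ?P (\<lambda>x. \<Sum>j<n. \<Sum>k<n. \<Sum>l<n. F i j k l x)" if "i < n" for i
    using that by (intro Bochner_Integration.integrable_sum intF) auto
  have intH: "integrable ?P (\<lambda>x. H3 (x i))" if "i < n" for i
    using integral_component(1)[OF that integrable_H3] .
  show "integrable ?P (statistic n)"
    unfolding st by (intro integrable_mult_right Bochner_Integration.integrable_sum Bochner_Integration.integrable_add int3 intH) auto
  have E: "(\<integral>x. statistic n x \<partial>?P)
      = (\<integral>s. H3 s \<partial>N) + (1 / real n) * (\<Sum>i<n. \<Sum>j<n. \<Sum>k<n. \<Sum>l<n. \<integral>x. F i j k l x \<partial>?P)"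
  proof -
    have "(\<integral>x. statistic n x \<partial>?P)
        = (1 / real n) * (\<Sum>i<n. (\<integral>x. H3 (x i) \<partial>?P) + (\<integral>x. (\<Sum>j<n. \<Sum>k<n. \<Sum>l<n. F i j k l x) \<partial>?P))"
      unfolding st integral_mult_right_zero
      by (subst Bochner_Integration.integral_sum)
        (auto intro!: Bochner_Integration.integrable_add int3 intH sum.cong Bochner_Integration.integral_add)
    also have "(\<Sum>i<n. (\<integral>x. H3 (x i) \<partial>?P) + (\<integral>x. (\<Sum>j<n. \<Sum>k<n. \<Sum>l<n. F i j k l x) \<partial>?P))
        = (\<Sum>i<n. (\<integral>s. H3 s \<partial>N) + (\<Sum>j<n. \<Sum>k<n. \<Sum>l<n. \<integral>x. F i j k l x \<partial>?P))"
    proof (intro sum.cong refl arg_cong2[where f = "(+)"])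
      fix i assume i: "i \<in> {..<n}"
      then show "(\<integral>x. H3 (x i) \<partial>?P) = (\<integral>s. H3 s \<partial>N)" using integral_component(2)[OF _ integrable_H3] by simp
      have "(\<integral>x. (\<Sum>j<n. \<Sum>k<n. \<Sum>l<n. F i j k l x) \<partial>?P) = (\<Sum>j<n. \<integral>x. (\<Sum>k<n. \<Sum>l<n. F i j k l x) \<partial>?P)"
        using i by (intro Bochner_Integration.integral_sum Bochner_Integration.integrable_sum intF) auto
      also have "\<dots> = (\<Sum>j<n. \<Sum>k<n. \<integral>x. (\<Sum>l<n. F i j k l x) \<partial>?P)"
        using i by (intro sum.cong refl Bochner_Integration.integral_sum Bochner_Integration.integrable_sum intF) auto
      also have "\<dots> = (\<Sum>j<n. \<Sum>k<n. \<Sum>l<n. \<integral>x. F i j k l x \<partial>?P)"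
        using i by (intro sum.cong refl Bochner_Integration.integral_sum Bochner_Integration.integrable_sum intF) auto
      finally show "(\<integral>x. (\<Sum>j<n. \<Sum>k<n. \<Sum>l<n. F i j k l x) \<partial>?P) = (\<Sum>j<n. \<Sum>k<n. \<Sum>l<n. \<integral>x. F i j k l x \<partial>?P)" .
    qed
    finally show ?thesis using n0 by (simp add: sum.distrib distrib_left)
  qed
  have inner: "\<bar>\<Sum>j<n. \<Sum>k<n. \<Sum>l<n. \<integral>x. F i j k l x \<partial>?P\<bar> \<le> real n ^ 3 * \<alpha> + 6 * real n ^ 2 * \<beta>" if i: "i < n" for i
  proof -
    have "\<bar>\<Sum>j<n. \<Sum>k<n. \<Sum>l<n. \<integral>x. F i j k l x \<partial>?P\<bar> \<le> (\<Sum>j<n. \<Sum>k<n. \<Sum>l<n. \<bar>\<integral>x. F i j k l x \<partial>?P\<bar>)"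
      by (intro order_trans[OF sum_abs] sum_mono order_refl)
    also have "\<dots> \<le> (\<Sum>j<n. \<Sum>k<n. \<Sum>l<n. \<alpha> + ((if j = i then \<beta> else 0) + (if k = i then \<beta> else 0) + (if l = i then \<beta> else 0)
       + (if k = j then \<beta> else 0) + (if l = k then \<beta> else 0) + (if l = j then \<beta> else 0)))"
    proof (intro sum_mono)
      fix j k l assume "j \<in> {..<n}" "k \<in> {..<n}" "l \<in> {..<n}"
      then have "\<bar>\<integral>x. F i j k l x \<partial>?P\<bar> \<le> (if distinct [i, j, k, l] then \<alpha> else \<beta>)"
        using F_le i by auto
      also have "\<dots> \<le> \<alpha> + ((if j = i then \<beta> else 0) + (if k = i then \<beta> else 0) + (if l = i then \<beta> else 0)
       + (if k = j then \<beta> else 0) + (if l = k then \<beta> else 0) + (if l = j then \<beta> else 0))"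
      proof (cases "distinct [i, j, k, l]")
        case True
        have nn: "0 \<le> (if b then \<beta> else 0)" for b using \<beta> by simp
        show ?thesis unfolding if_P[OF True] by (intro order_trans[OF eq_refl[OF add_0_right[symmetric]] add_left_mono] add_nonneg_nonneg nn)
      next
        case False
        have six: "\<beta> \<le> (if b1 then \<beta> else 0) + (if b2 then \<beta> else 0) + (if b3 then \<beta> else 0)
          + (if b4 then \<beta> else 0) + (if b5 then \<beta> else 0) + (if b6 then \<beta> else 0)"
          if "b1 \<or> b2 \<or> b3 \<or> b4 \<or> b5 \<or> b6" for b1 b2 b3 b4 b5 b6
          using that \<beta> by (elim disjE) (simp_all add: add_increasing add_increasing2)
        have "j = i \<or> k = i \<or> l = i \<or> k = j \<or> l = k \<or> l = j" using False by auto
        from add_mono[OF \<alpha> six[OF this]] show ?thesis unfolding if_not_P[OF False] add_0 .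
      qed
      finally show "\<bar>\<integral>x. F i j k l x \<partial>?P\<bar> \<le> \<dots>" .
    qed
    also have "\<dots> = real n ^ 3 * \<alpha> + 6 * real n ^ 2 * \<beta>"
    proof -
      have "(\<Sum>j<n. \<Sum>k<n. \<Sum>l<n. if l = i then \<beta> else 0) = real n ^ 2 * \<beta>"
        "(\<Sum>j<n. \<Sum>k<n. \<Sum>l<n. if k = i then \<beta> else 0) = real n ^ 2 * \<beta>"
        "(\<Sum>j<n. \<Sum>k<n. \<Sum>l<n. if j = i then \<beta> else 0) = real n ^ 2 * \<beta>"
        "(\<Sum>j<n. \<Sum>k<n. \<Sum>l<n. if k = j then \<beta> else 0) = real n ^ 2 * \<beta>"
        "(\<Sum>j<n. \<Sum>k<n. \<Sum>l<n. if l = k then \<beta> else 0) = real n ^ 2 * \<beta>"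
        "(\<Sum>j<n. \<Sum>k<n. \<Sum>l<n. if l = j then \<beta> else 0) = real n ^ 2 * \<beta>"
        "(\<Sum>j<n. \<Sum>k<n. \<Sum>l<n. \<alpha>) = real n ^ 3 * \<alpha>"
        using i by (simp_all add: sum_distrib_left[symmetric] power2_eq_square power3_eq_cube)
      then show ?thesis by (simp only: sum.distrib)
    qed
    finally show ?thesis .
  qed
  have half: "real n / 2 \<le> real (n - 4)" using n by simp
  have a: "\<alpha> \<le> 24 * K * L ^ 8 / (real n / 2) ^ 4" and b: "\<beta> \<le> 2 * K * L ^ 8 / (real n / 2) ^ 3"
    unfolding \<alpha>_def \<beta>_def using half n0 KL by (auto intro!: divide_left_mono power_mono simp: mult.assoc)
  have "real n ^ 3 * \<alpha> + 6 * real n ^ 2 * \<beta>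
      \<le> real n ^ 3 * (24 * K * L ^ 8 / (real n / 2) ^ 4) + 6 * real n ^ 2 * (2 * K * L ^ 8 / (real n / 2) ^ 3)"
    using a b by (intro add_mono mult_left_mono) auto
  also have "\<dots> = 480 * K * L ^ 8 / real n" using n0 by (simp add: field_simps eval_nat_numeral)
  finally have B: "real n ^ 3 * \<alpha> + 6 * real n ^ 2 * \<beta> \<le> 480 * K * L ^ 8 / real n" .
  have "\<bar>\<Sum>i<n. \<Sum>j<n. \<Sum>k<n. \<Sum>l<n. \<integral>x. F i j k l x \<partial>?P\<bar> \<le> (\<Sum>i<n. 480 * K * L ^ 8 / real n)"
    by (rule order_trans[OF sum_abs sum_mono]) (use order_trans[OF inner B] in simp)
  also have "\<dots> = 480 * K * L ^ 8" using n0 by simp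
  finally have S: "\<bar>\<Sum>i<n. \<Sum>j<n. \<Sum>k<n. \<Sum>l<n. \<integral>x. F i j k l x \<partial>?P\<bar> \<le> 480 * K * L ^ 8" .
  have "\<bar>(\<integral>x. statistic n x \<partial>?P) - (\<integral>s. H3 s \<partial>N)\<bar>
      = (1 / real n) * \<bar>\<Sum>i<n. \<Sum>j<n. \<Sum>k<n. \<Sum>l<n. \<integral>x. F i j k l x \<partial>?P\<bar>"
    unfolding E by (simp add: abs_mult)
  also have "\<dots> \<le> (1 / real n) * (480 * K * L ^ 8)" using S by (intro mult_left_mono) auto
  finally show "\<bar>(\<integral>x. statistic n x \<partial>?P) - (\<integral>s. H3 s \<partial>N)\<bar> \<le> 480 * K * L ^ 8 / real n" by simp
qed

end

section \<open>Application to the attention model\<close>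

lemma borel_measurable_matrix_mult [measurable]:
  fixes f :: "'s \<Rightarrow> real^'n^'m" and g :: "'s \<Rightarrow> real^'k^'n"
  assumes "f \<in> borel_measurable M" "g \<in> borel_measurable M"
  shows "(\<lambda>x. f x ** g x) \<in> borel_measurable M"
  using assms
  by (rule borel_measurable_continuous_Pair)
    (intro bounded_bilinear.continuous_on[OF bounded_bilinear_matrix_mult] continuous_intros)

lemma borel_measurable_outer [measurable]:
  fixes f :: "'s \<Rightarrow> real^'n"
  assumes "f \<in> borel_measurable M"
  shows "(\<lambda>x. outer (f x)) \<in> borel_measurable M"
proof -
  have "continuous_on UNIV (outer :: real^'n \<Rightarrow> _)"
    unfolding outer_def by (intro continuous_on_vec_lambda continuous_intros)
  from measurable_compose[OF assms borel_measurable_continuous_onI[OF this]] show ?thesis .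
qed

lemma loss_form_bound:
  fixes \<theta> \<delta> :: "('d::finite, 'p::finite) param" and s a b c :: "(real^'d) \<times> (real^'p)"
  assumes A: "norm (fst \<theta>) \<le> \<kappa>" and \<delta>: "norm \<delta> \<le> 1" and \<kappa>: "0 \<le> \<kappa>"
  shows "\<bar>loss_form \<theta> \<delta> s (fst a) (fst b) (fst c)\<bar>
    \<le> 3 * (\<kappa> + 1) ^ 3 * ((1 + norm s)\<^sup>2 * (1 + norm a)\<^sup>2 * (1 + norm b)\<^sup>2 * (1 + norm c)\<^sup>2)"
proof -
  let ?r = "\<lambda>s. 1 + norm (s :: (real^'d) \<times> (real^'p))"
  have r1: "1 \<le> ?r s" for s by simp
  have x: "norm (fst s) \<le> ?r s" "norm (snd s) \<le> ?r s" for s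
    using norm_fst_le[of "fst s" "snd s"] norm_snd_le[of "snd s" "fst s"] by simp_all
  have d: "norm (fst \<delta>) \<le> 1" "norm (snd \<delta>) \<le> 1"
    using \<delta> norm_fst_le[of "fst \<delta>" "snd \<delta>"] norm_snd_le[of "snd \<delta>" "fst \<delta>"] by simp_all
  have m1: "y \<le> y * z" if "0 \<le> y" "1 \<le> z" for y z :: real using mult_left_mono[OF that(2,1)] by simp
  define v where "v = fst \<theta> *v fst a - snd s"
  have v: "norm v \<le> (\<kappa> + 1) * (?r s * ?r a)"
  proof -
    have "norm v \<le> norm (fst \<theta> *v fst a) + norm (snd s)" unfolding v_def by (rule norm_triangle_ineq4)
    also have "\<dots> \<le> \<kappa> * ?r a + ?r s"
      using \<kappa> by (intro add_mono x order_trans[OF norm_matrix_vector_mult_le] mult_mono A) auto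
    also have "\<dots> \<le> \<kappa> * (?r a * ?r s) + ?r s * ?r a"
      using \<kappa> by (intro add_mono mult_left_mono m1 r1) auto
    finally show ?thesis by (simp add: algebra_simps)
  qed
  have t1: "\<bar>v \<bullet> (fst \<delta> *v fst b)\<bar> \<le> (\<kappa> + 1) * (?r s * ?r a) * ?r b"
  proof -
    have "norm (fst \<delta> *v fst b) \<le> 1 * ?r b"
      by (intro order_trans[OF norm_matrix_vector_mult_le] mult_mono d x) auto
    then show ?thesis using v \<kappa> by (intro order_trans[OF Cauchy_Schwarz_ineq2] mult_mono) auto
  qed
  have t2: "\<bar>v \<bullet> (fst \<theta> *v fst b)\<bar> \<le> (\<kappa> + 1) * (?r s * ?r a) * (\<kappa> * ?r b)"
  proof -
    have "norm (fst \<theta> *v fst b) \<le> \<kappa> * ?r b"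
      using \<kappa> by (intro order_trans[OF norm_matrix_vector_mult_le] mult_mono A x) auto
    then show ?thesis using v \<kappa> by (intro order_trans[OF Cauchy_Schwarz_ineq2] mult_mono) auto
  qed
  have t3: "\<bar>fst s \<bullet> (snd \<delta> *v (fst b - fst c))\<bar> \<le> ?r s * (2 * (?r b * ?r c))"
  proof -
    have "norm (fst b - fst c) \<le> norm (fst b) + norm (fst c)" by (rule norm_triangle_ineq4)
    also have "\<dots> \<le> ?r b * ?r c + ?r c * ?r b"
      by (intro add_mono order_trans[OF x(1)] m1 r1) auto
    finally have n: "norm (fst b - fst c) \<le> 2 * (?r b * ?r c)" by (simp add: mult.commute)
    have "norm (snd \<delta> *v (fst b - fst c)) \<le> 1 * (2 * (?r b * ?r c))"
      by (intro order_trans[OF norm_matrix_vector_mult_le] mult_mono d n) auto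
    then show ?thesis by (intro order_trans[OF Cauchy_Schwarz_ineq2] mult_mono x) auto
  qed
  let ?P = "(?r s)\<^sup>2 * (?r a)\<^sup>2 * (?r b)\<^sup>2 * (?r c)\<^sup>2"
  have q1: "?r u \<le> (?r u)\<^sup>2" for u unfolding power2_eq_square by (rule m1) simp_all
  note q = q1 order_trans[OF r1 q1]
  have P1: "?r s * ?r a * ?r b \<le> ?P"
  proof -
    have "?r s * ?r a * ?r b * 1 \<le> ?P" using q by (intro mult_mono) auto
    then show ?thesis by simp
  qed
  have P2: "?r s * ?r a * ?r b * (?r s * (?r b * ?r c)) \<le> ?P"
  proof -
    have "?r s * ?r a * ?r b * (?r s * (?r b * ?r c)) = (?r s)\<^sup>2 * ?r a * (?r b)\<^sup>2 * ?r c"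
      by (simp add: power2_eq_square mult_ac)
    also have "\<dots> \<le> ?P" using q by (intro mult_mono) auto
    finally show ?thesis .
  qed
  have "\<bar>loss_form \<theta> \<delta> s (fst a) (fst b) (fst c)\<bar>
      \<le> \<bar>v \<bullet> (fst \<delta> *v fst b)\<bar> + \<bar>v \<bullet> (fst \<theta> *v fst b)\<bar> * \<bar>fst s \<bullet> (snd \<delta> *v (fst b - fst c))\<bar>"
    unfolding loss_form_def v_def[symmetric] abs_mult[symmetric] by (rule abs_triangle_ineq)
  also have "\<dots> \<le> (\<kappa> + 1) * (?r s * ?r a) * ?r b + (\<kappa> + 1) * (?r s * ?r a) * (\<kappa> * ?r b) * (?r s * (2 * (?r b * ?r c)))"
    using \<kappa> by (intro add_mono mult_mono t1 t2 t3) auto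
  also have "\<dots> = (\<kappa> + 1) * (?r s * ?r a * ?r b) + 2 * \<kappa> * (\<kappa> + 1) * (?r s * ?r a * ?r b * (?r s * (?r b * ?r c)))"
    by (simp only: mult_ac)
  also have "\<dots> \<le> (\<kappa> + 1) * ?P + 2 * \<kappa> * (\<kappa> + 1) * ?P"
    using \<kappa> by (intro add_mono mult_left_mono P1 P2) auto
  also have "\<dots> = ((\<kappa> + 1) + 2 * \<kappa> * (\<kappa> + 1)) * ?P" by (simp only: distrib_right)
  also have "\<dots> \<le> 3 * (\<kappa> + 1) ^ 3 * ?P"
  proof (rule mult_right_mono)
    have "(\<kappa> + 1) + 2 * \<kappa> * (\<kappa> + 1) \<le> 3 * (\<kappa> + 1) ^ 3"
      using \<kappa> by (simp add: power3_eq_cube algebra_simps)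
    then show "(\<kappa> + 1) + 2 * \<kappa> * (\<kappa> + 1) \<le> 3 * (\<kappa> + 1) ^ 3" .
  qed simp
  finally show ?thesis .
qed

lemma norm_matrix_mult_mono:
  fixes X :: "real^'i^'j" and Y :: "real^'k^'i"
  assumes "norm X \<le> \<alpha>" "norm Y \<le> \<beta>"
  shows "norm (X ** Y) \<le> \<alpha> * \<beta>"
  using assms order_trans[OF norm_ge_zero assms(1)]
  by (intro order_trans[OF norm_matrix_mult_le] mult_mono) auto

lemma reg_form_bound:
  fixes \<theta> \<delta> :: "('d::finite, 'p::finite) param" and s a b c :: "(real^'d) \<times> (real^'p)"
  assumes A: "norm (fst \<theta>) \<le> \<kappa>" "norm (snd \<theta>) \<le> \<kappa>" and \<delta>: "norm \<delta> \<le> 1" and \<kappa>: "0 \<le> \<kappa>"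
  shows "\<bar>reg_form \<theta> \<delta> (outer (fst s)) (outer (fst a)) (outer (fst b)) (outer (fst c))\<bar>
    \<le> 3 * (\<kappa> + 1) ^ 3 * ((1 + norm s)\<^sup>2 * (1 + norm a)\<^sup>2 * (1 + norm b)\<^sup>2 * (1 + norm c)\<^sup>2)"
proof -
  let ?r = "\<lambda>s. (1 + norm (s :: (real^'d) \<times> (real^'p)))\<^sup>2"
  have r1: "1 \<le> ?r s" for s by (simp add: power2_eq_square algebra_simps)
  have o: "norm (outer (fst s)) \<le> ?r s" for s
    unfolding norm_outer using norm_fst_le[of "fst s" "snd s"] by (intro power_mono) simp_all
  have d: "norm (fst \<delta>) \<le> 1" "norm (snd \<delta>) \<le> 1"
    using \<delta> norm_fst_le[of "fst \<delta>" "snd \<delta>"] norm_snd_le[of "snd \<delta>" "fst \<delta>"] by simp_all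
  note tA = A[folded norm_transpose[of "fst \<theta>"] norm_transpose[of "snd \<theta>"]]
  note td = d[folded norm_transpose[of "fst \<delta>"] norm_transpose[of "snd \<delta>"]]
  let ?D = "transpose (fst \<theta>) ** fst \<theta> - transpose (snd \<theta>) ** outer (fst b) ** snd \<theta>"
  let ?E = "transpose (fst \<delta>) ** fst \<theta> + transpose (fst \<theta>) ** fst \<delta>"
  let ?F = "transpose (snd \<delta>) ** outer (fst c) ** snd \<theta> + transpose (snd \<theta>) ** outer (fst c) ** snd \<delta>"
  have D: "norm ?D \<le> 2 * \<kappa>\<^sup>2 * ?r b"
  proof -
    have "norm ?D \<le> norm (transpose (fst \<theta>) ** fst \<theta>) + norm (transpose (snd \<theta>) ** outer (fst b) ** snd \<theta>)"
      by (rule norm_triangle_ineq4)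
    also have "\<dots> \<le> \<kappa> * \<kappa> + \<kappa> * ?r b * \<kappa>" by (intro add_mono norm_matrix_mult_mono A tA o)
    also have "\<dots> \<le> \<kappa> * \<kappa> * ?r b + \<kappa> * ?r b * \<kappa>"
      using mult_left_mono[OF r1[of b], of "\<kappa> * \<kappa>"] \<kappa> by simp
    also have "\<dots> = 2 * \<kappa>\<^sup>2 * ?r b" by (simp add: power2_eq_square[of \<kappa>])
    finally show ?thesis .
  qed
  have E: "norm (?E - ?F) \<le> 4 * \<kappa> * ?r c"
  proof -
    have "norm (?E - ?F) \<le> norm ?E + norm ?F" by (rule norm_triangle_ineq4)
    also have "\<dots> \<le> (norm (transpose (fst \<delta>) ** fst \<theta>) + norm (transpose (fst \<theta>) ** fst \<delta>))
       + (norm (transpose (snd \<delta>) ** outer (fst c) ** snd \<theta>) + norm (transpose (snd \<theta>) ** outer (fst c) ** snd \<delta>))"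
      by (intro add_mono norm_triangle_ineq)
    also have "\<dots> \<le> (1 * \<kappa> + \<kappa> * 1) + (1 * ?r c * \<kappa> + \<kappa> * ?r c * 1)" by (intro add_mono norm_matrix_mult_mono A tA o d td)
    also have "\<dots> \<le> 4 * \<kappa> * ?r c" using mult_left_mono[OF r1[of c] \<kappa>] by (simp add: mult_ac)
    finally show ?thesis .
  qed
  have X: "norm (outer (fst s) ** ?D ** outer (fst a)) \<le> ?r s * (2 * \<kappa>\<^sup>2 * ?r b) * ?r a" by (intro norm_matrix_mult_mono o D)
  have "\<bar>reg_form \<theta> \<delta> (outer (fst s)) (outer (fst a)) (outer (fst b)) (outer (fst c))\<bar>
      = 1 / 4 * \<bar>(outer (fst s) ** ?D ** outer (fst a)) \<bullet> (?E - ?F)\<bar>"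
    unfolding reg_form_def by (simp add: abs_mult)
  also have "\<dots> \<le> 1 / 4 * ((?r s * (2 * \<kappa>\<^sup>2 * ?r b) * ?r a) * (4 * \<kappa> * ?r c))"
    using X E order_trans[OF norm_ge_zero X] by (intro mult_left_mono order_trans[OF Cauchy_Schwarz_ineq2] mult_mono) auto
  also have "\<dots> = 2 * \<kappa> ^ 3 * (?r s * ?r a * ?r b * ?r c)" by (simp add: power2_eq_square power3_eq_cube)
  also have "\<dots> \<le> 3 * (\<kappa> + 1) ^ 3 * (?r s * ?r a * ?r b * ?r c)"
    using \<kappa> by (intro mult_right_mono mult_mono power_mono) auto
  finally show ?thesis .
qed

locale attention_model =
  fixes M :: "real^'d^'p" and S :: "real^'d^'d" and \<Omega> :: "real^'p^'p"
  assumes psd_S: "psd_mat S" and invertible_S: "invertible S"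
begin

definition R :: "real^'d^'d" where "R = msqrt S"

definition q :: "(real^'d) \<times> (real^'p) \<Rightarrow> real" where
  "q s = (norm (matrix_inv R *v fst s))\<^sup>2 + (norm (snd s - M *v fst s))\<^sup>2 / (1 + (norm (msqrt \<Omega>))\<^sup>2)"

definition \<phi> :: "(real^'d) \<times> (real^'p) \<Rightarrow> real" where
  "\<phi> s = exp (q s / 128)"

lemma R_sym: "transpose R = R" and R_sq: "R ** R = S"
  using msqrt_psd[OF psd_S] by (auto simp: R_def psd_mat_def)

lemma invertible_R: "invertible R"
proof -
  obtain S' where "S ** S' = mat 1" using invertible_S by (auto simp: invertible_def)
  then have "R ** (R ** S') = mat 1" by (simp add: matrix_mul_assoc R_sq)
  then show ?thesis using invertible_right_inverse by blast
qed

lemma R_inv: "R ** matrix_inv R = mat 1" "matrix_inv R ** R = mat 1"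
proof -
  have "R ** matrix_inv R = mat 1 \<and> matrix_inv R ** R = mat 1"
    unfolding matrix_inv_def by (rule someI_ex[OF invertible_R[unfolded invertible_def]])
  then show "R ** matrix_inv R = mat 1" "matrix_inv R ** R = mat 1" by auto
qed

lemma R_inv_vec: "R *v (matrix_inv R *v x) = x" "matrix_inv R *v (R *v x) = x"
  by (simp_all add: matrix_vector_mul_assoc R_inv)

lemma q_nonneg: "0 \<le> q s" by (simp add: q_def add_nonneg_pos)

lemma q_ge: "(norm (matrix_inv R *v fst s))\<^sup>2 \<le> q s"
  by (simp add: q_def add_nonneg_pos)

lemma measurable_fst_snd_borel [measurable]:
  "(fst :: (real^'d) \<times> (real^'p) \<Rightarrow> _) \<in> borel_measurable borel"
  "(snd :: (real^'d) \<times> (real^'p) \<Rightarrow> _) \<in> borel_measurable borel"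
  by (simp_all add: borel_prod[symmetric])

lemma measurable_\<phi> [measurable]: "\<phi> \<in> borel_measurable borel"
  unfolding \<phi>_def q_def by measurable

lemma \<phi>_ge1: "1 \<le> \<phi> s" using q_nonneg by (simp add: \<phi>_def)

lemma \<phi>_power: "\<phi> s ^ k = exp (real k * q s / 128)"
  by (simp add: \<phi>_def exp_of_nat_mult[symmetric])

lemma integrable_\<phi>_power: "integrable (sample_dist M S \<Omega>) (\<lambda>s. \<phi> s ^ 63)"
proof -
  have m: "(\<lambda>s. \<phi> s ^ 63) \<in> borel_measurable borel" by measurable
  show ?thesis unfolding integral_sample_dist(2)[OF m]
  proof (rule integrable_pair_std_gauss_bound[where c = "63/128" and C = 1])
    let ?h = "\<lambda>(g, u). (msqrt S *v g, M *v (msqrt S *v g) + msqrt \<Omega> *v u)"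
    have "(\<lambda>z. \<phi> (?h z) ^ 63) \<in> borel_measurable (std_gauss \<Otimes>\<^sub>M std_gauss)"
      by (rule measurable_compose[OF measurable_sample_map m])
    then show "(\<lambda>(g, u). \<phi> (msqrt S *v g, M *v (msqrt S *v g) + msqrt \<Omega> *v u) ^ 63) \<in> borel_measurable (std_gauss \<Otimes>\<^sub>M std_gauss)"
      by (simp add: split_beta')
    fix g :: "real^'d" and u :: "real^'p"
    let ?c = "1 + (norm (msqrt \<Omega>))\<^sup>2"
    have c: "0 < ?c" by (simp add: add_pos_nonneg)
    have "(norm (msqrt \<Omega> *v u))\<^sup>2 \<le> (norm (msqrt \<Omega>) * norm u)\<^sup>2"
      by (intro power_mono norm_matrix_vector_mult_le norm_ge_zero)
    also have "\<dots> \<le> ?c * (norm u)\<^sup>2" by (simp add: power_mult_distrib distrib_right)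
    finally have "(norm (msqrt \<Omega> *v u))\<^sup>2 / ?c \<le> (norm u)\<^sup>2" using c by (simp add: pos_divide_le_eq mult.commute)
    then have "q (msqrt S *v g, M *v (msqrt S *v g) + msqrt \<Omega> *v u) \<le> (norm g)\<^sup>2 + (norm u)\<^sup>2"
      unfolding q_def by (simp add: R_def[symmetric] R_inv_vec)
    then show "\<bar>(\<lambda>(g, u). \<phi> (msqrt S *v g, M *v (msqrt S *v g) + msqrt \<Omega> *v u) ^ 63) (g, u)\<bar> \<le> 1 * exp (63 / 128 * ((norm g)\<^sup>2 + (norm u)\<^sup>2))"
      unfolding \<phi>_power by simp
  qed simp
qed

lemma poly_le_\<phi>: "\<exists>K1\<ge>0. \<forall>s. (1 + norm s)\<^sup>2 \<le> K1 * \<phi> s"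
proof -
  define c where "c = 1 + (norm (msqrt \<Omega>))\<^sup>2"
  define \<kappa> where "\<kappa> = norm R + (sqrt c + norm M * norm R)"
  have c: "0 < c" by (simp add: c_def add_pos_nonneg)
  have \<kappa>: "0 \<le> \<kappa>" using c by (simp add: \<kappa>_def)
  have "(1 + norm s)\<^sup>2 \<le> (2 + 256 * \<kappa>\<^sup>2) * \<phi> s" for s :: "(real^'d) \<times> (real^'p)"
  proof -
    have qx: "norm (matrix_inv R *v fst s) \<le> sqrt (q s)" using q_ge by (rule real_le_rsqrt)
    have "norm (fst s) = norm (R *v (matrix_inv R *v fst s))" by (simp add: R_inv_vec)
    also have "\<dots> \<le> norm R * sqrt (q s)"
      by (rule order_trans[OF norm_matrix_vector_mult_le mult_left_mono[OF qx norm_ge_zero]])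
    finally have x: "norm (fst s) \<le> norm R * sqrt (q s)" .
    have "(norm (snd s - M *v fst s))\<^sup>2 / c \<le> q s" by (simp add: q_def c_def)
    then have "(norm (snd s - M *v fst s))\<^sup>2 \<le> c * q s" using c by (simp add: pos_divide_le_eq mult.commute)
    then have z: "norm (snd s - M *v fst s) \<le> sqrt c * sqrt (q s)"
      unfolding real_sqrt_mult[symmetric] by (rule real_le_rsqrt)
    have "norm (snd s) \<le> norm (snd s - M *v fst s) + norm (M *v fst s)"
      using norm_triangle_ineq[of "snd s - M *v fst s" "M *v fst s"] by simp
    also have "\<dots> \<le> sqrt c * sqrt (q s) + norm M * (norm R * sqrt (q s))"
      using x by (intro add_mono z order_trans[OF norm_matrix_vector_mult_le] mult_left_mono) auto
    finally have y: "norm (snd s) \<le> sqrt c * sqrt (q s) + norm M * (norm R * sqrt (q s))" .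
    have "norm s \<le> norm (fst s) + norm (snd s)"
      unfolding norm_prod_def by (rule sqrt_sum_squares_le_sum) auto
    also have "\<dots> \<le> \<kappa> * sqrt (q s)" using add_mono[OF x y] by (simp add: \<kappa>_def distrib_right mult.assoc)
    finally have n: "norm s \<le> \<kappa> * sqrt (q s)" .
    have "(1 + norm s)\<^sup>2 \<le> 2 + 2 * (norm s)\<^sup>2"
      using sum_squares_bound[of 1 "norm s"] by (simp add: power2_eq_square algebra_simps)
    also have "(norm s)\<^sup>2 \<le> (\<kappa> * sqrt (q s))\<^sup>2" using n by (intro power_mono) auto
    also have "\<dots> = \<kappa>\<^sup>2 * q s" using q_nonneg by (simp add: power_mult_distrib)
    finally have 1: "(1 + norm s)\<^sup>2 \<le> 2 + 2 * (\<kappa>\<^sup>2 * q s)" by simp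
    have e: "1 \<le> \<phi> s" by (rule \<phi>_ge1)
    have "q s / 128 \<le> \<phi> s" unfolding \<phi>_def using exp_ge_add_one_self[of "q s / 128"] by linarith
    then have "\<kappa>\<^sup>2 * q s \<le> \<kappa>\<^sup>2 * (128 * \<phi> s)" by (intro mult_left_mono) auto
    then have "2 + 2 * (\<kappa>\<^sup>2 * q s) \<le> 2 * \<phi> s + 2 * (\<kappa>\<^sup>2 * (128 * \<phi> s))" using e by linarith
    also have "\<dots> = (2 + 256 * \<kappa>\<^sup>2) * \<phi> s" by (simp add: algebra_simps)
    finally show ?thesis using 1 by linarith
  qed
  then show ?thesis by (intro exI[of _ "2 + 256 * \<kappa>\<^sup>2"]) auto
qed

definition K1 :: real where "K1 = (SOME K. 0 \<le> K \<and> (\<forall>s. (1 + norm s)\<^sup>2 \<le> K * \<phi> s))"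

lemma K1: "0 \<le> K1" "(1 + norm s)\<^sup>2 \<le> K1 * \<phi> s"
proof -
  have "0 \<le> K1 \<and> (\<forall>s. (1 + norm s)\<^sup>2 \<le> K1 * \<phi> s)"
    unfolding K1_def by (rule someI_ex[OF poly_le_\<phi>])
  then show "0 \<le> K1" "(1 + norm s)\<^sup>2 \<le> K1 * \<phi> s" by blast+
qed

lemma poly_prod_le_\<phi>:
  assumes C: "0 \<le> C"
    and v: "\<bar>v\<bar> \<le> C * ((1 + norm s)\<^sup>2 * (1 + norm a)\<^sup>2 * (1 + norm b)\<^sup>2 * (1 + norm c)\<^sup>2)"
  shows "\<bar>v\<bar> \<le> (C * K1 ^ 4) * \<phi> s * \<phi> a * \<phi> b * \<phi> c"
proof -
  have p: "0 \<le> \<phi> s" for s using \<phi>_ge1[of s] by simp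
  note v
  also have "C * ((1 + norm s)\<^sup>2 * (1 + norm a)\<^sup>2 * (1 + norm b)\<^sup>2 * (1 + norm c)\<^sup>2)
      \<le> C * ((K1 * \<phi> s) * (K1 * \<phi> a) * (K1 * \<phi> b) * (K1 * \<phi> c))"
    using C p K1(1) by (intro mult_left_mono mult_mono K1(2)) auto
  also have "\<dots> = (C * K1 ^ 4) * \<phi> s * \<phi> a * \<phi> b * \<phi> c" by (simp add: eval_nat_numeral mult_ac)
  finally show ?thesis .
qed

lemma weight_bound:
  assumes B: "\<And>g. norm (R *v (B *v (R *v g))) \<le> norm g / 16"
  shows "\<bar>fst s \<bullet> (B *v fst a)\<bar> \<le> (q s + q a) / 32"
proof -
  let ?g = "matrix_inv R *v fst s" and ?h = "matrix_inv R *v fst a"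
  have "fst s \<bullet> (B *v fst a) = (R *v ?g) \<bullet> (B *v (R *v ?h))" by (simp add: R_inv_vec)
  also have "\<dots> = ?g \<bullet> (R *v (B *v (R *v ?h)))" by (rule inner_symmetric_matrix[OF R_sym, symmetric])
  finally have "\<bar>fst s \<bullet> (B *v fst a)\<bar> \<le> norm ?g * norm (R *v (B *v (R *v ?h)))"
    using Cauchy_Schwarz_ineq2 by simp
  also have "\<dots> \<le> norm ?g * (norm ?h / 16)" by (intro mult_left_mono B) simp
  also have "\<dots> = (2 * norm ?g * norm ?h) / 32" by simp
  also have "\<dots> \<le> ((norm ?g)\<^sup>2 + (norm ?h)\<^sup>2) / 32"
    by (rule divide_right_mono[OF sum_squares_bound]) simp
  also have "\<dots> \<le> (q s + q a) / 32" using q_ge[of s] q_ge[of a] by simp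
  finally show ?thesis .
qed

end

lemma measure_std_gauss_UNIV: "measure std_gauss UNIV = 1"
  using prob_space.prob_space[OF prob_space_std_gauss] by simp

context attention_model
begin

abbreviation N where "N \<equiv> sample_dist M S \<Omega>"

abbreviation attn_w :: "('d, 'p) param \<Rightarrow> _" where
  "attn_w \<theta> \<equiv> \<lambda>s a :: (real^'d) \<times> (real^'p). exp (fst s \<bullet> (snd \<theta> *v fst a))"

abbreviation loss_H :: "('d, 'p) param \<Rightarrow> _" where
  "loss_H \<theta> \<delta> \<equiv> \<lambda>s a b c :: (real^'d) \<times> (real^'p). loss_form \<theta> \<delta> s (fst a) (fst b) (fst c)"

abbreviation reg_H :: "('d, 'p) param \<Rightarrow> _" where
  "reg_H \<theta> \<delta> \<equiv> \<lambda>s a b c :: (real^'d) \<times> (real^'p).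
     reg_form \<theta> \<delta> (outer (fst s)) (outer (fst a)) (outer (fst b)) (outer (fst c))"

definition bias_const :: "real \<Rightarrow> real" where "bias_const \<kappa> = 3 * (\<kappa> + 1) ^ 3 * K1 ^ 4"

lemma loss_statistic:
  fixes \<theta> \<delta> :: "('d, 'p) param"
  assumes B: "\<And>g. norm (R *v (snd \<theta> *v (R *v g))) \<le> norm g / 16"
    and \<theta>: "norm (fst \<theta>) \<le> \<kappa>" and \<kappa>: "0 \<le> \<kappa>" and \<delta>: "norm \<delta> \<le> 1"
  shows "weighted_statistic N (attn_w \<theta>) \<phi>
    (loss_H \<theta> \<delta>) (bias_const \<kappa>)"
proof -
  interpret prob_space N by (rule prob_space_sample_dist)
    show ?thesis
  proof
    show "(\<lambda>(s, a). exp (fst s \<bullet> (snd \<theta> *v fst a))) \<in> borel_measurable (N \<Otimes>\<^sub>M N)" by measurable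
    show "\<phi> \<in> borel_measurable N" by measurable
    show "(\<lambda>(s, a, b, c). loss_form \<theta> \<delta> s (fst a) (fst b) (fst c)) \<in> borel_measurable (N \<Otimes>\<^sub>M N \<Otimes>\<^sub>M N \<Otimes>\<^sub>M N)"
      unfolding loss_form_def by measurable
    fix s a b c :: "(real^'d) \<times> (real^'p)"
    have w: "\<bar>fst s \<bullet> (snd \<theta> *v fst a)\<bar> \<le> (q s + q a) / 32" by (rule weight_bound[OF B])
    have ff: "\<phi> s ^ 4 * \<phi> a ^ 4 = exp ((q s + q a) / 32)"
      unfolding \<phi>_power exp_add[symmetric] by (simp add: add_divide_distrib)
    show "exp (fst s \<bullet> (snd \<theta> *v fst a)) \<le> \<phi> s ^ 4 * \<phi> a ^ 4" unfolding ff using w by simp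
    show "1 / exp (fst s \<bullet> (snd \<theta> *v fst a)) \<le> \<phi> s ^ 4 * \<phi> a ^ 4"
      unfolding ff inverse_eq_divide[symmetric] exp_minus[symmetric] using w by simp
    show "\<bar>loss_form \<theta> \<delta> s (fst a) (fst b) (fst c)\<bar> \<le> bias_const \<kappa> * \<phi> s * \<phi> a * \<phi> b * \<phi> c"
      unfolding bias_const_def using \<kappa> by (intro poly_prod_le_\<phi> loss_form_bound[OF \<theta> \<delta> \<kappa>]) auto
    have "(\<integral>a. exp (fst s \<bullet> (snd \<theta> *v fst a)) * 1 \<partial>N)
      = exp ((norm (msqrt S *v (transpose (snd \<theta>) *v fst s)))\<^sup>2 / 2) * (\<integral>g. 1 \<partial>(std_gauss :: (real^'d) measure))"
      by (rule integral_exp_sample_dist[OF psd_S]) simp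
    then show "1 \<le> (\<integral>a. exp (fst s \<bullet> (snd \<theta> *v fst a)) \<partial>N)" by (simp add: measure_std_gauss_UNIV)
    show "integrable N (\<lambda>s. \<phi> s ^ 63)" by (rule integrable_\<phi>_power)
  qed (auto simp: \<phi>_ge1)
qed

lemma reg_statistic:
  fixes \<theta> \<delta> :: "('d, 'p) param"
  assumes \<theta>: "norm (fst \<theta>) \<le> \<kappa>" "norm (snd \<theta>) \<le> \<kappa>" and \<kappa>: "0 \<le> \<kappa>" and \<delta>: "norm \<delta> \<le> 1"
  shows "weighted_statistic N (\<lambda>s a. 1) \<phi>
    (reg_H \<theta> \<delta>) (bias_const \<kappa>)"
proof -
  interpret prob_space N by (rule prob_space_sample_dist)
    show ?thesis
  proof
    show "\<phi> \<in> borel_measurable N" by measurable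
    show "(\<lambda>(s, a, b, c). reg_form \<theta> \<delta> (outer (fst s)) (outer (fst a)) (outer (fst b)) (outer (fst c)))
        \<in> borel_measurable (N \<Otimes>\<^sub>M N \<Otimes>\<^sub>M N \<Otimes>\<^sub>M N)"
      unfolding reg_form_def by measurable
    fix s a b c :: "(real^'d) \<times> (real^'p)"
    have "1 * 1 \<le> \<phi> s ^ 4 * \<phi> a ^ 4" using \<phi>_ge1 by (intro mult_mono one_le_power) auto
    then show "1 \<le> \<phi> s ^ 4 * \<phi> a ^ 4" "1 / 1 \<le> \<phi> s ^ 4 * \<phi> a ^ 4" by simp_all
    show "\<bar>reg_form \<theta> \<delta> (outer (fst s)) (outer (fst a)) (outer (fst b)) (outer (fst c))\<bar> \<le> bias_const \<kappa> * \<phi> s * \<phi> a * \<phi> b * \<phi> c"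
      unfolding bias_const_def using \<kappa> by (intro poly_prod_le_\<phi> reg_form_bound[OF \<theta> \<delta> \<kappa>]) auto
    show "integrable N (\<lambda>s. \<phi> s ^ 63)" by (rule integrable_\<phi>_power)
    show "1 \<le> (\<integral>a. (1::real) \<partial>N)" using prob_space by simp
  qed (auto simp: \<phi>_ge1)
qed

lemma reg_population:
  fixes \<theta> \<delta> :: "('d, 'p) param"
  assumes "weighted_statistic N (\<lambda>s a. 1) \<phi>
    (reg_H \<theta> \<delta>) K"
  shows "(\<integral>s. weighted_statistic.H3 N (\<lambda>s a. 1)
      (reg_H \<theta> \<delta>) s \<partial>N)
    = reg_form \<theta> \<delta> S S S S"
proof -
  interpret weighted_statistic N "\<lambda>s a. 1" \<phi>
    "reg_H \<theta> \<delta>" K by fact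
  have m: "mean_w s = 1" for s unfolding mean_w_def using prob_space by simp
  have int: "(\<integral>a. f (outer (fst a)) \<partial>N) = f S" if f: "affine_form f" for f
  proof -
    obtain c L where fe: "f = (\<lambda>X. c + X \<bullet> L)" using f by (auto simp: affine_form_def)
    have [measurable]: "(\<lambda>x. f (outer x)) \<in> borel_measurable borel" unfolding fe by measurable
    have "(\<integral>a. f (outer (fst a)) \<partial>N) = (\<integral>g. f (outer (msqrt S *v g)) \<partial>std_gauss)"
      by (rule integral_sample_dist_fst) measurable
    then show ?thesis by (simp only: affine_form_gauss[OF f psd_S])
  qed
  have 1: "H1 s b c = reg_form \<theta> \<delta> (outer (fst s)) S (outer (fst b)) (outer (fst c))" for s b c
    unfolding H1_def m by (simp only: div_by_1 mult_1 int[OF reg_form_affine(2)])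
  have 2: "H2 s c = reg_form \<theta> \<delta> (outer (fst s)) S S (outer (fst c))" for s c
    unfolding H2_def m 1 by (simp only: div_by_1 mult_1 int[OF reg_form_affine(3)])
  have 3: "H3 s = reg_form \<theta> \<delta> (outer (fst s)) S S S" for s
    unfolding H3_def m 2 by (simp only: div_by_1 mult_1 int[OF reg_form_affine(4)])
  show ?thesis unfolding 3 by (rule int[OF reg_form_affine(1)])
qed

lemma loss_population:
  fixes \<theta> \<delta> :: "('d, 'p) param"
  assumes "weighted_statistic N (attn_w \<theta>) \<phi>
    (loss_H \<theta> \<delta>) K"
  shows "(\<integral>s. weighted_statistic.H3 N (attn_w \<theta>)
      (loss_H \<theta> \<delta>) s \<partial>N)
    = ((fst \<theta> ** S ** transpose (snd \<theta>) - M) ** R)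
     \<bullet> ((fst \<delta> ** S ** transpose (snd \<theta>) + fst \<theta> ** S ** transpose (snd \<delta>)) ** R)"
proof -
    interpret weighted_statistic N "attn_w \<theta>" \<phi>
    "loss_H \<theta> \<delta>" K by fact
  define A B \<delta>A \<delta>B where "A = fst \<theta>" and "B = snd \<theta>" and "\<delta>A = fst \<delta>" and "\<delta>B = snd \<delta>"
  define \<mu> where "\<mu> = (\<lambda>s :: (real^'d) \<times> (real^'p). S *v (transpose B *v fst s))"
  have tilt: "(\<integral>a. exp (fst s \<bullet> (snd \<theta> *v fst a)) / mean_w s * f (fst a) \<partial>N) = (\<integral>g. f (R *v g + \<mu> s) \<partial>std_gauss)"
    if f: "f \<in> borel_measurable borel" for f s
  proof -
    let ?Z = "exp ((norm (msqrt S *v (transpose (snd \<theta>) *v fst s)))\<^sup>2 / 2)"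
    have "(\<integral>a. exp (fst s \<bullet> (snd \<theta> *v fst a)) * 1 \<partial>N) = ?Z * (\<integral>g. 1 \<partial>(std_gauss :: (real^'d) measure))"
      by (rule integral_exp_sample_dist[OF psd_S]) simp
    then have mw: "mean_w s = ?Z" by (simp add: mean_w_def measure_std_gauss_UNIV)
    have "(\<integral>a. exp (fst s \<bullet> (snd \<theta> *v fst a)) / mean_w s * f (fst a) \<partial>N)
        = (1 / mean_w s) * (\<integral>a. exp (fst s \<bullet> (snd \<theta> *v fst a)) * f (fst a) \<partial>N)"
      by simp
    also have "\<dots> = (1 / mean_w s) * (?Z * (\<integral>g. f (R *v g + \<mu> s) \<partial>std_gauss))"
      unfolding integral_exp_sample_dist[OF psd_S f] R_def \<mu>_def B_def ..
    finally show ?thesis unfolding mw by simp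
  qed
  have RtA: "v \<bullet> (X *v (R *v g)) = (R *v (transpose X *v v)) \<bullet> g" for X :: "real^'d^'p" and v g
    unfolding R_def by (rule inner_query_key[OF psd_S])
  have RtB: "v \<bullet> (X *v (R *v g)) = (R *v (transpose X *v v)) \<bullet> g" for X :: "real^'d^'d" and v g
    unfolding R_def by (rule inner_query_key[OF psd_S])
  have meas: "(\<lambda>a. loss_form \<theta> \<delta> s a b c) \<in> borel_measurable borel" "(\<lambda>b. loss_form \<theta> \<delta> s a b c) \<in> borel_measurable borel" for s a b c
    unfolding loss_form_def by measurable
  have 1: "H1 s b c = loss_form \<theta> \<delta> s (\<mu> s) (fst b) (fst c)" for s b c
  proof -
    define k where "k = fst s \<bullet> (\<delta>B *v (fst b - fst c))"
    define p where "p = R *v (transpose A *v (\<delta>A *v fst b + k *\<^sub>R (A *v fst b)))"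
    have "H1 s b c = (\<integral>g. loss_form \<theta> \<delta> s (R *v g + \<mu> s) (fst b) (fst c) \<partial>std_gauss)"
      unfolding H1_def by (rule tilt[OF meas(1)])
    also have "(\<lambda>g. loss_form \<theta> \<delta> s (R *v g + \<mu> s) (fst b) (fst c)) = (\<lambda>g. loss_form \<theta> \<delta> s (\<mu> s) (fst b) (fst c) + p \<bullet> g)"
    proof (rule ext)
      fix g
      have "(A *v (R *v g)) \<bullet> (\<delta>A *v fst b + k *\<^sub>R (A *v fst b)) = p \<bullet> g"
        unfolding p_def RtA[symmetric] by (rule inner_commute)
      then have pg: "(A *v (R *v g)) \<bullet> (\<delta>A *v fst b) + k * ((A *v (R *v g)) \<bullet> (A *v fst b)) = p \<bullet> g"
        by (simp only: inner_add_right inner_scaleR_right)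
      have av: "A *v (R *v g + \<mu> s) - snd s = A *v (R *v g) + (A *v \<mu> s - snd s)"
        by (simp only: matrix_vector_right_distrib add_diff_eq)
      show "loss_form \<theta> \<delta> s (R *v g + \<mu> s) (fst b) (fst c) = loss_form \<theta> \<delta> s (\<mu> s) (fst b) (fst c) + p \<bullet> g"
        unfolding loss_form_def A_def[symmetric] \<delta>A_def[symmetric] \<delta>B_def[symmetric] k_def[symmetric] av
          inner_add_left pg[symmetric] by (simp only: distrib_right mult.commute[of k] add_ac)
    qed
    finally show ?thesis unfolding std_gauss_linear_moments(2) .
  qed
  define v where "v = (\<lambda>s :: (real^'d) \<times> (real^'p). A *v \<mu> s - snd s)"
  define p2 where "p2 = (\<lambda>s. R *v (transpose A *v v s))"
  define k2 where "k2 = (\<lambda>s :: (real^'d) \<times> (real^'p). R *v (transpose \<delta>B *v fst s))"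
  have 2: "H2 s c = (v s \<bullet> (\<delta>A *v \<mu> s) + p2 s \<bullet> k2 s) + (v s \<bullet> (A *v \<mu> s)) * (fst s \<bullet> (\<delta>B *v (\<mu> s - fst c)))" for s c
  proof -
    define p1 where "p1 = R *v (transpose \<delta>A *v v s)"
    have "H2 s c = (\<integral>g. loss_form \<theta> \<delta> s (\<mu> s) (R *v g + \<mu> s) (fst c) \<partial>std_gauss)"
      unfolding H2_def 1 by (rule tilt[OF meas(2)])
    also have "(\<lambda>g. loss_form \<theta> \<delta> s (\<mu> s) (R *v g + \<mu> s) (fst c))
       = (\<lambda>g. (v s \<bullet> (\<delta>A *v \<mu> s) + p1 \<bullet> g) + (v s \<bullet> (A *v \<mu> s) + p2 s \<bullet> g) * (fst s \<bullet> (\<delta>B *v (\<mu> s - fst c)) + k2 s \<bullet> g))"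
    proof (rule ext)
      fix g
      have dist: "R *v g + \<mu> s - fst c = R *v g + (\<mu> s - fst c)" by (rule add_diff_eq[symmetric])
      show "loss_form \<theta> \<delta> s (\<mu> s) (R *v g + \<mu> s) (fst c)
        = (v s \<bullet> (\<delta>A *v \<mu> s) + p1 \<bullet> g) + (v s \<bullet> (A *v \<mu> s) + p2 s \<bullet> g) * (fst s \<bullet> (\<delta>B *v (\<mu> s - fst c)) + k2 s \<bullet> g)"
        unfolding loss_form_def A_def[symmetric] \<delta>A_def[symmetric] \<delta>B_def[symmetric] dist matrix_vector_right_distrib
          inner_add_right p1_def p2_def k2_def RtA[symmetric] RtB[symmetric]
        by (simp only: v_def add.commute)
    qed
    also have "(\<integral>g. (v s \<bullet> (\<delta>A *v \<mu> s) + p1 \<bullet> g) + (v s \<bullet> (A *v \<mu> s) + p2 s \<bullet> g) * (fst s \<bullet> (\<delta>B *v (\<mu> s - fst c)) + k2 s \<bullet> g) \<partial>std_gauss)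
      = v s \<bullet> (\<delta>A *v \<mu> s) + ((v s \<bullet> (A *v \<mu> s)) * (fst s \<bullet> (\<delta>B *v (\<mu> s - fst c))) + p2 s \<bullet> k2 s)"
      unfolding Bochner_Integration.integral_add[OF std_gauss_linear_moments(1,3)] std_gauss_linear_moments(2,4) ..
    finally show ?thesis by (simp only: add_ac)
  qed
  have 3: "H3 s = v s \<bullet> ((\<delta>A ** S ** transpose B + A ** S ** transpose \<delta>B) *v fst s)" for s
  proof -
    define \<alpha> where "\<alpha> = v s \<bullet> (\<delta>A *v \<mu> s) + p2 s \<bullet> k2 s"
    define \<beta> where "\<beta> = v s \<bullet> (A *v \<mu> s)"
    have "(\<lambda>c. \<alpha> + \<beta> * (fst s \<bullet> (\<delta>B *v (\<mu> s - c)))) \<in> borel_measurable borel" by measurable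
    then have "H3 s = (\<integral>g. \<alpha> + \<beta> * (fst s \<bullet> (\<delta>B *v (\<mu> s - (R *v g + \<mu> s)))) \<partial>std_gauss)"
      unfolding H3_def 2 \<alpha>_def[symmetric] \<beta>_def[symmetric] by (rule tilt)
    also have "(\<lambda>g. \<alpha> + \<beta> * (fst s \<bullet> (\<delta>B *v (\<mu> s - (R *v g + \<mu> s))))) = (\<lambda>g. \<alpha> + (- \<beta> *\<^sub>R k2 s) \<bullet> g)"
    proof (rule ext)
      fix g
      have "\<mu> s - (R *v g + \<mu> s) = - (R *v g)" by simp
      then have "\<delta>B *v (\<mu> s - (R *v g + \<mu> s)) = - (\<delta>B *v (R *v g))"
        using matrix_vector_mult_scaleR[of \<delta>B "-1" "R *v g"] by simp
      then show "\<alpha> + \<beta> * (fst s \<bullet> (\<delta>B *v (\<mu> s - (R *v g + \<mu> s)))) = \<alpha> + (- \<beta> *\<^sub>R k2 s) \<bullet> g"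
        by (simp only: inner_minus_right inner_scaleR_left k2_def RtB[symmetric] mult_minus_left mult_minus_right)
    qed
    finally have "H3 s = \<alpha>" unfolding std_gauss_linear_moments(2) .
    moreover have "p2 s \<bullet> k2 s = v s \<bullet> (A *v (S *v (transpose \<delta>B *v fst s)))"
    proof -
      have "p2 s \<bullet> k2 s = v s \<bullet> (A *v (R *v (R *v (transpose \<delta>B *v fst s))))"
        unfolding p2_def k2_def by (rule RtA[symmetric])
      then show ?thesis by (simp only: matrix_vector_mul_assoc[of R R] R_sq)
    qed
    ultimately show ?thesis
      unfolding \<alpha>_def \<mu>_def
      by (simp only: inner_add_right matrix_vector_mult_add_rdistrib matrix_vector_mul_assoc matrix_mul_assoc)
  qed
  let ?X = "(A ** S ** transpose B - M) ** R"
  let ?Y = "(\<delta>A ** S ** transpose B + A ** S ** transpose \<delta>B) ** R"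
  have m3: "H3 \<in> borel_measurable borel" using measurable_H3 by simp
  have "(\<integral>s. H3 s \<partial>N) = (\<integral>(g, u). H3 (R *v g, M *v (R *v g) + msqrt \<Omega> *v u) \<partial>(std_gauss \<Otimes>\<^sub>M std_gauss))"
    unfolding R_def by (rule integral_sample_dist(1)[OF m3])
  also have "(\<lambda>(g, u). H3 (R *v g, M *v (R *v g) + msqrt \<Omega> *v u)) = (\<lambda>(g, u). (?X *v g - msqrt \<Omega> *v u) \<bullet> (?Y *v g - (0 :: real^'p^'p) *v u))"
  proof (intro ext, clarify)
    fix g :: "real^'d" and u :: "real^'p"
    have "v (R *v g, M *v (R *v g) + msqrt \<Omega> *v u) = ?X *v g - msqrt \<Omega> *v u"
      unfolding v_def \<mu>_def fst_conv snd_conv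
      by (simp only: matrix_vector_mul_assoc[symmetric] matrix_vector_mult_diff_rdistrib diff_diff_eq)
    moreover have "(\<delta>A ** S ** transpose B + A ** S ** transpose \<delta>B) *v (R *v g) = ?Y *v g - (0 :: real^'p^'p) *v u"
      by (simp add: matrix_vector_mul_assoc)
    ultimately show "H3 (R *v g, M *v (R *v g) + msqrt \<Omega> *v u) = (?X *v g - msqrt \<Omega> *v u) \<bullet> (?Y *v g - (0 :: real^'p^'p) *v u)"
      unfolding 3 by (simp only: fst_conv)
  qed
  finally show ?thesis unfolding pair_std_gauss_bilinear(2) A_def B_def \<delta>A_def \<delta>B_def by simp
qed

definition deriv_hat :: "nat \<Rightarrow> ('d, 'p) param \<Rightarrow> (nat \<Rightarrow> (real^'d) \<times> (real^'p)) \<Rightarrow> ('d, 'p) param \<Rightarrow> real" where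
  "deriv_hat n \<theta> s \<delta> = (1 / real n) * (\<Sum>i<n. \<Sum>j<n. \<Sum>k<n. \<Sum>l<n.
     exp (fst (s i) \<bullet> (snd \<theta> *v fst (s j))) * exp (fst (s i) \<bullet> (snd \<theta> *v fst (s k))) * exp (fst (s i) \<bullet> (snd \<theta> *v fst (s l)))
       / (\<Sum>t<n. exp (fst (s i) \<bullet> (snd \<theta> *v fst (s t)))) ^ 3 * loss_form \<theta> \<delta> (s i) (fst (s j)) (fst (s k)) (fst (s l)))
   + (1 / real n) * (\<Sum>i<n. \<Sum>j<n. \<Sum>k<n. \<Sum>l<n. 1 * 1 * 1 / (\<Sum>t<n. 1) ^ 3
       * reg_form \<theta> \<delta> (outer (fst (s i))) (outer (fst (s j))) (outer (fst (s k))) (outer (fst (s l))))"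

definition deriv_pop :: "('d, 'p) param \<Rightarrow> ('d, 'p) param \<Rightarrow> real" where
  "deriv_pop \<theta> \<delta> = ((fst \<theta> ** S ** transpose (snd \<theta>) - M) ** R)
     \<bullet> ((fst \<delta> ** S ** transpose (snd \<theta>) + fst \<theta> ** S ** transpose (snd \<delta>)) ** R) + reg_form \<theta> \<delta> S S S S"

lemma Qpop_has_derivative: "(Qpop M S \<Omega> has_derivative deriv_pop \<theta>) (at \<theta>)"
proof -
  have "Qpop M S \<Omega> = (\<lambda>\<theta>. pop_loss M S \<Omega> \<theta> + reg S \<theta>)" by (rule ext) (simp add: Qpop_def)
  then show ?thesis unfolding deriv_pop_def R_def
    using has_derivative_add[OF pop_loss_has_derivative[OF psd_S] reg_has_derivative[OF psd_S]] by simp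
qed

lemma psd_emp_cov: "psd_mat (emp_cov n s)"
proof -
  have "transpose (emp_cov n s) = emp_cov n s"
    unfolding emp_cov_def by (simp add: transpose_def vec_eq_iff outer_def mult.commute)
  moreover have "0 \<le> x \<bullet> (emp_cov n s *v x)" for x
  proof -
    have "x \<bullet> (emp_cov n s *v x) = emp_cov n s \<bullet> outer x"
      by (simp only: inner_commute[of "emp_cov n s"] inner_outer)
    also have "\<dots> = (1 / real n) * (\<Sum>i<n. (fst (s i) \<bullet> x)\<^sup>2)"
      unfolding emp_cov_def inner_scaleR_left inner_sum_left inner_outer outer_mult_vec
      by (simp add: inner_commute[of x] power2_eq_square)
    also have "0 \<le> \<dots>" by (simp add: sum_nonneg)
    finally show ?thesis .
  qed
  ultimately show ?thesis by (simp add: psd_mat_def)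
qed

lemma reg_form_emp_cov:
  assumes n: "0 < n"
  shows "reg_form \<theta> \<delta> (emp_cov n s) (emp_cov n s) (emp_cov n s) (emp_cov n s)
    = (1 / real n) * (\<Sum>i<n. \<Sum>j<n. \<Sum>k<n. \<Sum>l<n. 1 * 1 * 1 / (\<Sum>t<n. 1) ^ 3
       * reg_form \<theta> \<delta> (outer (fst (s i))) (outer (fst (s j))) (outer (fst (s k))) (outer (fst (s l))))"
proof -
  define C where "C = emp_cov n s"
  define o' where "o' = (\<lambda>i. outer (fst (s i)))"
  have C: "C = (1 / real n) *\<^sub>R (\<Sum>i<n. o' i)" by (simp add: C_def o'_def emp_cov_def)
  have avg: "f C = (1 / real n) * (\<Sum>i<n. f (o' i))" if "affine_form f" for f
    unfolding C by (rule affine_form_average[OF that n])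
  have "reg_form \<theta> \<delta> C C C C = (1 / real n) * (\<Sum>i<n. (1 / real n) * (\<Sum>j<n. (1 / real n) * (\<Sum>k<n. (1 / real n) * (\<Sum>l<n.
      reg_form \<theta> \<delta> (o' i) (o' j) (o' k) (o' l)))))"
    unfolding avg[OF reg_form_affine(1)]
    by (intro arg_cong[where f = "(*) (1 / real n)"] sum.cong refl trans[OF avg[OF reg_form_affine(2)]]
        trans[OF avg[OF reg_form_affine(3)]] avg[OF reg_form_affine(4)])
  also have "\<dots> = (1 / real n) * (\<Sum>i<n. \<Sum>j<n. \<Sum>k<n. \<Sum>l<n. (1 / real n) * ((1 / real n) * ((1 / real n) * reg_form \<theta> \<delta> (o' i) (o' j) (o' k) (o' l))))"
    unfolding sum_distrib_left ..
  finally show ?thesis unfolding C_def o'_def by (simp add: power3_eq_cube mult.assoc)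
qed

lemma Qhat_has_derivative:
  assumes n: "0 < n"
  shows "(Qhat n s has_derivative deriv_hat n \<theta> s) (at \<theta>)"
proof -
  have "Qhat n s = (\<lambda>\<theta>. emp_loss n s \<theta> + reg (emp_cov n s) \<theta>)" by (rule ext) (simp add: Qhat_def)
  moreover note has_derivative_add[OF emp_loss_has_derivative[OF n, of s \<theta>] reg_has_derivative[OF psd_emp_cov, of n s \<theta>]]
  moreover have "deriv_hat n \<theta> s = (\<lambda>\<delta>. deriv_hat n \<theta> s \<delta>)" ..
  ultimately show ?thesis unfolding deriv_hat_def[abs_def] reg_form_emp_cov[OF n] by (simp only:)
qed

lemma deriv_bias:
  assumes B: "\<And>g. norm (R *v (snd \<theta> *v (R *v g))) \<le> norm g / 16"
    and \<theta>: "norm (fst \<theta>) \<le> \<kappa>" "norm (snd \<theta>) \<le> \<kappa>" and \<kappa>: "0 \<le> \<kappa>" and \<delta>: "norm \<delta> \<le> 1"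
    and n: "8 \<le> n"
  shows "integrable (PiM {..<n} (\<lambda>_. N)) (\<lambda>s. deriv_hat n \<theta> s \<delta>)"
    and "\<bar>(\<integral>s. deriv_hat n \<theta> s \<delta> \<partial>PiM {..<n} (\<lambda>_. N)) - deriv_pop \<theta> \<delta>\<bar>
      \<le> 960 * bias_const \<kappa> * (\<integral>s. \<phi> s ^ 63 \<partial>N) ^ 8 / real n"
proof -
    let ?P = "PiM {..<n} (\<lambda>_. N)"
  note L = loss_statistic[OF B \<theta>(1) \<kappa> \<delta>]
  note Rg = reg_statistic[OF \<theta> \<kappa> \<delta>]
  let ?f = "weighted_statistic.statistic (attn_w \<theta>) (loss_H \<theta> \<delta>) n"
  let ?g = "weighted_statistic.statistic (\<lambda>s a. 1) (reg_H \<theta> \<delta>) n"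
  have eq: "(\<lambda>s. deriv_hat n \<theta> s \<delta>) = (\<lambda>s. ?f s + ?g s)"
    unfolding deriv_hat_def weighted_statistic.statistic_def[OF L] weighted_statistic.statistic_def[OF Rg] ..
  note f = weighted_statistic.statistic_bias[OF L n] and g = weighted_statistic.statistic_bias[OF Rg n]
  note f2 = f(2)[unfolded loss_population[OF L] weighted_statistic.L_def[OF L]]
    and g2 = g(2)[unfolded reg_population[OF Rg] weighted_statistic.L_def[OF Rg]]
  show "integrable ?P (\<lambda>s. deriv_hat n \<theta> s \<delta>)" unfolding eq by (rule Bochner_Integration.integrable_add[OF f(1) g(1)])
  let ?K = "bias_const \<kappa> * (\<integral>s. \<phi> s ^ 63 \<partial>N) ^ 8 / real n"
  have "\<bar>(\<integral>s. deriv_hat n \<theta> s \<delta> \<partial>?P) - deriv_pop \<theta> \<delta>\<bar> \<le> 480 * ?K + 480 * ?K"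
    unfolding eq Bochner_Integration.integral_add[OF f(1) g(1)] deriv_pop_def using f2 g2 by (simp add: mult.assoc)
  then show "\<bar>(\<integral>s. deriv_hat n \<theta> s \<delta> \<partial>?P) - deriv_pop \<theta> \<delta>\<bar>
      \<le> 960 * bias_const \<kappa> * (\<integral>s. \<phi> s ^ 63 \<partial>N) ^ 8 / real n" by (simp add: mult.assoc)
qed

lemma exp_grad_bias:
  assumes B: "\<And>g. norm (R *v (snd \<theta> *v (R *v g))) \<le> norm g / 16"
    and \<theta>: "norm (fst \<theta>) \<le> \<kappa>" "norm (snd \<theta>) \<le> \<kappa>" and \<kappa>: "0 \<le> \<kappa>"
    and n: "8 \<le> n"
  shows "norm (exp_grad_Qhat M S \<Omega> n \<theta> - grad (Qpop M S \<Omega>) \<theta>)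
    \<le> real (card (Basis :: ('d, 'p) param set)) * (960 * bias_const \<kappa> * (\<integral>s. \<phi> s ^ 63 \<partial>N) ^ 8) / real n"
proof -
  let ?P = "PiM {..<n} (\<lambda>_. N)"
  let ?K = "960 * bias_const \<kappa> * (\<integral>s. \<phi> s ^ 63 \<partial>N) ^ 8 / real n"
  have n0: "0 < n" using n by simp
  have nb: "norm b \<le> 1" if "b \<in> Basis" for b :: "('d, 'p) param" using that by simp
  note db = deriv_bias[OF B \<theta> \<kappa> nb n]
  have "exp_grad_Qhat M S \<Omega> n \<theta> = (\<integral>s. (\<Sum>b\<in>Basis. deriv_hat n \<theta> s b *\<^sub>R b) \<partial>?P)"
    unfolding exp_grad_Qhat_def grad_eq_sum_Basis[OF Qhat_has_derivative[OF n0]] ..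
  also have "\<dots> = (\<Sum>b\<in>Basis. \<integral>s. deriv_hat n \<theta> s b *\<^sub>R b \<partial>?P)"
    by (rule Bochner_Integration.integral_sum) (intro integrable_scaleR_left db(1))
  also have "\<dots> = (\<Sum>b\<in>Basis. (\<integral>s. deriv_hat n \<theta> s b \<partial>?P) *\<^sub>R b)"
    by (intro sum.cong refl integral_scaleR_left db(1))
  finally have "exp_grad_Qhat M S \<Omega> n \<theta> - grad (Qpop M S \<Omega>) \<theta>
      = (\<Sum>b\<in>Basis. ((\<integral>s. deriv_hat n \<theta> s b \<partial>?P) - deriv_pop \<theta> b) *\<^sub>R b)"
    unfolding grad_eq_sum_Basis[OF Qpop_has_derivative] by (simp only: sum_subtractf[symmetric] scaleR_diff_left)
  also have "norm \<dots> \<le> (\<Sum>b\<in>(Basis :: ('d, 'p) param set). ?K)"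
  proof (rule order_trans[OF norm_sum sum_mono])
    fix b :: "('d, 'p) param" assume b: "b \<in> Basis"
    then show "norm (((\<integral>s. deriv_hat n \<theta> s b \<partial>?P) - deriv_pop \<theta> b) *\<^sub>R b) \<le> ?K"
      using db(2)[OF b] by simp
  qed
  finally show ?thesis by simp
qed

end

lemma trace_transpose_mult: "trace (transpose X ** X) = X \<bullet> X" for X :: "real^'n^'m"
  unfolding trace_def matrix_matrix_mult_def transpose_def inner_vec_def
  by (simp add: inner_vec_def) (rule sum.swap)

lemma norm_isometry:
  fixes V :: "real^'n^'m"
  assumes "transpose V ** V = mat 1"
  shows "norm (V *v x) = norm x"
proof -
  have "(V *v x) \<bullet> (V *v x) = x \<bullet> x"
    using inner_matrix_transpose[of "V *v x" V x] assms by (simp add: matrix_vector_mul_assoc del: transpose_matrix_vector)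
  then show ?thesis by (simp add: norm_eq_sqrt_inner)
qed

lemma norm_orthogonal_matrix: "orthogonal_matrix J \<Longrightarrow> norm J = sqrt (real CARD('n))" for J :: "real^'n^'n"
  using trace_transpose_mult[of J] by (simp add: orthogonal_matrix norm_eq_sqrt_inner trace_def mat_def)

lemma norm_diag_sqrt_mult_le:
  fixes G :: "real^'n^'n"
  assumes G: "\<And>i. 0 < G $ i $ i"
  shows "norm (diag_sqrt G *v x) \<le> sqrt (Max (range (\<lambda>i. G $ i $ i))) * norm x"
proof (rule power2_le_imp_le)
  let ?m = "Max (range (\<lambda>i. G $ i $ i))"
  have m: "G $ i $ i \<le> ?m" for i by (intro Max_ge) auto
  have m0: "0 \<le> ?m" using m[of undefined] G[of undefined] by linarith
  have c: "(diag_sqrt G *v x) $ i = sqrt (G $ i $ i) * x $ i" for i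
  proof -
    have "(diag_sqrt G *v x) $ i = (\<Sum>j\<in>UNIV. if i = j then sqrt (G $ i $ i) * x $ j else 0)"
      unfolding diag_sqrt_def matrix_vector_mult_def by (simp add: if_distrib[of "\<lambda>y. y * _"] cong: if_cong)
    then show ?thesis by simp
  qed
  have "(norm (diag_sqrt G *v x))\<^sup>2 = (\<Sum>i\<in>UNIV. G $ i $ i * (x $ i)\<^sup>2)"
    unfolding power2_norm_eq_inner inner_vec_def c
    using G by (intro sum.cong refl) (simp add: power2_eq_square less_imp_le mult_ac flip: real_sqrt_mult)
  also have "\<dots> \<le> (\<Sum>i\<in>UNIV. ?m * (x $ i)\<^sup>2)" by (intro sum_mono mult_right_mono m) simp
  also have "\<dots> = (sqrt ?m * norm x)\<^sup>2"
    using m0 by (simp add: power_mult_distrib power2_norm_eq_inner[of x] inner_vec_def[of x] sum_distrib_left power2_eq_square[of "x $ _"])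
  finally show "(norm (diag_sqrt G *v x))\<^sup>2 \<le> (sqrt ?m * norm x)\<^sup>2" .
next
  have "0 \<le> Max (range (\<lambda>i. G $ i $ i))"
    by (rule order_trans[OF less_imp_le[OF G[of undefined]]]) (rule Max_ge, auto)
  then show "0 \<le> sqrt (Max (range (\<lambda>i. G $ i $ i))) * norm x" by simp
qed

context attention_model
begin

lemma Pnorm_bounds:
  fixes \<theta> :: "('d, 'p) param"
  assumes "Pnorm S \<theta> \<le> e"
  shows "norm (fst \<theta>) \<le> e" "norm (R ** snd \<theta>) \<le> e" "0 \<le> e"
proof -
  have "transpose (R ** snd \<theta>) ** (R ** snd \<theta>) = transpose (snd \<theta>) ** (R ** R) ** snd \<theta>"
    by (simp only: matrix_transpose_mul R_sym matrix_mul_assoc)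
  then have "transpose (snd \<theta>) ** S ** snd \<theta> = transpose (R ** snd \<theta>) ** (R ** snd \<theta>)"
    by (simp only: R_sq)
  then have P: "Pnorm S \<theta> = sqrt (fst \<theta> \<bullet> fst \<theta> + (R ** snd \<theta>) \<bullet> (R ** snd \<theta>))"
    unfolding Pnorm_def trace_add by (simp only: trace_transpose_mult)
  have "norm (fst \<theta>) \<le> Pnorm S \<theta>" "norm (R ** snd \<theta>) \<le> Pnorm S \<theta>" unfolding P norm_eq_sqrt_inner by simp_all
  then show "norm (fst \<theta>) \<le> e" "norm (R ** snd \<theta>) \<le> e" using assms by simp_all
  then show "0 \<le> e" using norm_ge_zero order_trans by blast
qed

lemma norm_R_le: "norm (R *v x) \<le> sqrt (opnorm S) * norm x"
proof (rule power2_le_imp_le)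
  have o: "norm (S *v x) \<le> opnorm S * norm x"
    unfolding opnorm_def by (rule onorm[OF matrix_vector_mul_bounded_linear])
  have o0: "0 \<le> opnorm S" unfolding opnorm_def by (rule onorm_pos_le[OF matrix_vector_mul_bounded_linear])
  have "(norm (R *v x))\<^sup>2 = x \<bullet> (S *v x)"
    unfolding power2_norm_eq_inner inner_symmetric_matrix[OF R_sym, symmetric] by (simp add: matrix_vector_mul_assoc R_sq)
  also have "\<dots> \<le> norm x * norm (S *v x)" by (rule norm_cauchy_schwarz)
  also have "\<dots> \<le> norm x * (opnorm S * norm x)" by (intro mult_left_mono o) simp
  also have "\<dots> = (sqrt (opnorm S) * norm x)\<^sup>2" using o0 by (simp add: power_mult_distrib power2_eq_square)
  finally show "(norm (R *v x))\<^sup>2 \<le> (sqrt (opnorm S) * norm x)\<^sup>2" .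
  show "0 \<le> sqrt (opnorm S) * norm x" using o0 by simp
qed

lemma opnorm_pos: "0 < sqrt (opnorm S)"
proof (rule ccontr)
  assume "\<not> 0 < sqrt (opnorm S)"
  then have le0: "sqrt (opnorm S) * norm x \<le> 0" for x :: "real^'d" by (simp add: mult_nonpos_nonneg)
  have "R *v x = 0" for x using order_trans[OF norm_R_le le0, of x] by simp
  then have "x = 0" for x :: "real^'d" using R_inv_vec(2)[of x] by simp
  from this[of "axis undefined 1"] show False by (simp add: axis_eq_0_iff)
qed

lemma near_S_set_bounds:
  fixes U :: "real^'d^'p" and G V :: "real^'d^'d" and \<theta> :: "('d, 'p) param"
  assumes V: "transpose V ** V = mat 1" and G: "\<And>i. 0 < G $ i $ i"
    and \<theta>': "\<theta>' \<in> S_set S U G V"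
    and near: "Pnorm S (\<theta> - \<theta>') \<le> e"
    and e_def: "e = 1 / (2 * sqrt (opnorm S)) * (1 / 16 - sqrt (Max (range (\<lambda>i. G $ i $ i))))"
  defines "\<kappa> \<equiv> \<bar>e\<bar> + norm (matrix_inv R) * \<bar>e\<bar>
     + norm U * norm (diag_sqrt G) * sqrt (real CARD('d)) * norm (matrix_inv R)
     + norm (matrix_inv R) * norm V * norm (diag_sqrt G) * sqrt (real CARD('d)) * norm (matrix_inv R)"
  shows "norm (R *v (snd \<theta> *v (R *v g))) \<le> norm g / 16"
    and "norm (fst \<theta>) \<le> \<kappa>" "norm (snd \<theta>) \<le> \<kappa>"
proof -
  let ?Q = "matrix_inv R"
  define \<sigma> where "\<sigma> = sqrt (Max (range (\<lambda>i. G $ i $ i)))"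
  obtain J where J: "orthogonal_matrix J" and A': "fst \<theta>' = U ** diag_sqrt G ** transpose J ** ?Q"
    and B': "snd \<theta>' = ?Q ** V ** diag_sqrt G ** transpose J ** ?Q"
    using \<theta>' unfolding S_set_def R_def by auto
  note P = Pnorm_bounds[OF near]
  have dA: "norm (fst \<theta> - fst \<theta>') \<le> e" and dB: "norm (R ** (snd \<theta> - snd \<theta>')) \<le> e" and e0: "0 \<le> e"
    using P by simp_all
  have tJ: "transpose (transpose J) ** transpose J = mat 1" using J by (simp add: orthogonal_matrix_def)
  have nJ: "norm (transpose J) \<le> sqrt (real CARD('d))" using norm_orthogonal_matrix[OF J] by (simp add: norm_transpose)
  have eo: "e * sqrt (opnorm S) = (1 / 16 - \<sigma>) / 2" using opnorm_pos by (simp add: \<sigma>_def e_def)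
  have \<sigma>: "\<sigma> \<le> 1 / 16"
  proof -
    have "0 \<le> e * sqrt (opnorm S)" using e0 opnorm_pos by simp
    then show ?thesis unfolding eo by simp
  qed
  have "R *v (snd \<theta>' *v (R *v g)) = (R ** snd \<theta>' ** R) *v g" by (simp only: matrix_vector_mul_assoc matrix_mul_assoc)
  also have "R ** snd \<theta>' ** R = (R ** ?Q) ** V ** diag_sqrt G ** transpose J ** (?Q ** R)"
    unfolding B' by (simp only: matrix_mul_assoc)
  also have "\<dots> = V ** diag_sqrt G ** transpose J" by (simp add: R_inv)
  also have "\<dots> *v g = V *v (diag_sqrt G *v (transpose J *v g))" by (simp only: matrix_vector_mul_assoc matrix_mul_assoc)
  finally have "norm (R *v (snd \<theta>' *v (R *v g))) = norm (diag_sqrt G *v (transpose J *v g))"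
    by (simp only: norm_isometry[OF V])
  also have "\<dots> \<le> \<sigma> * norm (transpose J *v g)" unfolding \<sigma>_def by (rule norm_diag_sqrt_mult_le[OF G])
  also have "\<dots> = \<sigma> * norm g" by (simp only: norm_isometry[OF tJ])
  finally have 1: "norm (R *v (snd \<theta>' *v (R *v g))) \<le> \<sigma> * norm g" .
  have "norm (R *v ((snd \<theta> - snd \<theta>') *v (R *v g))) = norm ((R ** (snd \<theta> - snd \<theta>')) *v (R *v g))"
    by (simp only: matrix_vector_mul_assoc matrix_mul_assoc)
  also have "\<dots> \<le> e * (sqrt (opnorm S) * norm g)"
    using e0 by (intro order_trans[OF norm_matrix_vector_mult_le] mult_mono dB norm_R_le) auto
  also have "\<dots> = (1 / 16 - \<sigma>) / 2 * norm g" unfolding eo[symmetric] by simp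
  finally have 2: "norm (R *v ((snd \<theta> - snd \<theta>') *v (R *v g))) \<le> (1 / 16 - \<sigma>) / 2 * norm g" .
  have "R *v (snd \<theta> *v (R *v g)) = R *v (snd \<theta>' *v (R *v g)) + R *v ((snd \<theta> - snd \<theta>') *v (R *v g))"
    by (simp add: matrix_vector_mult_diff_rdistrib matrix_vector_right_distrib[symmetric])
  then have "norm (R *v (snd \<theta> *v (R *v g))) \<le> \<sigma> * norm g + (1 / 16 - \<sigma>) / 2 * norm g"
    using norm_triangle_le[OF add_mono[OF 1 2]] by simp
  also have "\<dots> = (\<sigma> + (1 / 16 - \<sigma>) / 2) * norm g" by (simp only: distrib_right)
  also have "\<dots> \<le> (1 / 16) * norm g"
  proof (rule mult_right_mono)
    have "\<sigma> + (1 / 16 - \<sigma>) / 2 = 1 / 32 + \<sigma> / 2" by (simp add: diff_divide_distrib)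
    also have "\<dots> \<le> 1 / 16" using \<sigma> by simp
    finally show "\<sigma> + (1 / 16 - \<sigma>) / 2 \<le> 1 / 16" .
  qed simp
  finally show "norm (R *v (snd \<theta> *v (R *v g))) \<le> norm g / 16" by simp
  have a': "norm (fst \<theta>') \<le> norm U * norm (diag_sqrt G) * sqrt (real CARD('d)) * norm ?Q"
    unfolding A' by (intro norm_matrix_mult_mono nJ order_refl)
  have b': "norm (snd \<theta>') \<le> norm ?Q * norm V * norm (diag_sqrt G) * sqrt (real CARD('d)) * norm ?Q"
    unfolding B' by (intro norm_matrix_mult_mono nJ order_refl)
  have nn: "0 \<le> norm ?Q * \<bar>e\<bar>" "0 \<le> norm U * norm (diag_sqrt G) * sqrt (real CARD('d)) * norm ?Q"
    "0 \<le> norm ?Q * norm V * norm (diag_sqrt G) * sqrt (real CARD('d)) * norm ?Q" by simp_all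
  show "norm (fst \<theta>) \<le> \<kappa>"
    using norm_triangle_ineq2[of "fst \<theta>" "fst \<theta>'"] dA a' nn unfolding \<kappa>_def by linarith
  have "snd \<theta> - snd \<theta>' = ?Q ** (R ** (snd \<theta> - snd \<theta>'))" by (simp add: matrix_mul_assoc R_inv)
  then have "norm (snd \<theta> - snd \<theta>') \<le> norm ?Q * e"
    using norm_matrix_mult_mono[OF order_refl dB, of ?Q] by simp
  also have "\<dots> \<le> norm ?Q * \<bar>e\<bar>" by (intro mult_left_mono) auto
  finally have "norm (snd \<theta> - snd \<theta>') \<le> norm ?Q * \<bar>e\<bar>" .
  then show "norm (snd \<theta>) \<le> \<kappa>"
    using norm_triangle_ineq2[of "snd \<theta>" "snd \<theta>'"] b' nn abs_ge_zero[of e] unfolding \<kappa>_def by linarith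
qed

end

theorem theorem3:
  fixes M :: "real^'d^'p" and \<Sigma> :: "real^'d^'d"
    and U :: "real^'d^'p" and G :: "real^'d^'d" and V :: "real^'d^'d"
  assumes psd: "psd_mat \<Sigma>" and full: "invertible \<Sigma>"
    and pd: "CARD('d) \<le> CARD('p)"
    and colrank: "rank (M ** msqrt \<Sigma>) = CARD('d)"
    and small: "opnorm (M ** msqrt \<Sigma>) < 1 / 16"
    and svd: "M ** msqrt \<Sigma> = U ** G ** transpose V"
      "transpose U ** U = mat 1" "transpose V ** V = mat 1"
      "diag_mat G" "\<forall>i. 0 < G $ i $ i"
  shows "\<exists>C. \<forall>\<Omega> :: real^'p^'p. psd_mat \<Omega> \<longrightarrow>
    (let \<epsilon>\<^sub>1 = 1 / (2 * sqrt (opnorm \<Sigma>)) * (1 / 16 - sqrt (Max (range (\<lambda>i. G $ i $ i))))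
     in \<exists>N. \<forall>n \<ge> N. \<forall>\<theta>. (\<exists>\<theta>'\<in>S_set \<Sigma> U G V. Pnorm \<Sigma> (\<theta> - \<theta>') \<le> \<epsilon>\<^sub>1) \<longrightarrow>
          (norm (exp_grad_Qhat M \<Sigma> \<Omega> n \<theta> - grad (Qpop M \<Sigma> \<Omega>) \<theta>))\<^sup>2
            \<le> C * (ln (real n)) ^ 6 / (real n)\<^sup>2)"
proof (intro exI[of _ 1] allI impI)
  fix \<Omega> :: "real^'p^'p"
  assume "psd_mat \<Omega>"
  interpret attention_model M \<Sigma> \<Omega> using psd full by unfold_locales
  define e where "e = 1 / (2 * sqrt (opnorm \<Sigma>)) * (1 / 16 - sqrt (Max (range (\<lambda>i. G $ i $ i))))"
  define \<kappa> where "\<kappa> = \<bar>e\<bar> + norm (matrix_inv R) * \<bar>e\<bar>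
     + norm U * norm (diag_sqrt G) * sqrt (real CARD('d)) * norm (matrix_inv R)
     + norm (matrix_inv R) * norm V * norm (diag_sqrt G) * sqrt (real CARD('d)) * norm (matrix_inv R)"
  define K where "K = real (card (Basis :: ('d, 'p) param set))
    * (960 * bias_const \<kappa> * (\<integral>s. \<phi> s ^ 63 \<partial>sample_dist M \<Sigma> \<Omega>) ^ 8)"
  define N where "N = max 8 (nat \<lceil>exp (max 1 K)\<rceil>)"
  have G: "0 < G $ i $ i" for i using svd(5) by simp
  have \<kappa>: "0 \<le> \<kappa>" unfolding \<kappa>_def by simp
  have bound: "(norm (exp_grad_Qhat M \<Sigma> \<Omega> n \<theta> - grad (Qpop M \<Sigma> \<Omega>) \<theta>))\<^sup>2 \<le> 1 * (ln (real n)) ^ 6 / (real n)\<^sup>2"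
    if n: "N \<le> n" and \<theta>': "\<theta>' \<in> S_set \<Sigma> U G V" "Pnorm \<Sigma> (\<theta> - \<theta>') \<le> e" for n \<theta> \<theta>'
  proof -
    have n8: "8 \<le> n" and n0: "0 < real n" using n by (auto simp: N_def)
    have "exp (max 1 K) \<le> real n" using n unfolding N_def by linarith
    then have ln: "max 1 K \<le> ln (real n)" by (simp only: ln_ge_iff[OF n0])
    note bounds = near_S_set_bounds[OF svd(3) G \<theta>' e_def, folded \<kappa>_def]
    have "norm (exp_grad_Qhat M \<Sigma> \<Omega> n \<theta> - grad (Qpop M \<Sigma> \<Omega>) \<theta>) \<le> K / real n"
      unfolding K_def by (rule exp_grad_bias[OF bounds \<kappa> n8])
    also have "\<dots> \<le> ln (real n) / real n" using ln n0 by (intro divide_right_mono) auto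
    finally have "(norm (exp_grad_Qhat M \<Sigma> \<Omega> n \<theta> - grad (Qpop M \<Sigma> \<Omega>) \<theta>))\<^sup>2 \<le> (ln (real n) / real n)\<^sup>2"
      by (rule power_mono) simp
    also have "\<dots> = (ln (real n)) ^ 2 / (real n)\<^sup>2" by (rule power_divide)
    also have "\<dots> \<le> (ln (real n)) ^ 6 / (real n)\<^sup>2"
      using ln by (intro divide_right_mono power_increasing) auto
    finally show ?thesis by simp
  qed
  show "let \<epsilon>\<^sub>1 = 1 / (2 * sqrt (opnorm \<Sigma>)) * (1 / 16 - sqrt (Max (range (\<lambda>i. G $ i $ i))))
     in \<exists>N. \<forall>n \<ge> N. \<forall>\<theta>. (\<exists>\<theta>'\<in>S_set \<Sigma> U G V. Pnorm \<Sigma> (\<theta> - \<theta>') \<le> \<epsilon>\<^sub>1) \<longrightarrow>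
          (norm (exp_grad_Qhat M \<Sigma> \<Omega> n \<theta> - grad (Qpop M \<Sigma> \<Omega>) \<theta>))\<^sup>2
            \<le> 1 * (ln (real n)) ^ 6 / (real n)\<^sup>2"
    unfolding Let_def e_def[symmetric] by (intro exI[of _ N] allI impI, elim bexE) (rule bound)
qed

end
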